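(* Let $\mathcal B$ be a Krull–Schmidt exact category with enough projectives and enough injectives, and let $(\mathcal S,\mathcal T),(\mathcal U,\mathcal V)$ be a twin cotorsion pair on $\mathcal B$ satisfying $\mathcal U\subseteq\mathcal T$ or $\mathcal T\subseteq\mathcal U$. Then the heart $\underline{\mathcal H}=\mathcal H/\mathcal W$ is integral and almost abelian.
   Context: Exact category is meant in the sense of Quillen (the class of short exact sequences is closed under isomorphisms, direct sums and direct summands); $X\rightarrowtail Y\twoheadrightarrow Z$ denotes a short exact sequence of the exact structure. For subcategories $\mathcal C,\mathcal D$, $\mathrm{Ext}^1_{\mathcal B}(\mathcal C,\mathcal D)=0$ means $\mathrm{Ext}^1_{\mathcal B}(C,D)=0$ for all $C\in\mathcal C$, $D\in\mathcal D$. Cotorsion pair: a pair $(\mathcal U,\mathcal V)$ of full additive subcategories of $\mathcal B$, closed under direct summands, such that $\mathrm{Ext}^1_{\mathcal B}(\mathcal U,\mathcal V)=0$ and every $B\in\mathcal B$ admits short exact sequences $V_B\rightarrowtail U_B\twoheadrightarrow B$ and $B\rightarrowtail V^B\twoheadrightarrow U^B$ with $U_B,U^B\in\mathcal U$, $V_B,V^B\in\mathcal V$. Twin cotorsion pair: a pair of cotorsion pairs $(\mathcal S,\mathcal T),(\mathcal U,\mathcal V)$ with $\mathcal S\subseteq\mathcal U$. For a twin cotorsion pair put $\mathcal W=\mathcal T\cap\mathcal U$. $\mathcal B^+$ is the full subcategory of objects $B$ admitting a short exact sequence $V_B\rightarrowtail U_B\twoheadrightarrow B$ with $U_B\in\mathcal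 W$, $V_B\in\mathcal V$. $\mathcal B^-$ is the full subcategory of objects $B$ admitting a short exact sequence $B\rightarrowtail T^B\twoheadrightarrow S^B$ with $T^B\in\mathcal W$, $S^B\in\mathcal S$. Put $\mathcal H=\mathcal B^+\cap\mathcal B^-\supseteq\mathcal W$. The heart is the additive quotient category $\underline{\mathcal H}=\mathcal H/\mathcal W$ (morphisms modulo those factoring through an object of $\mathcal W$). Preabelian: additive with all kernels and cokernels. A morphism is called a cokernel (kernel) if it is a cokernel (kernel) of some morphism. Consider pull-back squares with $\alpha:A\to B$, $\beta:A\to C$, $\gamma:B\to D$, $\delta:C\to D$, $\gamma\alpha=\delta\beta$. A preabelian category is left integral if in every such square $\alpha$ is an epimorphism whenever $\delta$ is an epimorphism; it is left almost abelian if in every such square $\alpha$ is a cokernel whenever $\delta$ is a cokernel. Right integral and right almost abelian are defined dually. Integral means both left and right integral; almost abelian means both left and right almost abelian. *)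

theory Defs
  imports "HOL-Algebra.Ideal"
begin

section \<open>Additive categories\<close>

text \<open>
  A category enriched in abelian groups is given by a set of objects and a set of arrows with
  domain and codomain. \<open>g \<cdot>\<^bsub>C\<^esub> f\<close> is the composite of \<open>f\<close> followed by \<open>g\<close>. The operations are only
  meaningful on composable (resp. parallel) arrows. \<open>Zer C A B\<close> is the zero arrow from \<open>A\<close> to \<open>B\<close>.
\<close>

record ('o, 'm) acat =
  Obj :: "'o set"
  Arr :: "'m set"
  Dom :: "'m \<Rightarrow> 'o"
  Cod :: "'m \<Rightarrow> 'o"
  Ide :: "'o \<Rightarrow> 'm"
  Cmp :: "'m \<Rightarrow> 'm \<Rightarrow> 'm"  (infixl "\<cdot>\<index>" 70)
  Zer :: "'o \<Rightarrow> 'o \<Rightarrow> 'm"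
  Sum :: "'m \<Rightarrow> 'm \<Rightarrow> 'm"  (infixl "\<boxplus>\<index>" 65)

definition Hom :: "('o, 'm) acat \<Rightarrow> 'o \<Rightarrow> 'o \<Rightarrow> 'm set" where
  "Hom C A B = {f \<in> Arr C. Dom C f = A \<and> Cod C f = B}"

definition hom_group :: "('o, 'm) acat \<Rightarrow> 'o \<Rightarrow> 'o \<Rightarrow> 'm monoid" where
  "hom_group C A B = \<lparr>carrier = Hom C A B, monoid.mult = Sum C, one = Zer C A B\<rparr>"

definition end_ring :: "('o, 'm) acat \<Rightarrow> 'o \<Rightarrow> 'm ring" where
  "end_ring C A = \<lparr>carrier = Hom C A A, monoid.mult = Cmp C, one = Ide C A,
     ring.zero = Zer C A A, ring.add = Sum C\<rparr>"

locale category =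
  fixes C :: "('o, 'm) acat" (structure)
  assumes Dom_closed: "f \<in> Arr C \<Longrightarrow> Dom C f \<in> Obj C"
    and Cod_closed: "f \<in> Arr C \<Longrightarrow> Cod C f \<in> Obj C"
    and Ide_closed: "A \<in> Obj C \<Longrightarrow> Ide C A \<in> Hom C A A"
    and Cmp_closed: "\<lbrakk>f \<in> Hom C X Y; g \<in> Hom C Y Z\<rbrakk> \<Longrightarrow> g \<cdot> f \<in> Hom C X Z"
    and Cmp_Ide_right: "f \<in> Hom C X Y \<Longrightarrow> f \<cdot> Ide C X = f"
    and Cmp_Ide_left: "f \<in> Hom C X Y \<Longrightarrow> Ide C Y \<cdot> f = f"
    and Cmp_assoc: "\<lbrakk>f \<in> Hom C X Y; g \<in> Hom C Y Z; h \<in> Hom C Z Z'\<rbrakk>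
      \<Longrightarrow> (h \<cdot> g) \<cdot> f = h \<cdot> (g \<cdot> f)"

locale preadditive_category = category +
  assumes hom_comm_group:
      "\<lbrakk>A \<in> Obj C; B \<in> Obj C\<rbrakk> \<Longrightarrow> comm_group (hom_group C A B)"
    and Cmp_Sum_right: "\<lbrakk>f \<in> Hom C X Y; f' \<in> Hom C X Y; g \<in> Hom C Y Z\<rbrakk>
      \<Longrightarrow> g \<cdot> (f \<boxplus> f') = (g \<cdot> f) \<boxplus> (g \<cdot> f')"
    and Cmp_Sum_left: "\<lbrakk>f \<in> Hom C X Y; g \<in> Hom C Y Z; g' \<in> Hom C Y Z\<rbrakk>
      \<Longrightarrow> (g \<boxplus> g') \<cdot> f = (g \<cdot> f) \<boxplus> (g' \<cdot> f)"

definition is_zero_obj :: "('o, 'm) acat \<Rightarrow> 'o \<Rightarrow> bool" where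
  "is_zero_obj C Z \<longleftrightarrow> Z \<in> Obj C \<and>
     (\<forall>A \<in> Obj C. (\<exists>!f. f \<in> Hom C A Z) \<and> (\<exists>!f. f \<in> Hom C Z A))"

definition is_biprod ::
    "('o, 'm) acat \<Rightarrow> 'o \<Rightarrow> 'o \<Rightarrow> 'o \<Rightarrow> 'm \<Rightarrow> 'm \<Rightarrow> 'm \<Rightarrow> 'm \<Rightarrow> bool" where
  "is_biprod C A B P \<iota>\<^sub>1 \<iota>\<^sub>2 \<pi>\<^sub>1 \<pi>\<^sub>2 \<longleftrightarrow>
     A \<in> Obj C \<and> B \<in> Obj C \<and> P \<in> Obj C \<and>
     \<iota>\<^sub>1 \<in> Hom C A P \<and> \<iota>\<^sub>2 \<in> Hom C B P \<and> \<pi>\<^sub>1 \<in> Hom C P A \<and> \<pi>\<^sub>2 \<in> Hom C P B \<and>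
     \<pi>\<^sub>1 \<cdot>\<^bsub>C\<^esub> \<iota>\<^sub>1 = Ide C A \<and> \<pi>\<^sub>2 \<cdot>\<^bsub>C\<^esub> \<iota>\<^sub>2 = Ide C B \<and>
     \<pi>\<^sub>2 \<cdot>\<^bsub>C\<^esub> \<iota>\<^sub>1 = Zer C A B \<and> \<pi>\<^sub>1 \<cdot>\<^bsub>C\<^esub> \<iota>\<^sub>2 = Zer C B A \<and>
     (\<iota>\<^sub>1 \<cdot>\<^bsub>C\<^esub> \<pi>\<^sub>1) \<boxplus>\<^bsub>C\<^esub> (\<iota>\<^sub>2 \<cdot>\<^bsub>C\<^esub> \<pi>\<^sub>2) = Ide C P"

definition is_direct_sum :: "('o, 'm) acat \<Rightarrow> 'o \<Rightarrow> 'o \<Rightarrow> 'o \<Rightarrow> bool" where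
  "is_direct_sum C A B P \<longleftrightarrow> (\<exists>\<iota>\<^sub>1 \<iota>\<^sub>2 \<pi>\<^sub>1 \<pi>\<^sub>2. is_biprod C A B P \<iota>\<^sub>1 \<iota>\<^sub>2 \<pi>\<^sub>1 \<pi>\<^sub>2)"

locale additive_category = preadditive_category +
  assumes ex_zero_obj: "\<exists>Z. is_zero_obj C Z"
    and ex_direct_sum: "\<lbrakk>A \<in> Obj C; B \<in> Obj C\<rbrakk> \<Longrightarrow> \<exists>P. is_direct_sum C A B P"

definition full_subcat :: "('o, 'm) acat \<Rightarrow> 'o set \<Rightarrow> ('o, 'm) acat" where
  "full_subcat C \<H> =
     C\<lparr>Obj := Obj C \<inter> \<H>, Arr := {f \<in> Arr C. Dom C f \<in> \<H> \<and> Cod C f \<in> \<H>}\<rparr>"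

definition is_iso :: "('o, 'm) acat \<Rightarrow> 'm \<Rightarrow> bool" where
  "is_iso C f \<longleftrightarrow> f \<in> Arr C \<and> (\<exists>g \<in> Hom C (Cod C f) (Dom C f).
     g \<cdot>\<^bsub>C\<^esub> f = Ide C (Dom C f) \<and> f \<cdot>\<^bsub>C\<^esub> g = Ide C (Cod C f))"


section \<open>The additive quotient by a class of objects\<close>

definition factors_through :: "('o, 'm) acat \<Rightarrow> 'o set \<Rightarrow> 'm \<Rightarrow> bool" where
  "factors_through C \<W> h \<longleftrightarrow> h \<in> Arr C \<and> (\<exists>W \<in> \<W>. \<exists>u \<in> Hom C (Dom C h) W.
     \<exists>v \<in> Hom C W (Cod C h). h = v \<cdot>\<^bsub>C\<^esub> u)"

definition quot_rel :: "('o, 'm) acat \<Rightarrow> 'o set \<Rightarrow> ('m \<times> 'm) set" where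
  "quot_rel C \<W> = {(f, g). f \<in> Arr C \<and> g \<in> Hom C (Dom C f) (Cod C f) \<and>
     (\<exists>h \<in> Hom C (Dom C f) (Cod C f). factors_through C \<W> h \<and> g = f \<boxplus>\<^bsub>C\<^esub> h)}"

text \<open>
  Arrows of the quotient are the congruence classes; all members of a class are parallel, so that
  its domain and codomain are the unique elements of the sets used below.
\<close>

definition quot_cat :: "('o, 'm) acat \<Rightarrow> 'o set \<Rightarrow> ('o, 'm set) acat" where
  "quot_cat C \<W> = \<lparr>
     Obj = Obj C,
     Arr = Arr C // quot_rel C \<W>,
     Dom = (\<lambda>F. the_elem (Dom C ` F)),
     Cod = (\<lambda>F. the_elem (Cod C ` F)),
     Ide = (\<lambda>A. quot_rel C \<W> `` {Ide C A}),
     Cmp = (\<lambda>G F. quot_rel C \<W> `` {g \<cdot>\<^bsub>C\<^esub> f | g f. g \<in> G \<and> f \<in> F}),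
     Zer = (\<lambda>A B. quot_rel C \<W> `` {Zer C A B}),
     Sum = (\<lambda>F G. quot_rel C \<W> `` {f \<boxplus>\<^bsub>C\<^esub> g | f g. f \<in> F \<and> g \<in> G})\<rparr>"


section \<open>Krull--Schmidt categories\<close>

definition is_local_ring :: "('a, 'x) ring_scheme \<Rightarrow> bool" where
  "is_local_ring R \<longleftrightarrow> ring R \<and> ideal (carrier R - Units R) R"

definition is_finite_direct_sum ::
    "('o, 'm) acat \<Rightarrow> nat \<Rightarrow> (nat \<Rightarrow> 'o) \<Rightarrow> 'o \<Rightarrow> bool" where
  "is_finite_direct_sum C n X A \<longleftrightarrow> A \<in> Obj C \<and> (\<forall>i<n. X i \<in> Obj C) \<and>
     (\<exists>\<iota> \<pi>. (\<forall>i<n. \<iota> i \<in> Hom C (X i) A \<and> \<pi> i \<in> Hom C A (X i)) \<and>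
       (\<forall>i<n. \<forall>j<n. \<pi> i \<cdot>\<^bsub>C\<^esub> \<iota> j = (if i = j then Ide C (X i) else Zer C (X j) (X i))) \<and>
       finprod (hom_group C A A) (\<lambda>i. \<iota> i \<cdot>\<^bsub>C\<^esub> \<pi> i) {..<n} = Ide C A)"

locale krull_schmidt_category = additive_category +
  assumes krull_schmidt: "A \<in> Obj C \<Longrightarrow>
    \<exists>n X. is_finite_direct_sum C n X A \<and> (\<forall>i<n. is_local_ring (end_ring C (X i)))"


section \<open>Limits, integral and almost abelian categories\<close>

definition is_mono :: "('o, 'm) acat \<Rightarrow> 'm \<Rightarrow> bool" where
  "is_mono C f \<longleftrightarrow> f \<in> Arr C \<and> (\<forall>Z. \<forall>x \<in> Hom C Z (Dom C f). \<forall>y \<in> Hom C Z (Dom C f).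
     f \<cdot>\<^bsub>C\<^esub> x = f \<cdot>\<^bsub>C\<^esub> y \<longrightarrow> x = y)"

definition is_epi :: "('o, 'm) acat \<Rightarrow> 'm \<Rightarrow> bool" where
  "is_epi C f \<longleftrightarrow> f \<in> Arr C \<and> (\<forall>Z. \<forall>x \<in> Hom C (Cod C f) Z. \<forall>y \<in> Hom C (Cod C f) Z.
     x \<cdot>\<^bsub>C\<^esub> f = y \<cdot>\<^bsub>C\<^esub> f \<longrightarrow> x = y)"

definition is_kernel_of :: "('o, 'm) acat \<Rightarrow> 'm \<Rightarrow> 'm \<Rightarrow> bool" where
  "is_kernel_of C k f \<longleftrightarrow> k \<in> Arr C \<and> f \<in> Arr C \<and> Cod C k = Dom C f \<and>
     f \<cdot>\<^bsub>C\<^esub> k = Zer C (Dom C k) (Cod C f) \<and>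
     (\<forall>Z. \<forall>x \<in> Hom C Z (Dom C f). f \<cdot>\<^bsub>C\<^esub> x = Zer C Z (Cod C f) \<longrightarrow>
       (\<exists>!u. u \<in> Hom C Z (Dom C k) \<and> k \<cdot>\<^bsub>C\<^esub> u = x))"

definition is_cokernel_of :: "('o, 'm) acat \<Rightarrow> 'm \<Rightarrow> 'm \<Rightarrow> bool" where
  "is_cokernel_of C c f \<longleftrightarrow> c \<in> Arr C \<and> f \<in> Arr C \<and> Dom C c = Cod C f \<and>
     c \<cdot>\<^bsub>C\<^esub> f = Zer C (Dom C f) (Cod C c) \<and>
     (\<forall>Z. \<forall>x \<in> Hom C (Cod C f) Z. x \<cdot>\<^bsub>C\<^esub> f = Zer C (Dom C f) Z \<longrightarrow>
       (\<exists>!u. u \<in> Hom C (Cod C c) Z \<and> u \<cdot>\<^bsub>C\<^esub> c = x))"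

definition is_kernel :: "('o, 'm) acat \<Rightarrow> 'm \<Rightarrow> bool" where
  "is_kernel C k \<longleftrightarrow> (\<exists>f. is_kernel_of C k f)"

definition is_cokernel :: "('o, 'm) acat \<Rightarrow> 'm \<Rightarrow> bool" where
  "is_cokernel C c \<longleftrightarrow> (\<exists>f. is_cokernel_of C c f)"

text \<open>
  The squares below consist of \<open>\<alpha> : A \<rightarrow> B\<close>, \<open>\<beta> : A \<rightarrow> C\<close>, \<open>\<gamma> : B \<rightarrow> D\<close>, \<open>\<delta> : C \<rightarrow> D\<close>
  with \<open>\<gamma> \<alpha> = \<delta> \<beta>\<close>.
\<close>

definition is_comm_square :: "('o, 'm) acat \<Rightarrow> 'm \<Rightarrow> 'm \<Rightarrow> 'm \<Rightarrow> 'm \<Rightarrow> bool" where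
  "is_comm_square C \<alpha> \<beta> \<gamma> \<delta> \<longleftrightarrow>
     \<alpha> \<in> Arr C \<and> \<beta> \<in> Arr C \<and> \<gamma> \<in> Arr C \<and> \<delta> \<in> Arr C \<and>
     Dom C \<alpha> = Dom C \<beta> \<and> Cod C \<alpha> = Dom C \<gamma> \<and> Cod C \<beta> = Dom C \<delta> \<and> Cod C \<gamma> = Cod C \<delta> \<and>
     \<gamma> \<cdot>\<^bsub>C\<^esub> \<alpha> = \<delta> \<cdot>\<^bsub>C\<^esub> \<beta>"

definition is_pullback :: "('o, 'm) acat \<Rightarrow> 'm \<Rightarrow> 'm \<Rightarrow> 'm \<Rightarrow> 'm \<Rightarrow> bool" where
  "is_pullback C \<alpha> \<beta> \<gamma> \<delta> \<longleftrightarrow> is_comm_square C \<alpha> \<beta> \<gamma> \<delta> \<and>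
     (\<forall>Z. \<forall>x \<in> Hom C Z (Dom C \<gamma>). \<forall>y \<in> Hom C Z (Dom C \<delta>).
       \<gamma> \<cdot>\<^bsub>C\<^esub> x = \<delta> \<cdot>\<^bsub>C\<^esub> y \<longrightarrow>
       (\<exists>!u. u \<in> Hom C Z (Dom C \<alpha>) \<and> \<alpha> \<cdot>\<^bsub>C\<^esub> u = x \<and> \<beta> \<cdot>\<^bsub>C\<^esub> u = y))"

definition is_pushout :: "('o, 'm) acat \<Rightarrow> 'm \<Rightarrow> 'm \<Rightarrow> 'm \<Rightarrow> 'm \<Rightarrow> bool" where
  "is_pushout C \<alpha> \<beta> \<gamma> \<delta> \<longleftrightarrow> is_comm_square C \<alpha> \<beta> \<gamma> \<delta> \<and>
     (\<forall>Z. \<forall>x \<in> Hom C (Cod C \<alpha>) Z. \<forall>y \<in> Hom C (Cod C \<beta>) Z.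
       x \<cdot>\<^bsub>C\<^esub> \<alpha> = y \<cdot>\<^bsub>C\<^esub> \<beta> \<longrightarrow>
       (\<exists>!u. u \<in> Hom C (Cod C \<gamma>) Z \<and> u \<cdot>\<^bsub>C\<^esub> \<gamma> = x \<and> u \<cdot>\<^bsub>C\<^esub> \<delta> = y))"

locale preabelian_category = additive_category +
  assumes ex_kernel: "f \<in> Arr C \<Longrightarrow> \<exists>k. is_kernel_of C k f"
    and ex_cokernel: "f \<in> Arr C \<Longrightarrow> \<exists>c. is_cokernel_of C c f"

locale left_integral_category = preabelian_category +
  assumes pullback_epi: "\<lbrakk>is_pullback C \<alpha> \<beta> \<gamma> \<delta>; is_epi C \<delta>\<rbrakk> \<Longrightarrow> is_epi C \<alpha>"

locale right_integral_category = preabelian_category +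
  assumes pushout_mono: "\<lbrakk>is_pushout C \<alpha> \<beta> \<gamma> \<delta>; is_mono C \<alpha>\<rbrakk> \<Longrightarrow> is_mono C \<delta>"

locale integral_category = left_integral_category + right_integral_category

locale left_almost_abelian_category = preabelian_category +
  assumes pullback_cokernel:
    "\<lbrakk>is_pullback C \<alpha> \<beta> \<gamma> \<delta>; is_cokernel C \<delta>\<rbrakk> \<Longrightarrow> is_cokernel C \<alpha>"

locale right_almost_abelian_category = preabelian_category +
  assumes pushout_kernel:
    "\<lbrakk>is_pushout C \<alpha> \<beta> \<gamma> \<delta>; is_kernel C \<alpha>\<rbrakk> \<Longrightarrow> is_kernel C \<delta>"

locale almost_abelian_category = left_almost_abelian_category + right_almost_abelian_category


section \<open>Exact categories\<close>

text \<open>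
  An exact structure is a set \<open>E\<close> of pairs \<open>(i, p)\<close>, the short exact sequences
  \<open>X \<rightarrowtail> Y \<twoheadrightarrow> Z\<close> with \<open>i : X \<rightarrow> Y\<close> and \<open>p : Y \<rightarrow> Z\<close>.
\<close>

definition seq :: "('o, 'm) acat \<Rightarrow> 'o \<Rightarrow> 'o \<Rightarrow> 'o \<Rightarrow> ('m \<times> 'm) set" where
  "seq C X Y Z = {(i, p). i \<in> Hom C X Y \<and> p \<in> Hom C Y Z}"

definition ses :: "('o, 'm) acat \<Rightarrow> ('m \<times> 'm) set \<Rightarrow> 'o \<Rightarrow> 'o \<Rightarrow> 'o \<Rightarrow> bool" where
  "ses C E X Y Z \<longleftrightarrow> E \<inter> seq C X Y Z \<noteq> {}"

definition is_seq_iso :: "('o, 'm) acat \<Rightarrow> 'm \<times> 'm \<Rightarrow> 'm \<times> 'm \<Rightarrow> bool" where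
  "is_seq_iso C s s' \<longleftrightarrow> (\<exists>X Y Z X' Y' Z' i p i' p' a b c.
     s = (i, p) \<and> s' = (i', p') \<and> s \<in> seq C X Y Z \<and> s' \<in> seq C X' Y' Z' \<and>
     a \<in> Hom C X X' \<and> b \<in> Hom C Y Y' \<and> c \<in> Hom C Z Z' \<and> is_iso C a \<and> is_iso C b \<and> is_iso C c \<and>
     b \<cdot>\<^bsub>C\<^esub> i = i' \<cdot>\<^bsub>C\<^esub> a \<and> c \<cdot>\<^bsub>C\<^esub> p = p' \<cdot>\<^bsub>C\<^esub> b)"

definition is_arr_sum :: "('o, 'm) acat \<Rightarrow>
    'm \<times> 'm \<times> 'm \<times> 'm \<Rightarrow> 'm \<times> 'm \<times> 'm \<times> 'm \<Rightarrow> 'm \<Rightarrow> 'm \<Rightarrow> 'm \<Rightarrow> bool" where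
  "is_arr_sum C = (\<lambda>(\<iota>\<^sub>1, \<iota>\<^sub>2, \<pi>\<^sub>1, \<pi>\<^sub>2) (\<iota>\<^sub>1', \<iota>\<^sub>2', \<pi>\<^sub>1', \<pi>\<^sub>2') f g h.
     h = (\<iota>\<^sub>1' \<cdot>\<^bsub>C\<^esub> f \<cdot>\<^bsub>C\<^esub> \<pi>\<^sub>1) \<boxplus>\<^bsub>C\<^esub> (\<iota>\<^sub>2' \<cdot>\<^bsub>C\<^esub> g \<cdot>\<^bsub>C\<^esub> \<pi>\<^sub>2))"

text \<open>
  \<open>is_seq_sum C s t r\<close>: the composable pair \<open>r\<close> is the termwise direct sum of the composable
  pairs \<open>s\<close> and \<open>t\<close>, for some choice of direct sums of their terms.
\<close>

definition is_seq_sum ::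
    "('o, 'm) acat \<Rightarrow> 'm \<times> 'm \<Rightarrow> 'm \<times> 'm \<Rightarrow> 'm \<times> 'm \<Rightarrow> bool" where
  "is_seq_sum C s t r \<longleftrightarrow> (\<exists>X Y Z X' Y' Z' X'' Y'' Z''
       a\<^sub>1 a\<^sub>2 a\<^sub>3 a\<^sub>4 b\<^sub>1 b\<^sub>2 b\<^sub>3 b\<^sub>4 c\<^sub>1 c\<^sub>2 c\<^sub>3 c\<^sub>4.
     s \<in> seq C X Y Z \<and> t \<in> seq C X' Y' Z' \<and> r \<in> seq C X'' Y'' Z'' \<and>
     is_biprod C X X' X'' a\<^sub>1 a\<^sub>2 a\<^sub>3 a\<^sub>4 \<and>
     is_biprod C Y Y' Y'' b\<^sub>1 b\<^sub>2 b\<^sub>3 b\<^sub>4 \<and>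
     is_biprod C Z Z' Z'' c\<^sub>1 c\<^sub>2 c\<^sub>3 c\<^sub>4 \<and>
     is_arr_sum C (a\<^sub>1, a\<^sub>2, a\<^sub>3, a\<^sub>4) (b\<^sub>1, b\<^sub>2, b\<^sub>3, b\<^sub>4) (fst s) (fst t) (fst r) \<and>
     is_arr_sum C (b\<^sub>1, b\<^sub>2, b\<^sub>3, b\<^sub>4) (c\<^sub>1, c\<^sub>2, c\<^sub>3, c\<^sub>4) (snd s) (snd t) (snd r))"

definition is_inflation :: "('m \<times> 'm) set \<Rightarrow> 'm \<Rightarrow> bool" where
  "is_inflation E i \<longleftrightarrow> (\<exists>p. (i, p) \<in> E)"

definition is_deflation :: "('m \<times> 'm) set \<Rightarrow> 'm \<Rightarrow> bool" where
  "is_deflation E p \<longleftrightarrow> (\<exists>i. (i, p) \<in> E)"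

text \<open>
  Quillen's axioms in the form given by Buehler (Exact categories, Definition 2.1). Closure under
  direct sums and summands is a consequence of the others; it is kept since it is often taken as
  part of the definition.
\<close>

locale exact_category = additive_category +
  fixes E :: "('m \<times> 'm) set"
  assumes ses_kernel: "(i, p) \<in> E \<Longrightarrow> is_kernel_of C i p"
    and ses_cokernel: "(i, p) \<in> E \<Longrightarrow> is_cokernel_of C p i"
    and ses_iso: "\<lbrakk>s \<in> E; is_seq_iso C s s'\<rbrakk> \<Longrightarrow> s' \<in> E"
    and ses_direct_sum: "\<lbrakk>s \<in> E; t \<in> E; is_seq_sum C s t r\<rbrakk> \<Longrightarrow> r \<in> E"
    and ses_direct_summand: "\<lbrakk>r \<in> E; is_seq_sum C s t r\<rbrakk> \<Longrightarrow> s \<in> E"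
    and inflation_Ide: "A \<in> Obj C \<Longrightarrow> is_inflation E (Ide C A)"
    and deflation_Ide: "A \<in> Obj C \<Longrightarrow> is_deflation E (Ide C A)"
    and inflation_Cmp: "\<lbrakk>is_inflation E f; is_inflation E g; Cod C f = Dom C g\<rbrakk>
      \<Longrightarrow> is_inflation E (g \<cdot> f)"
    and deflation_Cmp: "\<lbrakk>is_deflation E f; is_deflation E g; Cod C f = Dom C g\<rbrakk>
      \<Longrightarrow> is_deflation E (g \<cdot> f)"
    and inflation_pushout: "\<lbrakk>is_inflation E \<alpha>; \<beta> \<in> Arr C; Dom C \<alpha> = Dom C \<beta>\<rbrakk>
      \<Longrightarrow> \<exists>\<gamma> \<delta>. is_pushout C \<alpha> \<beta> \<gamma> \<delta> \<and> is_inflation E \<delta>"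
    and deflation_pullback: "\<lbrakk>is_deflation E \<delta>; \<gamma> \<in> Arr C; Cod C \<gamma> = Cod C \<delta>\<rbrakk>
      \<Longrightarrow> \<exists>\<alpha> \<beta>. is_pullback C \<alpha> \<beta> \<gamma> \<delta> \<and> is_deflation E \<alpha>"

definition is_projective :: "('o, 'm) acat \<Rightarrow> ('m \<times> 'm) set \<Rightarrow> 'o \<Rightarrow> bool" where
  "is_projective C E P \<longleftrightarrow> P \<in> Obj C \<and>
     (\<forall>p f. is_deflation E p \<longrightarrow> f \<in> Hom C P (Cod C p) \<longrightarrow>
       (\<exists>g \<in> Hom C P (Dom C p). p \<cdot>\<^bsub>C\<^esub> g = f))"

definition is_injective :: "('o, 'm) acat \<Rightarrow> ('m \<times> 'm) set \<Rightarrow> 'o \<Rightarrow> bool" where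
  "is_injective C E I \<longleftrightarrow> I \<in> Obj C \<and>
     (\<forall>i f. is_inflation E i \<longrightarrow> f \<in> Hom C (Dom C i) I \<longrightarrow>
       (\<exists>g \<in> Hom C (Cod C i) I. g \<cdot>\<^bsub>C\<^esub> i = f))"

definition enough_projectives :: "('o, 'm) acat \<Rightarrow> ('m \<times> 'm) set \<Rightarrow> bool" where
  "enough_projectives C E \<longleftrightarrow> (\<forall>B \<in> Obj C. \<exists>K P. is_projective C E P \<and> ses C E K P B)"

definition enough_injectives :: "('o, 'm) acat \<Rightarrow> ('m \<times> 'm) set \<Rightarrow> bool" where
  "enough_injectives C E \<longleftrightarrow> (\<forall>B \<in> Obj C. \<exists>I K. is_injective C E I \<and> ses C E B I K)"

text \<open>
  \<open>Ext1 C E X Y\<close> is the set of Yoneda classes of extensions \<open>Y \<rightarrowtail> M \<twoheadrightarrow> X\<close>; the zero of this group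
  is the class of the split extensions. Only vanishing matters here, so the Baer sum is not needed.
\<close>

definition extensions :: "('o, 'm) acat \<Rightarrow> ('m \<times> 'm) set \<Rightarrow> 'o \<Rightarrow> 'o \<Rightarrow> ('m \<times> 'm) set" where
  "extensions C E X Y = {s \<in> E. \<exists>M \<in> Obj C. s \<in> seq C Y M X}"

definition ext_rel ::
    "('o, 'm) acat \<Rightarrow> ('m \<times> 'm) set \<Rightarrow> 'o \<Rightarrow> 'o \<Rightarrow> (('m \<times> 'm) \<times> ('m \<times> 'm)) set" where
  "ext_rel C E X Y = {((i, p), (i', p')).
     (i, p) \<in> extensions C E X Y \<and> (i', p') \<in> extensions C E X Y \<and>
     (\<exists>h \<in> Hom C (Cod C i) (Cod C i'). is_iso C h \<and> h \<cdot>\<^bsub>C\<^esub> i = i' \<and> p' \<cdot>\<^bsub>C\<^esub> h = p)}"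

definition Ext1 :: "('o, 'm) acat \<Rightarrow> ('m \<times> 'm) set \<Rightarrow> 'o \<Rightarrow> 'o \<Rightarrow> ('m \<times> 'm) set set" where
  "Ext1 C E X Y = extensions C E X Y // ext_rel C E X Y"

definition Ext1_zero :: "('o, 'm) acat \<Rightarrow> ('m \<times> 'm) set \<Rightarrow> 'o \<Rightarrow> 'o \<Rightarrow> ('m \<times> 'm) set" where
  "Ext1_zero C E X Y =
     {(i, p) \<in> extensions C E X Y. \<exists>s r. is_biprod C Y X (Cod C i) i s r p}"


section \<open>Twin cotorsion pairs and their hearts\<close>

text \<open>Full subcategories are given by their sets of objects.\<close>

definition is_additive_subcat :: "('o, 'm) acat \<Rightarrow> 'o set \<Rightarrow> bool" where
  "is_additive_subcat C \<U> \<longleftrightarrow> \<U> \<subseteq> Obj C \<and> additive_category (full_subcat C \<U>)"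

definition closed_under_summands :: "('o, 'm) acat \<Rightarrow> 'o set \<Rightarrow> bool" where
  "closed_under_summands C \<U> \<longleftrightarrow> (\<forall>A B P. is_direct_sum C A B P \<longrightarrow> P \<in> \<U> \<longrightarrow> A \<in> \<U>)"

definition cotorsion_pair ::
    "('o, 'm) acat \<Rightarrow> ('m \<times> 'm) set \<Rightarrow> 'o set \<Rightarrow> 'o set \<Rightarrow> bool" where
  "cotorsion_pair C E \<U> \<V> \<longleftrightarrow>
     is_additive_subcat C \<U> \<and> closed_under_summands C \<U> \<and>
     is_additive_subcat C \<V> \<and> closed_under_summands C \<V> \<and>
     (\<forall>U \<in> \<U>. \<forall>V \<in> \<V>. Ext1 C E U V = {Ext1_zero C E U V}) \<and>
     (\<forall>B \<in> Obj C. (\<exists>V \<in> \<V>. \<exists>U \<in> \<U>. ses C E V U B) \<and> (\<exists>V \<in> \<V>. \<exists>U \<in> \<U>. ses C E B V U))"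

definition twin_cotorsion_pair ::
    "('o, 'm) acat \<Rightarrow> ('m \<times> 'm) set \<Rightarrow> 'o set \<Rightarrow> 'o set \<Rightarrow> 'o set \<Rightarrow> 'o set \<Rightarrow> bool" where
  "twin_cotorsion_pair C E \<S> \<T> \<U> \<V> \<longleftrightarrow>
     cotorsion_pair C E \<S> \<T> \<and> cotorsion_pair C E \<U> \<V> \<and> \<S> \<subseteq> \<U>"

definition B_plus ::
    "('o, 'm) acat \<Rightarrow> ('m \<times> 'm) set \<Rightarrow> 'o set \<Rightarrow> 'o set \<Rightarrow> 'o set" where
  "B_plus C E \<W> \<V> = {B \<in> Obj C. \<exists>V \<in> \<V>. \<exists>W \<in> \<W>. ses C E V W B}"

definition B_minus ::
    "('o, 'm) acat \<Rightarrow> ('m \<times> 'm) set \<Rightarrow> 'o set \<Rightarrow> 'o set \<Rightarrow> 'o set" where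
  "B_minus C E \<W> \<S> = {B \<in> Obj C. \<exists>W \<in> \<W>. \<exists>S \<in> \<S>. ses C E B W S}"

definition heart :: "('o, 'm) acat \<Rightarrow> ('m \<times> 'm) set \<Rightarrow>
    'o set \<Rightarrow> 'o set \<Rightarrow> 'o set \<Rightarrow> 'o set \<Rightarrow> ('o, 'm set) acat" where
  "heart C E \<S> \<T> \<U> \<V> =
     (let \<W> = \<T> \<inter> \<U>; \<H> = B_plus C E \<W> \<V> \<inter> B_minus C E \<W> \<S>
      in quot_cat (full_subcat C \<H>) \<W>)"

end

theory Submission
  imports Defs
begin

text \<open>
  The two cases of the hypothesis are dual. In the opposite category the twin cotorsion pair
  becomes \<open>(\<V>, \<U>), (\<T>, \<S>)\<close>, its heart is the opposite of the heart, and being integral and almost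
  abelian is self-dual. So let \<open>\<U> \<subseteq> \<T>\<close>. Then \<open>\<W> = \<U>\<close>, every object is in \<open>\<B>\<^sup>+\<close>, and \<open>\<H>\<close> consists of
  the objects \<open>A\<close> with a short exact sequence \<open>A \<rightarrowtail> U \<twoheadrightarrow> S\<close>. Call an arrow null if it factors through
  an object of \<open>\<U>\<close>.

  Vanishing of Ext means that arrows into \<open>\<U>\<close> and \<open>\<V>\<close> extend along inflations with cokernel in \<open>\<S>\<close>,
  and that arrows from \<open>\<U>\<close> and \<open>\<S>\<close> lift along deflations with kernel in \<open>\<V>\<close>. Therefore pushouts along
  the former and pullbacks along the latter keep their universal property modulo null arrows
  (\<open>null_pullback_cancel\<close>, \<open>pushout_construction\<close>). Pushing out \<open>A \<rightarrowtail> U\<close> along \<open>f : A \<rightarrow> B\<close> gives a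
  cokernel of \<open>f\<close> in the heart; pulling back \<open>U \<twoheadrightarrow> B\<close> along \<open>f\<close> gives an object that has a
  coreflection in \<open>\<H>\<close>, and this is a kernel of \<open>f\<close>. Conversely, up to isomorphism, the cokernels in
  the heart are the inflations between objects of \<open>\<H>\<close> with cokernel in \<open>\<S>\<close>, and the kernels are the
  deflations with kernel in \<open>\<V>\<close> (\<open>inflation_cokernel\<close>, \<open>deflation_kernel\<close>). The first class is stable
  under pullback and the second under pushout (\<open>pullback_inflation\<close>, \<open>pushout_deflation\<close>): the heart
  is almost abelian.

  Monomorphisms of the heart are stable under pushout (\<open>pushout_mono\<close>) because a monomorphism
  \<open>f : A \<rightarrow> B\<close> induces injections \<open>Ext\<^sup>1(S, A) \<rightarrow> Ext\<^sup>1(S, B)\<close> for \<open>S \<in> \<S>\<close>. Stability of epimorphisms under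
  pullback then is a formal consequence: in an almost abelian category every arrow is a cokernel
  followed by a monomorphism, which reduces the claim to a pushout of a monomorphism
  (\<open>integral_almost_abelianI\<close>).
\<close>

section \<open>Computing in preadditive categories\<close>

context category
begin

text \<open>The objects are listed as well, so that unfolding a membership gives all side conditions
  of the laws below.\<close>

lemma Hom_iff: "f \<in> Hom C A B \<longleftrightarrow> f \<in> Arr C \<and> Dom C f = A \<and> Cod C f = B \<and> A \<in> Obj C \<and> B \<in> Obj C"
  unfolding Hom_def using Dom_closed Cod_closed by auto

lemma Arr_Hom: "f \<in> Arr C \<Longrightarrow> f \<in> Hom C (Dom C f) (Cod C f)"
  by (simp add: Hom_def)

lemma Ide_cat:
  assumes "A \<in> Obj C" shows "Ide C A \<in> Arr C" "Dom C (Ide C A) = A" "Cod C (Ide C A) = A"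
  using Ide_closed[OF assms] by (auto simp: Hom_def)

lemma Cmp_cat:
  assumes "f \<in> Arr C" "g \<in> Arr C" "Cod C f = Dom C g"
  shows "g \<cdot> f \<in> Arr C" "Dom C (g \<cdot> f) = Dom C f" "Cod C (g \<cdot> f) = Cod C g"
  using Cmp_closed[of f "Dom C f" "Cod C f" g "Cod C g"] assms by (auto simp: Hom_def)

lemma Ide_right: "f \<in> Arr C \<Longrightarrow> Dom C f = A \<Longrightarrow> f \<cdot> Ide C A = f"
  and Ide_left: "f \<in> Arr C \<Longrightarrow> Cod C f = A \<Longrightarrow> Ide C A \<cdot> f = f"
  using Cmp_Ide_right Cmp_Ide_left Arr_Hom by metis+

lemma assoc:
  "f \<in> Arr C \<Longrightarrow> g \<in> Arr C \<Longrightarrow> h \<in> Arr C \<Longrightarrow> Cod C f = Dom C g \<Longrightarrow> Cod C g = Dom C h \<Longrightarrow>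
    (h \<cdot> g) \<cdot> f = h \<cdot> (g \<cdot> f)"
  by (rule Cmp_assoc[of _ "Dom C f" "Cod C f" _ "Cod C g" _ "Cod C h"]) (auto simp: Hom_def)

text \<open>With composites associated to the right, an equation between composites can only be applied
  in front of a further factor in this form.\<close>

lemma Cmp_cong_right:
  assumes "g \<cdot> f = h \<cdot> k" "f \<in> Arr C" "g \<in> Arr C" "h \<in> Arr C" "k \<in> Arr C"
    "Cod C f = Dom C g" "Cod C k = Dom C h" "x \<in> Arr C" "Cod C x = Dom C f" "Dom C f = Dom C k"
  shows "g \<cdot> (f \<cdot> x) = h \<cdot> (k \<cdot> x)"
  using assms by (metis assoc)

lemma Cmp_cong_right1:
  assumes "g \<cdot> f = h" "f \<in> Arr C" "g \<in> Arr C" "Cod C f = Dom C g"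
    "x \<in> Arr C" "Cod C x = Dom C f"
  shows "g \<cdot> (f \<cdot> x) = h \<cdot> x"
  using assms by (metis assoc)

lemmas cat_simps = Hom_iff Ide_cat Cmp_cat Ide_right Ide_left assoc Dom_closed Cod_closed

end

definition Neg :: "('o, 'm) acat \<Rightarrow> 'm \<Rightarrow> 'm" where
  "Neg C f = m_inv (hom_group C (Dom C f) (Cod C f)) f"

context preadditive_category
begin

lemma hom_group_cat [simp]:
  "carrier (hom_group C A B) = Hom C A B"
  "monoid.mult (hom_group C A B) = Sum C"
  "one (hom_group C A B) = Zer C A B"
  by (simp_all add: hom_group_def)

lemma Zer_cat:
  assumes "A \<in> Obj C" "B \<in> Obj C"
  shows "Zer C A B \<in> Arr C" "Dom C (Zer C A B) = A" "Cod C (Zer C A B) = B"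
proof -
  interpret comm_group "hom_group C A B" using assms by (rule hom_comm_group)
  show "Zer C A B \<in> Arr C" "Dom C (Zer C A B) = A" "Cod C (Zer C A B) = B"
    using one_closed by (auto simp: Hom_def)
qed

lemma Sum_cat:
  assumes "f \<in> Arr C" "g \<in> Arr C" "Dom C f = Dom C g" "Cod C f = Cod C g"
  shows "f \<boxplus> g \<in> Arr C" "Dom C (f \<boxplus> g) = Dom C g" "Cod C (f \<boxplus> g) = Cod C g"
proof -
  interpret comm_group "hom_group C (Dom C f) (Cod C f)"
    using assms by (intro hom_comm_group) (auto simp: Dom_closed Cod_closed)
  show "f \<boxplus> g \<in> Arr C" "Dom C (f \<boxplus> g) = Dom C g" "Cod C (f \<boxplus> g) = Cod C g"
    using m_closed[of f g] assms by (auto simp: Hom_def)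
qed

lemma Neg_cat:
  assumes "f \<in> Arr C"
  shows "Neg C f \<in> Arr C" "Dom C (Neg C f) = Dom C f" "Cod C (Neg C f) = Cod C f"
proof -
  interpret comm_group "hom_group C (Dom C f) (Cod C f)"
    using assms by (intro hom_comm_group) (auto simp: Dom_closed Cod_closed)
  show "Neg C f \<in> Arr C" "Dom C (Neg C f) = Dom C f" "Cod C (Neg C f) = Cod C f"
    using inv_closed[of f] assms by (auto simp: Hom_def Neg_def)
qed

lemma Sum_laws:
  assumes "f \<in> Arr C" "g \<in> Arr C" "h \<in> Arr C"
    "Dom C f = Dom C g" "Cod C f = Cod C g" "Dom C g = Dom C h" "Cod C g = Cod C h"
  shows Sum_assoc: "(f \<boxplus> g) \<boxplus> h = f \<boxplus> (g \<boxplus> h)"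
    and Sum_left_comm: "f \<boxplus> (g \<boxplus> h) = g \<boxplus> (f \<boxplus> h)"
proof -
  interpret comm_group "hom_group C (Dom C f) (Cod C f)"
    using assms by (intro hom_comm_group) (auto simp: Dom_closed Cod_closed)
  show "(f \<boxplus> g) \<boxplus> h = f \<boxplus> (g \<boxplus> h)" "f \<boxplus> (g \<boxplus> h) = g \<boxplus> (f \<boxplus> h)"
    using m_assoc[of f g h] m_lcomm[of f g h] assms by (auto simp: Hom_def)
qed

lemma Sum_comm:
  assumes "f \<in> Arr C" "g \<in> Arr C" "Dom C f = Dom C g" "Cod C f = Cod C g"
  shows "f \<boxplus> g = g \<boxplus> f"
proof -
  interpret comm_group "hom_group C (Dom C f) (Cod C f)"
    using assms by (intro hom_comm_group) (auto simp: Dom_closed Cod_closed)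
  show ?thesis using m_comm[of f g] assms by (auto simp: Hom_def)
qed

lemma
  assumes "f \<in> Arr C" "Dom C f = A" "Cod C f = B"
  shows Sum_Zer: "f \<boxplus> Zer C A B = f" "Zer C A B \<boxplus> f = f"
    and Neg_right: "f \<boxplus> Neg C f = Zer C A B" and Neg_left: "Neg C f \<boxplus> f = Zer C A B"
    and Neg_Neg: "Neg C (Neg C f) = f"
proof -
  interpret comm_group "hom_group C (Dom C f) (Cod C f)"
    using assms by (intro hom_comm_group) (auto simp: Dom_closed Cod_closed)
  have f: "f \<in> carrier (hom_group C (Dom C f) (Cod C f))"
    using assms by (simp add: Hom_def)
  show "f \<boxplus> Zer C A B = f" "Zer C A B \<boxplus> f = f" "f \<boxplus> Neg C f = Zer C A B"
       "Neg C f \<boxplus> f = Zer C A B" "Neg C (Neg C f) = f"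
    using r_one[OF f] l_one[OF f] r_inv[OF f] l_inv[OF f] inv_inv[OF f] assms Neg_cat[OF assms(1)]
    by (auto simp: Neg_def)
qed

lemma Neg_cancel:
  assumes "f \<in> Arr C" "g \<in> Arr C" "Dom C f = Dom C g" "Cod C f = Cod C g"
  shows "f \<boxplus> (Neg C f \<boxplus> g) = g" "Neg C f \<boxplus> (f \<boxplus> g) = g"
  using assms by (simp_all add: Sum_assoc[symmetric] Neg_cat Neg_right Neg_left Sum_Zer)

lemma Neg_cancel2:
  assumes "f \<in> Arr C" "g \<in> Arr C" "Dom C f = Dom C g" "Cod C f = Cod C g"
  shows "f \<boxplus> (g \<boxplus> Neg C f) = g" "Neg C f \<boxplus> (g \<boxplus> f) = g"
  using Neg_cancel[OF assms] assms by (simp_all add: Sum_comm[of g] Neg_cat)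

lemma Neg_unique:
  assumes "f \<in> Arr C" "g \<in> Arr C" "Dom C f = Dom C g" "Cod C f = Cod C g"
    "f \<boxplus> g = Zer C (Dom C g) (Cod C g)"
  shows "g = Neg C f"
proof -
  have "g = Neg C f \<boxplus> (f \<boxplus> g)" using assms(1-4) by (rule Neg_cancel(2)[symmetric])
  also have "\<dots> = Neg C f" unfolding assms(5) using assms by (simp add: Sum_Zer Neg_cat)
  finally show ?thesis .
qed

lemma Zer_comp:
  assumes "f \<in> Arr C" "A \<in> Obj C"
  shows Cmp_Zer_right: "Cod C f = B \<Longrightarrow> Zer C B A \<cdot> f = Zer C (Dom C f) A"
    and Cmp_Zer_left: "Dom C f = B \<Longrightarrow> f \<cdot> Zer C A B = Zer C A (Cod C f)"
proof -
  assume B: "Cod C f = B"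
  let ?z = "Zer C B A \<cdot> f"
  have z: "?z \<in> Arr C" "Dom C ?z = Dom C f" "Cod C ?z = A"
    using assms B by (auto simp: Zer_cat Cmp_cat Cod_closed)
  have "?z \<boxplus> ?z = (Zer C B A \<boxplus> Zer C B A) \<cdot> f"
    using assms B by (intro Cmp_Sum_left[symmetric]) (auto simp: Hom_def Zer_cat Cod_closed)
  also have "\<dots> = ?z" using assms B by (subst Sum_Zer) (auto simp: Zer_cat Cod_closed)
  finally have "Neg C ?z \<boxplus> (?z \<boxplus> ?z) = Neg C ?z \<boxplus> ?z" by simp
  then show "?z = Zer C (Dom C f) A" using z by (simp add: Neg_cancel Neg_left)
next
  assume B: "Dom C f = B"
  let ?z = "f \<cdot> Zer C A B"
  have z: "?z \<in> Arr C" "Dom C ?z = A" "Cod C ?z = Cod C f"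
    using assms B by (auto simp: Zer_cat Cmp_cat Dom_closed)
  have "?z \<boxplus> ?z = f \<cdot> (Zer C A B \<boxplus> Zer C A B)"
    using assms B by (intro Cmp_Sum_right[symmetric]) (auto simp: Hom_def Zer_cat Dom_closed)
  also have "\<dots> = ?z" using assms B by (subst Sum_Zer) (auto simp: Zer_cat Dom_closed)
  finally have "Neg C ?z \<boxplus> (?z \<boxplus> ?z) = Neg C ?z \<boxplus> ?z" by simp
  then show "?z = Zer C A (Cod C f)" using z by (simp add: Neg_cancel Neg_left)
qed

lemma Cmp_Sum_R:
  assumes "f \<in> Arr C" "f' \<in> Arr C" "g \<in> Arr C" "Dom C f = Dom C f'" "Cod C f = Cod C f'"
    "Cod C f = Dom C g"
  shows "g \<cdot> (f \<boxplus> f') = (g \<cdot> f) \<boxplus> (g \<cdot> f')"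
  using assms by (intro Cmp_Sum_right) (auto simp: Hom_def)

lemma Cmp_Sum_L:
  assumes "g \<in> Arr C" "g' \<in> Arr C" "f \<in> Arr C" "Dom C g = Dom C g'" "Cod C g = Cod C g'"
    "Cod C f = Dom C g"
  shows "(g \<boxplus> g') \<cdot> f = (g \<cdot> f) \<boxplus> (g' \<cdot> f)"
  using assms by (intro Cmp_Sum_left) (auto simp: Hom_def)

lemma Cmp_Neg_R:
  assumes "f \<in> Arr C" "g \<in> Arr C" "Cod C f = Dom C g"
  shows "g \<cdot> Neg C f = Neg C (g \<cdot> f)"
  using assms
  by (intro Neg_unique) (simp_all add: cat_simps Neg_cat Cmp_Sum_R[symmetric] Neg_right Zer_comp)

lemma Cmp_Neg_L:
  assumes "f \<in> Arr C" "g \<in> Arr C" "Cod C f = Dom C g"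
  shows "Neg C g \<cdot> f = Neg C (g \<cdot> f)"
  using assms
  by (intro Neg_unique) (simp_all add: cat_simps Neg_cat Cmp_Sum_L[symmetric] Neg_right Zer_comp)

lemma Neg_Sum:
  assumes "f \<in> Arr C" "g \<in> Arr C" "Dom C f = Dom C g" "Cod C f = Cod C g"
  shows "Neg C (f \<boxplus> g) = Neg C f \<boxplus> Neg C g"
proof (rule Neg_unique[symmetric])
  have "f \<boxplus> g \<boxplus> (Neg C f \<boxplus> Neg C g) = (f \<boxplus> Neg C f) \<boxplus> (g \<boxplus> Neg C g)"
    using assms by (simp add: Sum_cat Neg_cat Sum_assoc Sum_left_comm)
  also have "\<dots> = Zer C (Dom C g) (Cod C g)"
    using assms by (simp add: Neg_right Sum_Zer Zer_cat cat_simps)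
  finally show "f \<boxplus> g \<boxplus> (Neg C f \<boxplus> Neg C g)
      = Zer C (Dom C (Neg C f \<boxplus> Neg C g)) (Cod C (Neg C f \<boxplus> Neg C g))"
    using assms by (simp add: Sum_cat Neg_cat)
qed (use assms in \<open>simp_all add: Sum_cat Neg_cat\<close>)

lemma Neg_Zer: "A \<in> Obj C \<Longrightarrow> B \<in> Obj C \<Longrightarrow> Neg C (Zer C A B) = Zer C A B"
  by (rule Neg_unique[symmetric]) (simp_all add: Zer_cat Sum_Zer)

lemmas arith_simps = cat_simps Zer_cat Sum_cat Neg_cat Sum_assoc Sum_left_comm Sum_comm
  Sum_Zer Neg_right Neg_left Neg_Neg Neg_cancel Neg_cancel2 Cmp_Zer_right Cmp_Zer_left Cmp_Sum_R Cmp_Sum_L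
  Cmp_Neg_R Cmp_Neg_L Neg_Sum Neg_Zer

lemma diff_zero_iff:
  assumes "f \<in> Arr C" "g \<in> Arr C" "Dom C f = Dom C g" "Cod C f = Cod C g"
  shows "f \<boxplus> Neg C g = Zer C (Dom C g) (Cod C g) \<longleftrightarrow> f = g"
proof
  assume "f \<boxplus> Neg C g = Zer C (Dom C g) (Cod C g)"
  then have "(f \<boxplus> Neg C g) \<boxplus> g = Zer C (Dom C g) (Cod C g) \<boxplus> g" by simp
  then show "f = g" using assms by (simp add: Sum_assoc Neg_cat Neg_left Sum_Zer)
qed (use assms in \<open>simp add: Neg_right\<close>)

lemma monoI:
  assumes "f \<in> Arr C" "\<And>x. x \<in> Arr C \<Longrightarrow> Cod C x = Dom C f \<Longrightarrow>
    f \<cdot> x = Zer C (Dom C x) (Cod C f) \<Longrightarrow> x = Zer C (Dom C x) (Cod C x)"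
  shows "is_mono C f"
  unfolding is_mono_def
proof (intro conjI allI ballI impI)
  fix Z x y assume h: "x \<in> Hom C Z (Dom C f)" "y \<in> Hom C Z (Dom C f)" "f \<cdot> x = f \<cdot> y"
  have "f \<cdot> (x \<boxplus> Neg C y) = Zer C Z (Cod C f)"
    using h assms(1) by (simp add: arith_simps)
  then have "x \<boxplus> Neg C y = Zer C Z (Dom C f)"
    using assms(2)[of "x \<boxplus> Neg C y"] h assms(1) by (simp add: Hom_iff Sum_cat Neg_cat)
  then show "x = y" using h diff_zero_iff[of x y] by (simp add: Hom_iff)
qed (rule assms)

lemma epiI:
  assumes "f \<in> Arr C" "\<And>x. x \<in> Arr C \<Longrightarrow> Dom C x = Cod C f \<Longrightarrow>
    x \<cdot> f = Zer C (Dom C f) (Cod C x) \<Longrightarrow> x = Zer C (Dom C x) (Cod C x)"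
  shows "is_epi C f"
  unfolding is_epi_def
proof (intro conjI allI ballI impI)
  fix Z x y assume h: "x \<in> Hom C (Cod C f) Z" "y \<in> Hom C (Cod C f) Z" "x \<cdot> f = y \<cdot> f"
  have "(x \<boxplus> Neg C y) \<cdot> f = Zer C (Dom C f) Z"
    using h assms(1) by (simp add: arith_simps)
  then have "x \<boxplus> Neg C y = Zer C (Cod C f) Z"
    using assms(2)[of "x \<boxplus> Neg C y"] h assms(1) by (simp add: Hom_iff Sum_cat Neg_cat)
  then show "x = y" using h diff_zero_iff[of x y] by (simp add: Hom_iff)
qed (rule assms)

end

lemma mono_cancel:
  "is_mono C f \<Longrightarrow> x \<in> Arr C \<Longrightarrow> y \<in> Arr C \<Longrightarrow> Cod C x = Dom C f \<Longrightarrow> Cod C y = Dom C f \<Longrightarrow>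
    Dom C x = Dom C y \<Longrightarrow> f \<cdot>\<^bsub>C\<^esub> x = f \<cdot>\<^bsub>C\<^esub> y \<Longrightarrow> x = y"
  unfolding is_mono_def Hom_def by auto

lemma epi_cancel:
  "is_epi C f \<Longrightarrow> x \<in> Arr C \<Longrightarrow> y \<in> Arr C \<Longrightarrow> Dom C x = Cod C f \<Longrightarrow> Dom C y = Cod C f \<Longrightarrow>
    Cod C x = Cod C y \<Longrightarrow> x \<cdot>\<^bsub>C\<^esub> f = y \<cdot>\<^bsub>C\<^esub> f \<Longrightarrow> x = y"
  unfolding is_epi_def Hom_def by auto

section \<open>Duality\<close>

definition op_cat :: "('o, 'm) acat \<Rightarrow> ('o, 'm) acat" where
  "op_cat C = \<lparr>Obj = Obj C, Arr = Arr C, Dom = Cod C, Cod = Dom C, Ide = Ide C,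
     Cmp = (\<lambda>g f. f \<cdot>\<^bsub>C\<^esub> g), Zer = (\<lambda>A B. Zer C B A), Sum = Sum C\<rparr>"

lemma op_cat_simps [simp]:
  "Obj (op_cat C) = Obj C" "Arr (op_cat C) = Arr C" "Dom (op_cat C) = Cod C"
  "Cod (op_cat C) = Dom C" "Ide (op_cat C) = Ide C" "g \<cdot>\<^bsub>op_cat C\<^esub> f = f \<cdot>\<^bsub>C\<^esub> g"
  "Zer (op_cat C) A B = Zer C B A" "Sum (op_cat C) = Sum C" "op_cat (op_cat C) = C"
  by (simp_all add: op_cat_def)

lemma Hom_op [simp]: "Hom (op_cat C) A B = Hom C B A"
  by (auto simp: Hom_def)

lemma hom_group_op [simp]: "hom_group (op_cat C) A B = hom_group C B A"
  by (simp add: hom_group_def)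

lemma Neg_op [simp]: "Neg (op_cat C) f = Neg C f"
  by (simp add: Neg_def)

lemma is_mono_op [simp]: "is_mono (op_cat C) f = is_epi C f"
  and is_epi_op [simp]: "is_epi (op_cat C) f = is_mono C f"
  by (simp_all add: is_mono_def is_epi_def)

lemma is_kernel_of_op [simp]: "is_kernel_of (op_cat C) k f = is_cokernel_of C k f"
  and is_cokernel_of_op [simp]: "is_cokernel_of (op_cat C) k f = is_kernel_of C k f"
  by (auto simp: is_kernel_of_def is_cokernel_of_def)

lemma is_kernel_op [simp]: "is_kernel (op_cat C) k = is_cokernel C k"
  and is_cokernel_op [simp]: "is_cokernel (op_cat C) k = is_kernel C k"
  by (simp_all add: is_kernel_def is_cokernel_def)

lemma is_comm_square_op [simp]: "is_comm_square (op_cat C) \<alpha> \<beta> \<gamma> \<delta> = is_comm_square C \<delta> \<gamma> \<beta> \<alpha>"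
  by (auto simp: is_comm_square_def)

lemma is_pullback_sym: "is_pullback C \<alpha> \<beta> \<gamma> \<delta> \<Longrightarrow> is_pullback C \<beta> \<alpha> \<delta> \<gamma>"
  unfolding is_pullback_def is_comm_square_def by (metis (no_types))

lemma is_pushout_sym: "is_pushout C \<alpha> \<beta> \<gamma> \<delta> \<Longrightarrow> is_pushout C \<beta> \<alpha> \<delta> \<gamma>"
  unfolding is_pushout_def is_comm_square_def by (metis (no_types))

lemma is_pullback_op [simp]: "is_pullback (op_cat C) \<alpha> \<beta> \<gamma> \<delta> = is_pushout C \<delta> \<gamma> \<beta> \<alpha>"
  and is_pushout_op [simp]: "is_pushout (op_cat C) \<alpha> \<beta> \<gamma> \<delta> = is_pullback C \<delta> \<gamma> \<beta> \<alpha>"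
proof -
  have "is_pullback (op_cat C) \<alpha> \<beta> \<gamma> \<delta> = is_pushout C \<gamma> \<delta> \<alpha> \<beta>"
    "is_pushout (op_cat C) \<alpha> \<beta> \<gamma> \<delta> = is_pullback C \<gamma> \<delta> \<alpha> \<beta>"
    by (auto simp: is_pullback_def is_pushout_def is_comm_square_def)
  then show "is_pullback (op_cat C) \<alpha> \<beta> \<gamma> \<delta> = is_pushout C \<delta> \<gamma> \<beta> \<alpha>"
    "is_pushout (op_cat C) \<alpha> \<beta> \<gamma> \<delta> = is_pullback C \<delta> \<gamma> \<beta> \<alpha>"
    using is_pullback_sym is_pushout_sym by metis+
qed

lemma is_iso_op [simp]: "is_iso (op_cat C) f = is_iso C f"
  by (auto simp: is_iso_def)

lemma is_zero_obj_op [simp]: "is_zero_obj (op_cat C) Z = is_zero_obj C Z"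
  by (auto simp: is_zero_obj_def)

lemma is_biprod_op [simp]: "is_biprod (op_cat C) A B P i j p q = is_biprod C A B P p q i j"
  by (auto simp: is_biprod_def)

lemma is_direct_sum_op [simp]: "is_direct_sum (op_cat C) A B P = is_direct_sum C A B P"
  unfolding is_direct_sum_def is_biprod_op by blast

lemma category_op: assumes "category C" shows "category (op_cat C)"
proof -
  interpret category C by fact
  show ?thesis by unfold_locales (auto simp: cat_simps)
qed

lemma preadditive_category_op:
  assumes "preadditive_category C" shows "preadditive_category (op_cat C)"
proof -
  interpret preadditive_category C by fact
  show ?thesis
    by (intro preadditive_category.intro preadditive_category_axioms.intro category_op
        category_axioms) (auto simp: hom_comm_group arith_simps)
qed

lemma additive_category_op: "additive_category C \<Longrightarrow> additive_category (op_cat C)"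
  by (auto simp: additive_category_def additive_category_axioms_def preadditive_category_op)

lemma preabelian_category_op: "preabelian_category C \<Longrightarrow> preabelian_category (op_cat C)"
  by (auto simp: preabelian_category_def preabelian_category_axioms_def additive_category_op)

lemma integral_category_op: "integral_category C \<Longrightarrow> integral_category (op_cat C)"
  unfolding integral_category_def left_integral_category_def right_integral_category_def
    left_integral_category_axioms_def right_integral_category_axioms_def
  by (simp add: preabelian_category_op)

lemma almost_abelian_category_op: "almost_abelian_category C \<Longrightarrow> almost_abelian_category (op_cat C)"
  unfolding almost_abelian_category_def left_almost_abelian_category_def
    right_almost_abelian_category_def left_almost_abelian_category_axioms_def
    right_almost_abelian_category_axioms_def
  by (simp add: preabelian_category_op)

section \<open>Universal properties\<close>

lemma is_comm_squareD:
  assumes "is_comm_square C \<alpha> \<beta> \<gamma> \<delta>"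
  shows "\<alpha> \<in> Arr C" "\<beta> \<in> Arr C" "\<gamma> \<in> Arr C" "\<delta> \<in> Arr C" "Dom C \<alpha> = Dom C \<beta>" "Cod C \<alpha> = Dom C \<gamma>"
    "Cod C \<beta> = Dom C \<delta>" "Cod C \<gamma> = Cod C \<delta>" "\<gamma> \<cdot>\<^bsub>C\<^esub> \<alpha> = \<delta> \<cdot>\<^bsub>C\<^esub> \<beta>"
  using assms by (auto simp: is_comm_square_def)

lemma pullback_comm_square: "is_pullback C \<alpha> \<beta> \<gamma> \<delta> \<Longrightarrow> is_comm_square C \<alpha> \<beta> \<gamma> \<delta>"
  by (simp add: is_pullback_def)

lemmas is_pullbackD = is_comm_squareD[OF pullback_comm_square]

lemma pushout_comm_square: "is_pushout C \<alpha> \<beta> \<gamma> \<delta> \<Longrightarrow> is_comm_square C \<alpha> \<beta> \<gamma> \<delta>"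
  by (simp add: is_pushout_def)

lemmas is_pushoutD = is_comm_squareD[OF pushout_comm_square]

lemma pullback_ex:
  assumes "is_pullback C \<alpha> \<beta> \<gamma> \<delta>" "x \<in> Arr C" "y \<in> Arr C" "Dom C x = Dom C y"
    "Cod C x = Dom C \<gamma>" "Cod C y = Dom C \<delta>" "\<gamma> \<cdot>\<^bsub>C\<^esub> x = \<delta> \<cdot>\<^bsub>C\<^esub> y"
  obtains u where "u \<in> Arr C" "Dom C u = Dom C y" "Cod C u = Dom C \<alpha>" "\<alpha> \<cdot>\<^bsub>C\<^esub> u = x" "\<beta> \<cdot>\<^bsub>C\<^esub> u = y"
  using assms unfolding is_pullback_def Hom_def by blast

lemma pushout_ex:
  assumes "is_pushout C \<alpha> \<beta> \<gamma> \<delta>" "x \<in> Arr C" "y \<in> Arr C" "Cod C x = Cod C y"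
    "Dom C x = Cod C \<alpha>" "Dom C y = Cod C \<beta>" "x \<cdot>\<^bsub>C\<^esub> \<alpha> = y \<cdot>\<^bsub>C\<^esub> \<beta>"
  obtains u where "u \<in> Arr C" "Dom C u = Cod C \<gamma>" "Cod C u = Cod C y" "u \<cdot>\<^bsub>C\<^esub> \<gamma> = x" "u \<cdot>\<^bsub>C\<^esub> \<delta> = y"
  using assms unfolding is_pushout_def Hom_def by blast

lemma is_kernel_ofD:
  assumes "is_kernel_of C k f"
  shows "k \<in> Arr C" "f \<in> Arr C" "Cod C k = Dom C f" "f \<cdot>\<^bsub>C\<^esub> k = Zer C (Dom C k) (Cod C f)"
  using assms by (auto simp: is_kernel_of_def)

lemma is_cokernel_ofD:
  assumes "is_cokernel_of C c f"
  shows "c \<in> Arr C" "f \<in> Arr C" "Dom C c = Cod C f" "c \<cdot>\<^bsub>C\<^esub> f = Zer C (Dom C f) (Cod C c)"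
  using assms by (auto simp: is_cokernel_of_def)

lemma kernel_ex:
  assumes "is_kernel_of C k f" "x \<in> Arr C" "Cod C x = Dom C f" "f \<cdot>\<^bsub>C\<^esub> x = Zer C (Dom C x) (Cod C f)"
  obtains u where "u \<in> Arr C" "Dom C u = Dom C x" "Cod C u = Dom C k" "k \<cdot>\<^bsub>C\<^esub> u = x"
  using assms unfolding is_kernel_of_def Hom_def by blast

lemma cokernel_ex:
  assumes "is_cokernel_of C c f" "x \<in> Arr C" "Dom C x = Cod C f"
    "x \<cdot>\<^bsub>C\<^esub> f = Zer C (Dom C f) (Cod C x)"
  obtains u where "u \<in> Arr C" "Dom C u = Cod C c" "Cod C u = Cod C x" "u \<cdot>\<^bsub>C\<^esub> c = x"
  using assms unfolding is_cokernel_of_def Hom_def by blast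

lemma is_isoE:
  assumes "is_iso C f"
  obtains g where "f \<in> Arr C" "g \<in> Arr C" "Dom C g = Cod C f" "Cod C g = Dom C f"
    "g \<cdot>\<^bsub>C\<^esub> f = Ide C (Dom C f)" "f \<cdot>\<^bsub>C\<^esub> g = Ide C (Cod C f)"
  using assms unfolding is_iso_def Hom_def by blast

lemma is_isoI:
  assumes "f \<in> Arr C" "g \<in> Arr C" "Dom C g = Cod C f" "Cod C g = Dom C f"
    "g \<cdot>\<^bsub>C\<^esub> f = Ide C (Dom C f)" "f \<cdot>\<^bsub>C\<^esub> g = Ide C (Cod C f)"
  shows "is_iso C f"
  using assms unfolding is_iso_def Hom_def by blast

context category
begin

lemma pullback_eq:
  assumes "is_pullback C \<alpha> \<beta> \<gamma> \<delta>" "u \<in> Arr C" "v \<in> Arr C" "Dom C u = Dom C v"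
    "Cod C u = Dom C \<alpha>" "Cod C v = Dom C \<alpha>" "\<alpha> \<cdot> u = \<alpha> \<cdot> v" "\<beta> \<cdot> u = \<beta> \<cdot> v"
  shows "u = v"
proof -
  note p = is_pullbackD[OF assms(1)]
  have "\<gamma> \<cdot> (\<alpha> \<cdot> v) = \<delta> \<cdot> (\<beta> \<cdot> v)"
    using assms p by (intro Cmp_cong_right) auto
  moreover have "\<alpha> \<cdot> v \<in> Hom C (Dom C v) (Dom C \<gamma>)" "\<beta> \<cdot> v \<in> Hom C (Dom C v) (Dom C \<delta>)"
    using assms p by (simp_all add: cat_simps)
  ultimately have "\<exists>!w. w \<in> Hom C (Dom C v) (Dom C \<alpha>) \<and> \<alpha> \<cdot> w = \<alpha> \<cdot> v \<and> \<beta> \<cdot> w = \<beta> \<cdot> v"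
    using assms(1) unfolding is_pullback_def by blast
  then show ?thesis using assms by (auto simp: Hom_def)
qed

end

context preadditive_category
begin

lemma pullbackI:
  assumes "is_comm_square C \<alpha> \<beta> \<gamma> \<delta>"
    and ex: "\<And>x y. x \<in> Arr C \<Longrightarrow> y \<in> Arr C \<Longrightarrow> Dom C x = Dom C y \<Longrightarrow> Cod C x = Dom C \<gamma> \<Longrightarrow>
      Cod C y = Dom C \<delta> \<Longrightarrow> \<gamma> \<cdot> x = \<delta> \<cdot> y \<Longrightarrow>
      \<exists>u \<in> Arr C. Dom C u = Dom C y \<and> Cod C u = Dom C \<alpha> \<and> \<alpha> \<cdot> u = x \<and> \<beta> \<cdot> u = y"
    and uniq: "\<And>h. h \<in> Arr C \<Longrightarrow> Cod C h = Dom C \<alpha> \<Longrightarrow> \<alpha> \<cdot> h = Zer C (Dom C h) (Cod C \<alpha>) \<Longrightarrow>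
      \<beta> \<cdot> h = Zer C (Dom C h) (Cod C \<beta>) \<Longrightarrow> h = Zer C (Dom C h) (Cod C h)"
  shows "is_pullback C \<alpha> \<beta> \<gamma> \<delta>"
  unfolding is_pullback_def
proof (intro conjI allI ballI impI)
  note sq = is_comm_squareD[OF assms(1)]
  fix Z x y assume h: "x \<in> Hom C Z (Dom C \<gamma>)" "y \<in> Hom C Z (Dom C \<delta>)" "\<gamma> \<cdot> x = \<delta> \<cdot> y"
  obtain u where u: "u \<in> Arr C" "Dom C u = Dom C y" "Cod C u = Dom C \<alpha>" "\<alpha> \<cdot> u = x" "\<beta> \<cdot> u = y"
    using ex[of x y] h by (auto simp: Hom_def)
  show "\<exists>!u. u \<in> Hom C Z (Dom C \<alpha>) \<and> \<alpha> \<cdot> u = x \<and> \<beta> \<cdot> u = y"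
  proof (rule ex1I[of _ u])
    fix v assume v: "v \<in> Hom C Z (Dom C \<alpha>) \<and> \<alpha> \<cdot> v = x \<and> \<beta> \<cdot> v = y"
    have "\<alpha> \<cdot> (v \<boxplus> Neg C u) = Zer C Z (Cod C \<alpha>)" "\<beta> \<cdot> (v \<boxplus> Neg C u) = Zer C Z (Cod C \<beta>)"
      using u v h sq by (auto simp: arith_simps)
    then have "v \<boxplus> Neg C u = Zer C Z (Dom C \<alpha>)"
      using uniq[of "v \<boxplus> Neg C u"] u v h by (simp add: Hom_iff Sum_cat Neg_cat)
    then show "v = u" using u v h diff_zero_iff[of v u] by (simp add: Hom_iff)
  qed (use u h in \<open>auto simp: Hom_def\<close>)
qed (rule assms)

lemma kernelI:
  assumes "k \<in> Arr C" "f \<in> Arr C" "Cod C k = Dom C f" "f \<cdot> k = Zer C (Dom C k) (Cod C f)"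
    and ex: "\<And>x. x \<in> Arr C \<Longrightarrow> Cod C x = Dom C f \<Longrightarrow> f \<cdot> x = Zer C (Dom C x) (Cod C f) \<Longrightarrow>
      \<exists>u \<in> Arr C. Dom C u = Dom C x \<and> Cod C u = Dom C k \<and> k \<cdot> u = x"
    and m: "is_mono C k"
  shows "is_kernel_of C k f"
  unfolding is_kernel_of_def
proof (intro conjI allI ballI impI)
  fix Z x assume h: "x \<in> Hom C Z (Dom C f)" "f \<cdot> x = Zer C Z (Cod C f)"
  obtain u where u: "u \<in> Arr C" "Dom C u = Dom C x" "Cod C u = Dom C k" "k \<cdot> u = x"
    using ex[of x] h by (auto simp: Hom_def)
  show "\<exists>!u. u \<in> Hom C Z (Dom C k) \<and> k \<cdot> u = x"
    by (rule ex1I[of _ u]) (use u h m in \<open>auto simp: Hom_def intro: mono_cancel\<close>)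
qed (use assms in auto)

lemma kernel_mono: assumes "is_kernel_of C k f" shows "is_mono C k"
proof (rule monoI)
  note k = is_kernel_ofD[OF assms]
  fix x assume x: "x \<in> Arr C" "Cod C x = Dom C k" "k \<cdot> x = Zer C (Dom C x) (Cod C k)"
  have "f \<cdot> (k \<cdot> x) = Zer C (Dom C x) (Cod C f)"
    using x k by (simp add: arith_simps)
  moreover have "k \<cdot> x \<in> Hom C (Dom C x) (Dom C f)" using x k by (simp add: arith_simps)
  ultimately have "\<exists>!u. u \<in> Hom C (Dom C x) (Dom C k) \<and> k \<cdot> u = k \<cdot> x"
    using assms unfolding is_kernel_of_def by blast
  moreover have "k \<cdot> Zer C (Dom C x) (Dom C k) = k \<cdot> x"
    using x k by (simp add: arith_simps)
  moreover have "x \<in> Hom C (Dom C x) (Dom C k)" "Zer C (Dom C x) (Dom C k) \<in> Hom C (Dom C x) (Dom C k)"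
    using x k by (simp_all add: arith_simps)
  ultimately have "x = Zer C (Dom C x) (Dom C k)" by blast
  then show "x = Zer C (Dom C x) (Cod C x)" using x by simp
qed (use is_kernel_ofD[OF assms] in auto)

lemma pullback_unique:
  assumes p: "is_pullback C \<alpha> \<beta> \<gamma> \<delta>" and q: "is_pullback C \<alpha>' \<beta>' \<gamma> \<delta>"
  obtains u where "is_iso C u" "Dom C u = Dom C \<alpha>" "Cod C u = Dom C \<alpha>'" "\<alpha>' \<cdot> u = \<alpha>" "\<beta>' \<cdot> u = \<beta>"
proof -
  note pD = is_pullbackD[OF p] and qD = is_pullbackD[OF q]
  obtain u where u: "u \<in> Arr C" "Dom C u = Dom C \<beta>" "Cod C u = Dom C \<alpha>'" "\<alpha>' \<cdot> u = \<alpha>" "\<beta>' \<cdot> u = \<beta>"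
    by (rule pullback_ex[OF q, of \<alpha> \<beta>]) (use pD in auto)
  obtain v where v: "v \<in> Arr C" "Dom C v = Dom C \<beta>'" "Cod C v = Dom C \<alpha>" "\<alpha> \<cdot> v = \<alpha>'" "\<beta> \<cdot> v = \<beta>'"
    by (rule pullback_ex[OF p, of \<alpha>' \<beta>']) (use qD in auto)
  have "v \<cdot> u = Ide C (Dom C u)"
    by (rule pullback_eq[OF p]) (use u v pD qD in \<open>simp_all add: cat_simps assoc[symmetric]\<close>)
  moreover have "u \<cdot> v = Ide C (Cod C u)"
    by (rule pullback_eq[OF q]) (use u v pD qD in \<open>simp_all add: cat_simps assoc[symmetric]\<close>)
  ultimately have "is_iso C u" using u v pD qD by (intro is_isoI[of u C v]) auto
  then show thesis using that u pD by auto
qed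

lemma kernel_iso:
  assumes k: "is_kernel_of C k f" and u: "is_iso C u" and "Cod C u = Dom C k"
  shows "is_kernel_of C (k \<cdot> u) f"
proof -
  note kD = is_kernel_ofD[OF k]
  obtain v where v: "u \<in> Arr C" "v \<in> Arr C" "Dom C v = Cod C u" "Cod C v = Dom C u"
    "v \<cdot> u = Ide C (Dom C u)" "u \<cdot> v = Ide C (Cod C u)" by (rule is_isoE[OF u])
  show ?thesis
  proof (rule kernelI)
    have "f \<cdot> (k \<cdot> u) = Zer C (Dom C k) (Cod C f) \<cdot> u"
      using v kD assms by (intro Cmp_cong_right1) auto
    then show "f \<cdot> (k \<cdot> u) = Zer C (Dom C (k \<cdot> u)) (Cod C f)"
      using v kD assms by (simp add: arith_simps)
    show "\<exists>w \<in> Arr C. Dom C w = Dom C x \<and> Cod C w = Dom C (k \<cdot> u) \<and> k \<cdot> u \<cdot> w = x"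
      if x: "x \<in> Arr C" "Cod C x = Dom C f" "f \<cdot> x = Zer C (Dom C x) (Cod C f)" for x
    proof -
      obtain w where w: "w \<in> Arr C" "Dom C w = Dom C x" "Cod C w = Dom C k" "k \<cdot> w = x"
        by (rule kernel_ex[OF k x])
      have "u \<cdot> (v \<cdot> w) = w"
        using v w assms Cmp_cong_right1[of u v "Ide C (Cod C u)" w] by (simp add: cat_simps)
      then show ?thesis using v w kD assms by (intro bexI[of _ "v \<cdot> w"]) (auto simp: cat_simps)
    qed
    show "is_mono C (k \<cdot> u)"
    proof (rule monoI)
      fix x assume x: "x \<in> Arr C" "Cod C x = Dom C (k \<cdot> u)" "k \<cdot> u \<cdot> x = Zer C (Dom C x) (Cod C (k \<cdot> u))"
      have "u \<cdot> x = Zer C (Dom C x) (Dom C k)"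
        by (rule mono_cancel[OF kernel_mono[OF k]]) (use x v kD assms in \<open>simp_all add: arith_simps\<close>)
      then have "v \<cdot> (u \<cdot> x) = Zer C (Dom C x) (Dom C u)" using x v kD assms by (simp add: arith_simps)
      then show "x = Zer C (Dom C x) (Cod C x)" using x v kD assms Cmp_cong_right1[OF v(5), of x]
        by (simp add: arith_simps)
    qed (use v kD assms in \<open>simp_all add: cat_simps\<close>)
  qed (use v kD assms in \<open>simp_all add: cat_simps\<close>)
qed

end

lemma (in category) pushout_eq:
  assumes "is_pushout C \<alpha> \<beta> \<gamma> \<delta>" "u \<in> Arr C" "v \<in> Arr C" "Cod C u = Cod C v"
    "Dom C u = Cod C \<delta>" "Dom C v = Cod C \<delta>" "u \<cdot> \<gamma> = v \<cdot> \<gamma>" "u \<cdot> \<delta> = v \<cdot> \<delta>"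
  shows "u = v"
proof -
  interpret op: category "op_cat C" by (rule category_op) unfold_locales
  show ?thesis using op.pullback_eq[of \<delta> \<gamma> \<beta> \<alpha> u v] assms by simp
qed

context preadditive_category
begin

lemma preadditive_op: "preadditive_category (op_cat C)"
  by (rule preadditive_category_op) unfold_locales

lemma pushoutI:
  assumes "is_comm_square C \<alpha> \<beta> \<gamma> \<delta>"
    and "\<And>x y. x \<in> Arr C \<Longrightarrow> y \<in> Arr C \<Longrightarrow> Cod C x = Cod C y \<Longrightarrow> Dom C x = Cod C \<alpha> \<Longrightarrow>
      Dom C y = Cod C \<beta> \<Longrightarrow> x \<cdot> \<alpha> = y \<cdot> \<beta> \<Longrightarrow>
      \<exists>u \<in> Arr C. Cod C u = Cod C y \<and> Dom C u = Cod C \<gamma> \<and> u \<cdot> \<gamma> = x \<and> u \<cdot> \<delta> = y"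
    and "\<And>h. h \<in> Arr C \<Longrightarrow> Dom C h = Cod C \<delta> \<Longrightarrow> h \<cdot> \<gamma> = Zer C (Dom C \<gamma>) (Cod C h) \<Longrightarrow>
      h \<cdot> \<delta> = Zer C (Dom C \<delta>) (Cod C h) \<Longrightarrow> h = Zer C (Dom C h) (Cod C h)"
  shows "is_pushout C \<alpha> \<beta> \<gamma> \<delta>"
proof -
  interpret op: preadditive_category "op_cat C" by (rule preadditive_op)
  have "is_pullback (op_cat C) \<gamma> \<delta> \<alpha> \<beta>"
    using assms is_comm_squareD[OF assms(1)]
    by (intro op.pullbackI) (auto simp: is_comm_square_def)
  then show ?thesis using is_pushout_sym by fastforce
qed

lemma cokernel_epi: "is_cokernel_of C c f \<Longrightarrow> is_epi C c"
  using preadditive_category.kernel_mono[OF preadditive_op, of c f] by simp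

lemma cokernel_iso:
  assumes "is_cokernel_of C c f" "is_iso C u" "Dom C u = Cod C c"
  shows "is_cokernel_of C (u \<cdot> c) f"
  using preadditive_category.kernel_iso[OF preadditive_op, of c f u] assms by simp

lemma kernel_iso_right:
  assumes k: "is_kernel_of C k f" and u: "is_iso C u" and "Dom C u = Cod C k"
  shows "is_kernel C (u \<cdot> k)"
proof -
  note kD = is_kernel_ofD[OF k]
  obtain v where v: "u \<in> Arr C" "v \<in> Arr C" "Dom C v = Cod C u" "Cod C v = Dom C u"
    "v \<cdot> u = Ide C (Dom C u)" "u \<cdot> v = Ide C (Cod C u)" by (rule is_isoE[OF u])
  have [simp]: "v \<cdot> (u \<cdot> x) = x" if "x \<in> Arr C" "Cod C x = Dom C u" for x
    using v that Cmp_cong_right1[OF v(5), of x] by (simp add: cat_simps)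
  have [simp]: "u \<cdot> (v \<cdot> x) = x" if "x \<in> Arr C" "Cod C x = Cod C u" for x
    using v that Cmp_cong_right1[OF v(6), of x] by (simp add: cat_simps)
  have "is_kernel_of C (u \<cdot> k) (f \<cdot> v)"
  proof (rule kernelI)
    show "\<exists>w \<in> Arr C. Dom C w = Dom C x \<and> Cod C w = Dom C (u \<cdot> k) \<and> u \<cdot> k \<cdot> w = x"
      if x: "x \<in> Arr C" "Cod C x = Dom C (f \<cdot> v)" "f \<cdot> v \<cdot> x = Zer C (Dom C x) (Cod C (f \<cdot> v))" for x
    proof -
      obtain w where w: "w \<in> Arr C" "Dom C w = Dom C (v \<cdot> x)" "Cod C w = Dom C k" "k \<cdot> w = v \<cdot> x"
        by (rule kernel_ex[OF k, of "v \<cdot> x"]) (use x v kD assms in \<open>simp_all add: cat_simps\<close>)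
      then show ?thesis using x v kD assms by (intro bexI[of _ w]) (simp_all add: cat_simps)
    qed
    show "is_mono C (u \<cdot> k)"
    proof (rule monoI)
      fix x assume x: "x \<in> Arr C" "Cod C x = Dom C (u \<cdot> k)" "u \<cdot> k \<cdot> x = Zer C (Dom C x) (Cod C (u \<cdot> k))"
      have "v \<cdot> (u \<cdot> (k \<cdot> x)) = v \<cdot> Zer C (Dom C x) (Cod C u)"
        using x v kD assms by (simp add: cat_simps)
      then have "k \<cdot> x = k \<cdot> Zer C (Dom C x) (Cod C x)"
        using x v kD assms by (simp add: arith_simps)
      then show "x = Zer C (Dom C x) (Cod C x)"
        by (rule mono_cancel[OF kernel_mono[OF k], rotated -1]) (use x(1,2) v(1) kD(1) assms(3) in \<open>simp_all add: cat_simps Zer_cat\<close>)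
    qed (use v kD assms in \<open>simp_all add: cat_simps\<close>)
  qed (use v kD assms in \<open>simp_all add: arith_simps\<close>)
  then show ?thesis by (auto simp: is_kernel_def)
qed

lemma cokernel_iso_right:
  assumes "is_cokernel_of C c f" "is_iso C u" "Cod C u = Dom C c"
  shows "is_cokernel C (c \<cdot> u)"
  using preadditive_category.kernel_iso_right[OF preadditive_op, of c f u] assms by simp

lemma biprod_simps:
  assumes "is_biprod C A B P i j p q" "x \<in> Arr C"
  shows "Cod C x = A \<Longrightarrow> p \<cdot> (i \<cdot> x) = x" "Cod C x = B \<Longrightarrow> q \<cdot> (j \<cdot> x) = x"
    "Cod C x = B \<Longrightarrow> p \<cdot> (j \<cdot> x) = Zer C (Dom C x) A" "Cod C x = A \<Longrightarrow> q \<cdot> (i \<cdot> x) = Zer C (Dom C x) B"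
  using assms unfolding is_biprod_def
  by (auto simp: Hom_iff assoc[symmetric]) (auto simp: arith_simps)

lemma is_biprodD:
  assumes "is_biprod C A B P i j p q"
  shows "i \<in> Hom C A P" "j \<in> Hom C B P" "p \<in> Hom C P A" "q \<in> Hom C P B"
    "p \<cdot> i = Ide C A" "q \<cdot> j = Ide C B" "q \<cdot> i = Zer C A B" "p \<cdot> j = Zer C B A"
    "(i \<cdot> p) \<boxplus> (j \<cdot> q) = Ide C P"
  using assms by (auto simp: is_biprod_def)

lemma biprod_ext:
  assumes "is_biprod C A B P i j p q" "x \<in> Hom C Z P" "y \<in> Hom C Z P" "p \<cdot> x = p \<cdot> y" "q \<cdot> x = q \<cdot> y"
  shows "x = y"
proof -
  note b = is_biprodD[OF assms(1)]
  have *: "z = (i \<cdot> (p \<cdot> z)) \<boxplus> (j \<cdot> (q \<cdot> z))" if "z \<in> Hom C Z P" for z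
  proof -
    have "z = ((i \<cdot> p) \<boxplus> (j \<cdot> q)) \<cdot> z" unfolding b using that by (simp add: cat_simps)
    also have "\<dots> = (i \<cdot> (p \<cdot> z)) \<boxplus> (j \<cdot> (q \<cdot> z))" using that b(1-4) by (simp add: cat_simps Cmp_Sum_L)
    finally show ?thesis .
  qed
  show ?thesis using *[OF assms(2)] *[OF assms(3)] assms(4,5) by simp
qed

lemma mono_zero:
  assumes "is_mono C f" "x \<in> Arr C" "Cod C x = Dom C f" "f \<cdot> x = Zer C (Dom C x) (Cod C f)"
  shows "x = Zer C (Dom C x) (Cod C x)"
proof -
  have "f \<in> Arr C" using assms by (simp add: is_mono_def)
  then show ?thesis using assms(2-4)
    by (intro mono_cancel[OF assms(1), of x "Zer C (Dom C x) (Cod C x)"])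
      (simp_all add: cat_simps Zer_cat Cmp_Zer_left)
qed

lemma is_biprod_sym: 
  assumes "is_biprod C A B P i j p q" shows "is_biprod C B A P j i q p"
  using assms unfolding is_biprod_def by (auto simp: cat_simps Sum_comm)

lemma kernel_unique:
  assumes k: "is_kernel_of C k f" and k': "is_kernel_of C k' f"
  obtains u where "is_iso C u" "Dom C u = Dom C k'" "Cod C u = Dom C k" "k \<cdot> u = k'"
proof -
  note kD = is_kernel_ofD[OF k] and kD' = is_kernel_ofD[OF k']
  obtain u where u: "u \<in> Arr C" "Dom C u = Dom C k'" "Cod C u = Dom C k" "k \<cdot> u = k'"
    by (rule kernel_ex[OF k, of k']) (use kD' in auto)
  obtain v where v: "v \<in> Arr C" "Dom C v = Dom C k" "Cod C v = Dom C k'" "k' \<cdot> v = k"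
    by (rule kernel_ex[OF k', of k]) (use kD in auto)
  have "v \<cdot> u = Ide C (Dom C u)"
    by (rule mono_cancel[OF kernel_mono[OF k']])
      (use u v kD(1) kD'(1) Cmp_cong_right1[OF v(4), of u] in \<open>simp_all add: cat_simps\<close>)
  moreover have "u \<cdot> v = Ide C (Cod C u)"
    by (rule mono_cancel[OF kernel_mono[OF k]])
      (use u v kD(1) kD'(1) Cmp_cong_right1[OF u(4), of v] in \<open>simp_all add: cat_simps\<close>)
  ultimately have "is_iso C u" using u v by (intro is_isoI[of u C v]) auto
  then show thesis using that u by blast
qed

lemma cokernel_unique:
  assumes "is_cokernel_of C c f" "is_cokernel_of C c' f"
  obtains u where "is_iso C u" "Cod C u = Cod C c'" "Dom C u = Cod C c" "u \<cdot> c = c'"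
  using preadditive_category.kernel_unique[OF preadditive_op, of c f c'] assms by auto

lemma pullback_iso_cod:
  assumes p: "is_pullback C \<alpha> \<beta> \<gamma> \<delta>" and u: "is_iso C u" "Dom C u = Cod C \<delta>"
  shows "is_pullback C \<alpha> \<beta> (u \<cdot> \<gamma>) (u \<cdot> \<delta>)"
proof (rule pullbackI)
  note pD = is_pullbackD[OF p]
  obtain v where v: "u \<in> Arr C" "v \<in> Arr C" "Dom C v = Cod C u" "Cod C v = Dom C u"
    "v \<cdot> u = Ide C (Dom C u)" "u \<cdot> v = Ide C (Cod C u)" by (rule is_isoE[OF u(1)])
  show "is_comm_square C \<alpha> \<beta> (u \<cdot> \<gamma>) (u \<cdot> \<delta>)"
    using pD v(1) u(2) by (simp add: is_comm_square_def cat_simps)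
  fix x y assume h: "x \<in> Arr C" "y \<in> Arr C" "Dom C x = Dom C y" "Cod C x = Dom C (u \<cdot> \<gamma>)"
    "Cod C y = Dom C (u \<cdot> \<delta>)" "(u \<cdot> \<gamma>) \<cdot> x = (u \<cdot> \<delta>) \<cdot> y"
  have "v \<cdot> (u \<cdot> (\<gamma> \<cdot> x)) = v \<cdot> (u \<cdot> (\<delta> \<cdot> y))" using h pD(1-8) v(1-4) u(2) by (simp add: cat_simps)
  then have eq: "\<gamma> \<cdot> x = \<delta> \<cdot> y"
    using Cmp_cong_right1[OF v(5), of "\<gamma> \<cdot> x"] Cmp_cong_right1[OF v(5), of "\<delta> \<cdot> y"] h(1-5) pD(1-8) v(1-4) u(2)
    by (simp add: cat_simps)
  obtain w where "w \<in> Arr C" "Dom C w = Dom C y" "Cod C w = Dom C \<alpha>" "\<alpha> \<cdot> w = x" "\<beta> \<cdot> w = y"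
    by (rule pullback_ex[OF p _ _ _ _ _ eq]) (use h(1-5) pD(1-8) v(1) u(2) in \<open>simp_all add: cat_simps\<close>)
  then show "\<exists>w \<in> Arr C. Dom C w = Dom C y \<and> Cod C w = Dom C \<alpha> \<and> \<alpha> \<cdot> w = x \<and> \<beta> \<cdot> w = y" by blast
next
  note pD = is_pullbackD[OF p]
  fix h assume "h \<in> Arr C" "Cod C h = Dom C \<alpha>" "\<alpha> \<cdot> h = Zer C (Dom C h) (Cod C \<alpha>)"
    "\<beta> \<cdot> h = Zer C (Dom C h) (Cod C \<beta>)"
  then show "h = Zer C (Dom C h) (Cod C h)"
    by - (rule pullback_eq[OF p], use pD(1-8) in \<open>simp_all add: arith_simps\<close>)
qed

text \<open>Any cokernel of \<open>f\<close> can be replaced by the given one, and any pullback by the one that the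
  hypothesis provides.\<close>

lemma pullback_cokernel_transfer:
  assumes c: "is_cokernel_of C c f"
    and stable: "\<And>\<gamma>. \<gamma> \<in> Arr C \<Longrightarrow> Cod C \<gamma> = Cod C c \<Longrightarrow> \<exists>\<alpha> \<beta>. is_pullback C \<alpha> \<beta> \<gamma> c \<and> is_cokernel C \<alpha>"
    and \<delta>: "is_cokernel_of C \<delta> f" and p: "is_pullback C \<alpha> \<beta> \<gamma> \<delta>"
  shows "is_cokernel C \<alpha>"
proof -
  note pD = is_pullbackD[OF p]
  obtain u where u: "is_iso C u" "Cod C u = Cod C c" "Dom C u = Cod C \<delta>" "u \<cdot> \<delta> = c"
    by (rule cokernel_unique[OF \<delta> c])
  have p': "is_pullback C \<alpha> \<beta> (u \<cdot> \<gamma>) c" using pullback_iso_cod[OF p u(1,3)] u(4) by simp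
  have "u \<in> Arr C" using u(1) by (simp add: is_iso_def)
  then obtain \<alpha>' \<beta>' where q: "is_pullback C \<alpha>' \<beta>' (u \<cdot> \<gamma>) c" and "is_cokernel C \<alpha>'"
    using stable[of "u \<cdot> \<gamma>"] u(2,3) pD by (auto simp: cat_simps)
  moreover obtain w where "is_iso C w" "Cod C w = Dom C \<alpha>'" "\<alpha>' \<cdot> w = \<alpha>"
    by (rule pullback_unique[OF p' q])
  ultimately show ?thesis using cokernel_iso_right by (auto simp: is_cokernel_def)
qed

lemma pushout_kernel_transfer:
  assumes "is_kernel_of C k f"
    and stable: "\<And>\<beta>. \<beta> \<in> Arr C \<Longrightarrow> Dom C \<beta> = Dom C k \<Longrightarrow> \<exists>\<gamma> \<delta>. is_pushout C k \<beta> \<gamma> \<delta> \<and> is_kernel C \<delta>"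
    and "is_kernel_of C \<alpha> f" "is_pushout C \<alpha> \<beta> \<gamma> \<delta>"
  shows "is_kernel C \<delta>"
proof -
  have "\<exists>\<gamma>' \<delta>'. is_pullback (op_cat C) \<gamma>' \<delta>' \<beta>' k \<and> is_cokernel (op_cat C) \<gamma>'"
    if "\<beta>' \<in> Arr C" "Dom C \<beta>' = Dom C k" for \<beta>' using stable[OF that] by auto
  then show ?thesis
    using preadditive_category.pullback_cokernel_transfer[OF preadditive_op, of k f \<alpha> \<delta> \<gamma> \<beta>] assms(1,3,4)
    by simp
qed

lemma biprod_shear:
  assumes b: "is_biprod C A B P i j p q" and g: "g \<in> Hom C A B"
  shows "is_biprod C A B P (i \<boxplus> (j \<cdot> g)) j p (q \<boxplus> Neg C (g \<cdot> p))"
proof -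
  note bD = is_biprodD[OF b] and bS = biprod_simps[OF b]
  have "((i \<boxplus> (j \<cdot> g)) \<cdot> p) \<boxplus> (j \<cdot> (q \<boxplus> Neg C (g \<cdot> p))) = (i \<cdot> p) \<boxplus> (j \<cdot> q)"
    using bD(1-4) g by (simp add: arith_simps)
  then show ?thesis unfolding is_biprod_def
    using bD bS g by (simp add: arith_simps)
qed

end

lemma (in additive_category) biprod_ex:
  assumes "A \<in> Obj C" "B \<in> Obj C"
  obtains P i j p q where "is_biprod C A B P i j p q"
  using ex_direct_sum[OF assms] unfolding is_direct_sum_def by blast

text \<open>Either pushout represents the triples of arrows from \<open>B\<close>, \<open>B'\<close> and \<open>U\<close> whose composites with \<open>\<alpha>\<close>,
  \<open>\<beta>\<close> and \<open>i\<close> satisfy one linear relation.\<close>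

lemma (in preadditive_category) pushout_transpose:
  assumes b: "is_biprod C B U P \<iota> \<kappa> \<pi> \<rho>" and c: "is_biprod C B B' R k l r s"
    and \<alpha>: "\<alpha> \<in> Hom C A B" and \<beta>: "\<beta> \<in> Hom C A B'" and i: "i \<in> Hom C A U"
    and po: "is_pushout C ((\<iota> \<cdot> \<alpha>) \<boxplus> (\<kappa> \<cdot> i)) \<beta> \<gamma> \<delta>"
  shows "is_pushout C i ((l \<cdot> \<beta>) \<boxplus> Neg C (k \<cdot> \<alpha>)) (\<gamma> \<cdot> \<kappa>) (((\<gamma> \<cdot> \<iota>) \<cdot> r) \<boxplus> (\<delta> \<cdot> s))"
proof -
  note bD = is_biprodD[OF b] and bS = biprod_simps[OF b] and cD = is_biprodD[OF c]
    and cS = biprod_simps[OF c] and sD = is_pushoutD[OF po]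
  define a where "a = (\<iota> \<cdot> \<alpha>) \<boxplus> (\<kappa> \<cdot> i)"
  define f where "f = (l \<cdot> \<beta>) \<boxplus> Neg C (k \<cdot> \<alpha>)"
  define \<theta> where "\<theta> = ((\<gamma> \<cdot> \<iota>) \<cdot> r) \<boxplus> (\<delta> \<cdot> s)"
  define D where "D = Cod C \<delta>"
  have a: "a \<in> Hom C A P" "\<pi> \<cdot> a = \<alpha>" "\<rho> \<cdot> a = i" using \<alpha> i bD bS by (simp_all add: a_def arith_simps)
  have f: "f \<in> Hom C A R" using \<alpha> \<beta> cD(1-4) by (simp add: f_def arith_simps)
  have \<gamma>: "\<gamma> \<in> Hom C P D" and \<delta>: "\<delta> \<in> Hom C B' D"
    using sD a(1)[unfolded a_def] \<beta> by (simp_all add: D_def Hom_iff Cod_closed)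
  have \<theta>: "\<theta> \<in> Hom C R D" "\<theta> \<cdot> k = \<gamma> \<cdot> \<iota>" "\<theta> \<cdot> l = \<delta>"
    using \<gamma> \<delta> bD(1) cD cS by (simp_all add: \<theta>_def arith_simps)
  have \<gamma>\<kappa>: "\<gamma> \<cdot> \<kappa> \<in> Hom C U D" using \<gamma> bD by (simp add: cat_simps)
  have "is_pushout C i f (\<gamma> \<cdot> \<kappa>) \<theta>"
  proof (rule pushoutI)
    have "\<theta> \<cdot> f = (\<delta> \<cdot> \<beta>) \<boxplus> Neg C (\<gamma> \<cdot> (\<iota> \<cdot> \<alpha>))"
      using \<gamma> \<delta> bD(1) cD cS \<alpha> \<beta> by (simp add: \<theta>_def f_def arith_simps)
    also have "\<dots> = (\<gamma> \<cdot> \<kappa>) \<cdot> i"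
      unfolding sD(9)[symmetric] using \<gamma> \<alpha> i bD(1-4) by (simp add: arith_simps)
    finally show "is_comm_square C i f (\<gamma> \<cdot> \<kappa>) \<theta>"
      using i f \<gamma>\<kappa> \<theta>(1) by (simp add: is_comm_square_def Hom_iff)
  next
    fix x y assume h: "x \<in> Arr C" "y \<in> Arr C" "Cod C x = Cod C y" "Dom C x = Cod C i" "Dom C y = Cod C f"
      "x \<cdot> i = y \<cdot> f"
    define x' where "x' = ((y \<cdot> k) \<cdot> \<pi>) \<boxplus> (x \<cdot> \<rho>)"
    have x': "x' \<in> Hom C P (Cod C y)" "x' \<cdot> \<kappa> = x" "x' \<cdot> \<iota> = y \<cdot> k"
      using h(1-5) i f bD bS cD(1-4) by (simp_all add: x'_def arith_simps)
    have "x' \<cdot> a = ((y \<cdot> k) \<cdot> (\<pi> \<cdot> a)) \<boxplus> (x \<cdot> (\<rho> \<cdot> a))"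
      using h(1-5) i f bD(1-4) cD(1-4) a(1) by (simp add: x'_def cat_simps Cmp_Sum_L)
    also have "\<dots> = (y \<cdot> (k \<cdot> \<alpha>)) \<boxplus> (y \<cdot> f)"
      unfolding a(2,3) h(6) using h(1-5) \<alpha> cD(1-4) f by (simp add: cat_simps)
    also have "\<dots> = (y \<cdot> l) \<cdot> \<beta>"
      unfolding f_def using h(1-5) \<alpha> \<beta> cD(1-4) f by (simp add: arith_simps)
    finally have eq: "x' \<cdot> ((\<iota> \<cdot> \<alpha>) \<boxplus> (\<kappa> \<cdot> i)) = (y \<cdot> l) \<cdot> \<beta>" by (simp add: a_def)
    obtain u where u: "u \<in> Arr C" "Dom C u = Cod C \<gamma>" "Cod C u = Cod C (y \<cdot> l)" "u \<cdot> \<gamma> = x'" "u \<cdot> \<delta> = y \<cdot> l"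
      by (rule pushout_ex[OF po _ _ _ _ _ eq])
        (use x' h(1-5) cD(1-4) f a(1)[unfolded a_def] \<beta> in \<open>simp_all add: cat_simps\<close>)
    have u': "u \<in> Hom C D (Cod C y)" using u(1-3) h(1-5) \<gamma> cD(1-4) f by (simp add: cat_simps)
    have 1: "u \<cdot> (\<gamma> \<cdot> \<kappa>) = x" and 2: "u \<cdot> (\<gamma> \<cdot> \<iota>) = y \<cdot> k"
      using Cmp_cong_right1[OF u(4), of \<kappa>] Cmp_cong_right1[OF u(4), of \<iota>] u' \<gamma> bD(1,2) x'
      by (auto simp: Hom_iff)
    have "u \<cdot> \<theta> = ((u \<cdot> (\<gamma> \<cdot> \<iota>)) \<cdot> r) \<boxplus> ((u \<cdot> \<delta>) \<cdot> s)"
      using u' \<gamma> \<delta> bD(1) cD(1-4) unfolding \<theta>_def by (simp add: cat_simps Sum_cat Cmp_Sum_R)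
    also have "\<dots> = y \<cdot> ((k \<cdot> r) \<boxplus> (l \<cdot> s))"
      unfolding 2 u(5) using h(1-5) cD(1-4) f by (simp add: cat_simps Cmp_Sum_R)
    also have "\<dots> = y" unfolding cD using h(1-5) f by (simp add: cat_simps)
    finally show "\<exists>u \<in> Arr C. Cod C u = Cod C y \<and> Dom C u = Cod C (\<gamma> \<cdot> \<kappa>) \<and> u \<cdot> (\<gamma> \<cdot> \<kappa>) = x \<and> u \<cdot> \<theta> = y"
      using 1 u' \<gamma>\<kappa> by (intro bexI[of _ u]) (simp_all add: Hom_iff)
  next
    fix h assume h: "h \<in> Arr C" "Dom C h = Cod C \<theta>" "h \<cdot> (\<gamma> \<cdot> \<kappa>) = Zer C (Dom C (\<gamma> \<cdot> \<kappa>)) (Cod C h)"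
      "h \<cdot> \<theta> = Zer C (Dom C \<theta>) (Cod C h)"
    have hz: "h \<cdot> \<delta> = Zer C B' (Cod C h)" "h \<cdot> (\<gamma> \<cdot> \<iota>) = Zer C B (Cod C h)"
      using Cmp_cong_right1[OF h(4), of l] Cmp_cong_right1[OF h(4), of k] h(1,2) \<theta> cD(1,2)
      by (simp_all add: arith_simps)
    have "h \<cdot> \<gamma> = (h \<cdot> \<gamma>) \<cdot> ((\<iota> \<cdot> \<pi>) \<boxplus> (\<kappa> \<cdot> \<rho>))" unfolding bD using h(1,2) \<gamma> \<theta>(1) by (simp add: cat_simps)
    also have "\<dots> = ((h \<cdot> (\<gamma> \<cdot> \<iota>)) \<cdot> \<pi>) \<boxplus> ((h \<cdot> (\<gamma> \<cdot> \<kappa>)) \<cdot> \<rho>)"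
      using h(1,2) \<gamma> \<theta>(1) bD(1-4) by (simp add: cat_simps Cmp_Sum_R)
    also have "\<dots> = Zer C P (Cod C h)" unfolding hz h(3) using h(1,2) \<gamma>\<kappa> bD(1-4) by (simp add: arith_simps)
    finally have h\<gamma>: "h \<cdot> \<gamma> = Zer C P (Cod C h)" .
    show "h = Zer C (Dom C h) (Cod C h)"
      by (rule pushout_eq[OF po]) (use h(1,2) \<theta>(1) \<gamma> \<delta> hz h\<gamma> in \<open>simp_all add: arith_simps D_def[symmetric]\<close>)
  qed
  then show ?thesis by (simp add: f_def \<theta>_def)
qed

section \<open>A criterion for being integral and almost abelian\<close>

text \<open>The square of the last hypothesis factors through the pushout, whose corresponding leg is therefore
  monic as well.

  Stability of epimorphisms under pullback: let \<open>\<delta>\<close> be epic, let \<open>\<alpha>\<close> be its pullback along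
  \<open>\<gamma>\<close>, and let \<open>y \<alpha> = 0\<close>. The arrow \<open>(\<gamma>, -\<delta>)\<close> is the composite of the cokernel \<open>c\<close> of its
  kernel \<open>(\<alpha>, \<beta>)\<close> and of a monomorphism \<open>f'\<close>, because cokernels are stable under pullback.
  Since \<open>(y, 0)\<close> vanishes on this kernel, it factors through \<open>c\<close>. Pushing \<open>f'\<close> out along the
  factorization gives a monomorphism \<open>\<delta>'\<close> and an arrow that vanishes on \<open>\<delta>\<close>, hence vanishes,
  so \<open>\<delta>' y = 0\<close>.\<close>

theorem (in additive_category) integral_almost_abelianI:
  assumes LA: "\<And>f. f \<in> Arr C \<Longrightarrow> \<exists>c. is_cokernel_of C c f \<and> (\<forall>\<gamma> \<in> Arr C. Cod C \<gamma> = Cod C c \<longrightarrow>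
      (\<exists>\<alpha> \<beta>. is_pullback C \<alpha> \<beta> \<gamma> c \<and> is_cokernel C \<alpha>))"
    and RA: "\<And>f. f \<in> Arr C \<Longrightarrow> \<exists>k. is_kernel_of C k f \<and> (\<forall>\<beta> \<in> Arr C. Dom C \<beta> = Dom C k \<longrightarrow>
      (\<exists>\<gamma> \<delta>. is_pushout C k \<beta> \<gamma> \<delta> \<and> is_kernel C \<delta>))"
    and RI: "\<And>\<alpha> \<beta>. is_mono C \<alpha> \<Longrightarrow> \<beta> \<in> Arr C \<Longrightarrow> Dom C \<alpha> = Dom C \<beta> \<Longrightarrow>
      \<exists>\<gamma> \<delta>. is_comm_square C \<alpha> \<beta> \<gamma> \<delta> \<and> is_mono C \<delta>"
  shows "integral_category C \<and> almost_abelian_category C"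
proof -
  interpret preabelian_category C by unfold_locales (use LA RA in blast)+
  have mono: "is_mono C \<delta>" if p: "is_pushout C \<alpha> \<beta> \<gamma> \<delta>" and m: "is_mono C \<alpha>" for \<alpha> \<beta> \<gamma> \<delta>
  proof -
    note pD = is_pushoutD[OF p]
    obtain \<gamma>' \<delta>' where sq: "is_comm_square C \<alpha> \<beta> \<gamma>' \<delta>'" and m': "is_mono C \<delta>'"
      using RI[OF m, of \<beta>] pD by auto
    note sD = is_comm_squareD[OF sq]
    obtain w where w: "w \<in> Arr C" "Dom C w = Cod C \<gamma>" "Cod C w = Cod C \<delta>'" "w \<cdot> \<gamma> = \<gamma>'" "w \<cdot> \<delta> = \<delta>'"
      by (rule pushout_ex[OF p, of \<gamma>' \<delta>']) (use sD in auto)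
    show ?thesis
    proof (rule monoI)
      fix x assume x: "x \<in> Arr C" "Cod C x = Dom C \<delta>" "\<delta> \<cdot> x = Zer C (Dom C x) (Cod C \<delta>)"
      have "\<delta>' \<cdot> x = w \<cdot> (\<delta> \<cdot> x)"
        by (rule Cmp_cong_right1[OF w(5), symmetric]) (use x w pD in auto)
      also have "\<dots> = \<delta>' \<cdot> Zer C (Dom C x) (Cod C x)" unfolding x using x w sD pD by (simp add: arith_simps)
      finally show "x = Zer C (Dom C x) (Cod C x)"
        by (rule mono_cancel[OF m', rotated -1]) (use x w sD pD in \<open>simp_all add: arith_simps\<close>)
    qed (rule pD)
  qed
  have epi: "is_epi C \<alpha>" if p: "is_pullback C \<alpha> \<beta> \<gamma> \<delta>" and e: "is_epi C \<delta>" for \<alpha> \<beta> \<gamma> \<delta>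
  proof (rule epiI)
    note pD = is_pullbackD[OF p]
    obtain P i j r s where b: "is_biprod C (Cod C \<alpha>) (Cod C \<beta>) P i j r s"
      by (rule biprod_ex[of "Cod C \<alpha>" "Cod C \<beta>"]) (use pD in \<open>simp_all add: Dom_closed\<close>)
    note bD = is_biprodD[OF b] and bS = biprod_simps[OF b]
    define f where "f = (\<gamma> \<cdot> r) \<boxplus> Neg C (\<delta> \<cdot> s)"
    define m where "m = (i \<cdot> \<alpha>) \<boxplus> (j \<cdot> \<beta>)"
    have f: "f \<in> Hom C P (Cod C \<delta>)" and m: "m \<in> Hom C (Dom C \<alpha>) P"
      using pD bD(1-4) by (simp_all add: f_def m_def arith_simps)
    have fm: "f \<cdot> m = Zer C (Dom C \<alpha>) (Cod C \<delta>)"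
      using pD bD bS by (simp add: f_def m_def arith_simps)
    obtain c where c: "is_cokernel_of C c m" and stable: "\<And>\<gamma>. \<gamma> \<in> Arr C \<Longrightarrow> Cod C \<gamma> = Cod C c \<Longrightarrow>
        \<exists>\<alpha> \<beta>. is_pullback C \<alpha> \<beta> \<gamma> c \<and> is_cokernel C \<alpha>"
      using LA[of m] m by (auto simp: Hom_iff)
    note cD = is_cokernel_ofD[OF c]
    obtain f' where f': "f' \<in> Arr C" "Dom C f' = Cod C c" "Cod C f' = Cod C f" "f' \<cdot> c = f"
      by (rule cokernel_ex[OF c, of f]) (use f m fm in \<open>auto simp: Hom_iff\<close>)
    have mf': "is_mono C f'"
    proof (rule monoI)
      fix x assume x: "x \<in> Arr C" "Cod C x = Dom C f'" "f' \<cdot> x = Zer C (Dom C x) (Cod C f')"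
      obtain a a' where sq: "is_pullback C a a' x c" and "is_cokernel C a"
        using stable[of x] x f' by auto
      then have ea: "is_epi C a" by (auto simp: is_cokernel_def cokernel_epi)
      note sD = is_pullbackD[OF sq]
      have "f \<cdot> a' = f' \<cdot> (c \<cdot> a')"
        by (rule Cmp_cong_right1[OF f'(4), symmetric]) (use sD f' cD in auto)
      also have "f' \<cdot> (c \<cdot> a') = f' \<cdot> (x \<cdot> a)" using sD by simp
      also have "\<dots> = Zer C (Dom C x) (Cod C f) \<cdot> a"
        using x(3) by (intro Cmp_cong_right1) (use x(1,2) sD(1-8) f' in auto)
      also have "\<dots> = Zer C (Dom C a) (Cod C f)"
        using x(1,2) sD(1-8) f' f by (simp add: arith_simps)
      finally have eq: "\<gamma> \<cdot> (r \<cdot> a') = \<delta> \<cdot> (s \<cdot> a')"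
        using diff_zero_iff[of "\<gamma> \<cdot> (r \<cdot> a')" "\<delta> \<cdot> (s \<cdot> a')"] sD pD bD(1-4) f m cD
        by (simp add: f_def arith_simps)
      obtain u where u: "u \<in> Arr C" "Dom C u = Dom C (s \<cdot> a')" "Cod C u = Dom C \<alpha>"
          "\<alpha> \<cdot> u = r \<cdot> a'" "\<beta> \<cdot> u = s \<cdot> a'"
        by (rule pullback_ex[OF p, of "r \<cdot> a'" "s \<cdot> a'"]) (use eq sD(1-8) pD bD(1-4) m cD in \<open>simp_all add: cat_simps\<close>)
      have "a' = m \<cdot> u"
        by (rule biprod_ext[OF b, of _ "Dom C a"])
          (use u sD pD bD(1-4) bS m cD in \<open>simp_all add: m_def arith_simps\<close>)
      then have "x \<cdot> a = c \<cdot> (m \<cdot> u)" using sD(9) by simp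
      also have "\<dots> = Zer C (Dom C m) (Cod C c) \<cdot> u"
        using cD(4) by (intro Cmp_cong_right1) (use cD(1-3) m u pD bD(1-4) sD(1-8) in \<open>auto simp: Hom_iff\<close>)
      also have "\<dots> = Zer C (Dom C x) (Cod C x) \<cdot> a"
        using x(1,2) u(1-3) cD(1-3) sD(1-8) f'(1-3) m bD(1-4) by (simp add: arith_simps)
      finally show "x = Zer C (Dom C x) (Cod C x)"
        by (rule epi_cancel[OF ea, rotated -1]) (use x sD f'(1) in \<open>simp_all add: arith_simps\<close>)
    qed (rule f')
    fix y assume y: "y \<in> Arr C" "Dom C y = Cod C \<alpha>" "y \<cdot> \<alpha> = Zer C (Dom C \<alpha>) (Cod C y)"
    have ym: "(y \<cdot> r) \<cdot> m = Zer C (Dom C m) (Cod C y)"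
      using y pD bD(1-4) bS by (simp add: m_def arith_simps)
    obtain y' where y': "y' \<in> Arr C" "Dom C y' = Cod C c" "Cod C y' = Cod C (y \<cdot> r)" "y' \<cdot> c = y \<cdot> r"
      by (rule cokernel_ex[OF c, of "y \<cdot> r"]) (use y(1,2) ym m bD(1-4) in \<open>auto simp: cat_simps\<close>)
    obtain \<gamma>' \<delta>' where sq: "is_comm_square C f' y' \<gamma>' \<delta>'" and m': "is_mono C \<delta>'"
      using RI[OF mf', of y'] y' f' by auto
    note sD = is_comm_squareD[OF sq]
    have "\<gamma>' \<cdot> f = \<delta>' \<cdot> (y' \<cdot> c)"
      unfolding f'(4)[symmetric] using sD f' y' cD by (intro Cmp_cong_right) auto
    then have *: "\<gamma>' \<cdot> f = \<delta>' \<cdot> (y \<cdot> r)" unfolding y' .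
    have "\<gamma>' \<cdot> (f \<cdot> j) = \<delta>' \<cdot> ((y \<cdot> r) \<cdot> j)"
      using * sD f f' y y' bD(1-4) by (intro Cmp_cong_right) (auto simp: cat_simps)
    then have "Neg C (\<gamma>' \<cdot> \<delta>) = Zer C (Dom C \<delta>) (Cod C \<delta>')"
      using sD f f' y y' bD pD bS by (simp add: f_def arith_simps)
    then have "\<gamma>' \<cdot> \<delta> = Neg C (Zer C (Dom C \<delta>) (Cod C \<delta>'))"
      using Neg_Neg[of "\<gamma>' \<cdot> \<delta>"] sD pD f f' by (simp add: arith_simps)
    then have "\<gamma>' \<cdot> \<delta> = Zer C (Dom C \<gamma>') (Cod C \<gamma>') \<cdot> \<delta>"
      using sD pD f f' by (simp add: arith_simps)
    then have \<gamma>': "\<gamma>' = Zer C (Dom C \<gamma>') (Cod C \<gamma>')"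
      by (rule epi_cancel[OF e, rotated -1]) (use sD f f' in \<open>simp_all add: arith_simps\<close>)
    have "\<gamma>' \<cdot> (f \<cdot> i) = \<delta>' \<cdot> ((y \<cdot> r) \<cdot> i)"
      using * sD f f' y y' bD(1-4) by (intro Cmp_cong_right) (auto simp: cat_simps)
    moreover have "\<gamma>' \<cdot> (f \<cdot> i) = Zer C (Cod C \<alpha>) (Cod C \<delta>')"
      by (subst \<gamma>') (use sD f f' bD(1-4) in \<open>simp add: arith_simps\<close>)
    ultimately have "\<delta>' \<cdot> y = \<delta>' \<cdot> Zer C (Dom C y) (Cod C y)"
      using sD y y' bD by (simp add: arith_simps)
    then show "y = Zer C (Dom C y) (Cod C y)"
      by (rule mono_cancel[OF m', rotated -1]) (use sD y y' bD(1-4) in \<open>simp_all add: arith_simps\<close>)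
  qed (use is_pullbackD[OF p] in auto)
  have coker: "is_cokernel C \<alpha>" if p: "is_pullback C \<alpha> \<beta> \<gamma> \<delta>" and \<delta>: "is_cokernel C \<delta>" for \<alpha> \<beta> \<gamma> \<delta>
  proof -
    obtain f where f: "is_cokernel_of C \<delta> f" using \<delta> by (auto simp: is_cokernel_def)
    obtain c where "is_cokernel_of C c f" "\<forall>\<gamma> \<in> Arr C. Cod C \<gamma> = Cod C c \<longrightarrow>
        (\<exists>\<alpha> \<beta>. is_pullback C \<alpha> \<beta> \<gamma> c \<and> is_cokernel C \<alpha>)"
      using LA[OF is_cokernel_ofD(2)[OF f]] by blast
    then show ?thesis using pullback_cokernel_transfer[OF _ _ f p] by blast
  qed
  have ker: "is_kernel C \<delta>" if p: "is_pushout C \<alpha> \<beta> \<gamma> \<delta>" and \<alpha>: "is_kernel C \<alpha>" for \<alpha> \<beta> \<gamma> \<delta>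
  proof -
    obtain f where f: "is_kernel_of C \<alpha> f" using \<alpha> by (auto simp: is_kernel_def)
    obtain k where "is_kernel_of C k f" "\<forall>\<beta> \<in> Arr C. Dom C \<beta> = Dom C k \<longrightarrow>
        (\<exists>\<gamma> \<delta>. is_pushout C k \<beta> \<gamma> \<delta> \<and> is_kernel C \<delta>)"
      using RA[OF is_kernel_ofD(2)[OF f]] by blast
    then show ?thesis using pushout_kernel_transfer[OF _ _ f p] by blast
  qed
  show ?thesis
    by (intro conjI integral_category.intro left_integral_category.intro
        right_integral_category.intro almost_abelian_category.intro
        left_almost_abelian_category.intro right_almost_abelian_category.intro
        left_integral_category_axioms.intro right_integral_category_axioms.intro
        left_almost_abelian_category_axioms.intro right_almost_abelian_category_axioms.intro
        preabelian_category_axioms)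
      (blast intro: mono epi coker ker)+
qed

section \<open>Exact structures\<close>

text \<open>A self-dual set of axioms: passing to the opposite category derives half of the lemmas below from
  the other half.\<close>

locale exact_structure = additive_category C for C :: "('o, 'm) acat" (structure) +
  fixes E :: "('m \<times> 'm) set"
  assumes E_kernel: "(i, p) \<in> E \<Longrightarrow> is_kernel_of C i p"
    and E_cokernel: "(i, p) \<in> E \<Longrightarrow> is_cokernel_of C p i"
    and E_iso: "\<lbrakk>s \<in> E; is_seq_iso C s s'\<rbrakk> \<Longrightarrow> s' \<in> E"
    and E_inflation_Ide: "A \<in> Obj C \<Longrightarrow> is_inflation E (Ide C A)"
    and E_deflation_Ide: "A \<in> Obj C \<Longrightarrow> is_deflation E (Ide C A)"
    and E_inflation_Cmp: "\<lbrakk>is_inflation E f; is_inflation E g; Cod C f = Dom C g\<rbrakk>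
      \<Longrightarrow> is_inflation E (g \<cdot> f)"
    and E_deflation_Cmp: "\<lbrakk>is_deflation E f; is_deflation E g; Cod C f = Dom C g\<rbrakk>
      \<Longrightarrow> is_deflation E (g \<cdot> f)"
    and E_pushout: "\<lbrakk>is_inflation E \<alpha>; \<beta> \<in> Arr C; Dom C \<alpha> = Dom C \<beta>\<rbrakk>
      \<Longrightarrow> \<exists>\<gamma> \<delta>. is_pushout C \<alpha> \<beta> \<gamma> \<delta> \<and> is_inflation E \<delta>"
    and E_pullback: "\<lbrakk>is_deflation E \<delta>; \<gamma> \<in> Arr C; Cod C \<gamma> = Cod C \<delta>\<rbrakk>
      \<Longrightarrow> \<exists>\<alpha> \<beta>. is_pullback C \<alpha> \<beta> \<gamma> \<delta> \<and> is_deflation E \<alpha>"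

lemma (in exact_category) exact_structure: "exact_structure C E"
  by unfold_locales
    (fact ses_kernel ses_cokernel ses_iso inflation_Ide deflation_Ide inflation_Cmp deflation_Cmp
      inflation_pushout deflation_pullback)+

lemma is_inflation_converse [simp]: "is_inflation (E\<inverse>) f = is_deflation E f"
  and is_deflation_converse [simp]: "is_deflation (E\<inverse>) f = is_inflation E f"
  by (simp_all add: is_inflation_def is_deflation_def)

lemma (in category) is_seq_iso_op:
  assumes "is_seq_iso (op_cat C) (p, i) (p', i')"
  shows "is_seq_iso C (i, p) (i', p')"
proof -
  obtain X Y Z X' Y' Z' a b c where h: "p \<in> Hom C Y X" "i \<in> Hom C Z Y" "p' \<in> Hom C Y' X'" "i' \<in> Hom C Z' Y'"
    "a \<in> Hom C X' X" "b \<in> Hom C Y' Y" "c \<in> Hom C Z' Z" "is_iso C a" "is_iso C b" "is_iso C c"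
    "p \<cdot> b = a \<cdot> p'" "i \<cdot> c = b \<cdot> i'"
    using assms by (auto simp: is_seq_iso_def seq_def)
  obtain a' where a': "a' \<in> Arr C" "Dom C a' = X" "Cod C a' = X'" "a' \<cdot> a = Ide C X'" "a \<cdot> a' = Ide C X"
    using is_isoE[OF h(8)] h by (metis Hom_iff)
  obtain b' where b': "b' \<in> Arr C" "Dom C b' = Y" "Cod C b' = Y'" "b' \<cdot> b = Ide C Y'" "b \<cdot> b' = Ide C Y"
    using is_isoE[OF h(9)] h by (metis Hom_iff)
  obtain c' where c': "c' \<in> Arr C" "Dom C c' = Z" "Cod C c' = Z'" "c' \<cdot> c = Ide C Z'" "c \<cdot> c' = Ide C Z"
    using is_isoE[OF h(10)] h by (metis Hom_iff)
  have isos: "is_iso C a'" "is_iso C b'" "is_iso C c'"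
    using a' b' c' h by (auto simp: Hom_iff intro!: is_isoI[of a' C a] is_isoI[of b' C b] is_isoI[of c' C c])
  have "a' \<cdot> p = a' \<cdot> (p \<cdot> (b \<cdot> b'))" using h(1-10) a'(1-3) b' by (simp add: cat_simps)
  also have "\<dots> = a' \<cdot> (a \<cdot> (p' \<cdot> b'))" using h a'(1-3) b'(1-3) by (simp add: cat_simps Cmp_cong_right[OF h(11)])
  also have "\<dots> = p' \<cdot> b'" using h(1-10) a'(1-3) b'(1-3) by (simp add: cat_simps Cmp_cong_right1[OF a'(4)])
  finally have 1: "a' \<cdot> p = p' \<cdot> b'" .
  have "b' \<cdot> i = b' \<cdot> (i \<cdot> (c \<cdot> c'))" using h(1-10) b'(1-3) c' by (simp add: cat_simps)
  also have "\<dots> = b' \<cdot> (b \<cdot> (i' \<cdot> c'))" using h b'(1-3) c'(1-3) by (simp add: cat_simps Cmp_cong_right[OF h(12)])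
  also have "\<dots> = i' \<cdot> c'" using h(1-10) b'(1-3) c'(1-3) by (simp add: cat_simps Cmp_cong_right1[OF b'(4)])
  finally have 2: "b' \<cdot> i = i' \<cdot> c'" .
  show ?thesis unfolding is_seq_iso_def seq_def
    using h a'(1-3) b'(1-3) c'(1-3) isos 1 2 by (simp add: Hom_iff) metis
qed

context exact_structure
begin

lemma exact_structure_op: "exact_structure (op_cat C) (E\<inverse>)"
proof -
  have iso: "s' \<in> E\<inverse>" if "s \<in> E\<inverse>" "is_seq_iso (op_cat C) s s'" for s s'
    using E_iso[OF _ is_seq_iso_op] that by (cases s; cases s') auto
  have po: "\<exists>\<gamma> \<delta>. is_pushout (op_cat C) \<alpha> \<beta> \<gamma> \<delta> \<and> is_inflation (E\<inverse>) \<delta>"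
    if "is_inflation (E\<inverse>) \<alpha>" "\<beta> \<in> Arr (op_cat C)" "Dom (op_cat C) \<alpha> = Dom (op_cat C) \<beta>" for \<alpha> \<beta>
    using E_pullback[of \<alpha> \<beta>] that by auto
  have pb: "\<exists>\<alpha> \<beta>. is_pullback (op_cat C) \<alpha> \<beta> \<gamma> \<delta> \<and> is_deflation (E\<inverse>) \<alpha>"
    if "is_deflation (E\<inverse>) \<delta>" "\<gamma> \<in> Arr (op_cat C)" "Cod (op_cat C) \<gamma> = Cod (op_cat C) \<delta>" for \<gamma> \<delta>
    using E_pushout[of \<delta> \<gamma>] that by auto
  show ?thesis
    by (intro exact_structure.intro exact_structure_axioms.intro additive_category_op
        additive_category_axioms po pb)
      ((rule iso; assumption) | simp add: E_kernel E_cokernel E_inflation_Ide E_deflation_Ide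
        E_inflation_Cmp E_deflation_Cmp)+
qed

lemma E_D:
  assumes "(i, p) \<in> E"
  shows "i \<in> Arr C" "p \<in> Arr C" "Cod C i = Dom C p" "p \<cdot> i = Zer C (Dom C i) (Cod C p)"
    "is_mono C i" "is_epi C p"
  using is_kernel_ofD[OF E_kernel[OF assms]] kernel_mono[OF E_kernel[OF assms]]
    cokernel_epi[OF E_cokernel[OF assms]] by auto

lemma E_isoI:
  assumes "(i, p) \<in> E" "is_iso C a" "is_iso C b" "is_iso C c" "a \<in> Hom C (Dom C i) X"
    "b \<in> Hom C (Dom C p) Y" "c \<in> Hom C (Cod C p) Z" "i' \<in> Hom C X Y" "p' \<in> Hom C Y Z"
    "b \<cdot> i = i' \<cdot> a" "c \<cdot> p = p' \<cdot> b"
  shows "(i', p') \<in> E"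
proof (rule E_iso[OF assms(1)])
  have "(i, p) \<in> seq C (Dom C i) (Dom C p) (Cod C p)" "(i', p') \<in> seq C X Y Z"
    using E_D[OF assms(1)] assms by (simp_all add: seq_def Hom_def)
  then show "is_seq_iso C (i, p) (i', p')" using assms unfolding is_seq_iso_def by blast
qed

lemma is_iso_Ide: "A \<in> Obj C \<Longrightarrow> is_iso C (Ide C A)"
  by (rule is_isoI[of _ _ "Ide C A"]) (simp_all add: cat_simps)

lemma E_kernel_transfer:
  assumes "(j, p) \<in> E" "is_kernel_of C i p"
  shows "(i, p) \<in> E"
proof -
  note j = E_D[OF assms(1)] and i = is_kernel_ofD[OF assms(2)]
  obtain b where b: "is_iso C b" "Dom C b = Dom C j" "Cod C b = Dom C i" "i \<cdot> b = j"
    by (rule kernel_unique[OF assms(2) E_kernel[OF assms(1)]])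
  have "b \<in> Arr C" using b(1) by (simp add: is_iso_def)
  then show ?thesis
    by - (rule E_isoI[of j p b "Ide C (Dom C p)" "Ide C (Cod C p)" "Dom C i" "Dom C p" "Cod C p" i p, OF assms(1)],
      use i j b in \<open>simp_all add: cat_simps is_iso_Ide\<close>)
qed

lemma ses_pullback:
  assumes p: "is_pullback C \<alpha> \<beta> \<gamma> \<delta>" and i: "(i, \<delta>) \<in> E"
  obtains j where "(j, \<alpha>) \<in> E" "Dom C j = Dom C i" "\<beta> \<cdot> j = i"
proof -
  note pD = is_pullbackD[OF p] and iD = E_D[OF i]
  obtain \<alpha>' \<beta>' where q: "is_pullback C \<alpha>' \<beta>' \<gamma> \<delta>" and "is_deflation E \<alpha>'"
    using E_pullback[of \<delta> \<gamma>] i pD by (auto simp: is_deflation_def)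
  then obtain k where k: "(k, \<alpha>') \<in> E" by (auto simp: is_deflation_def)
  note kD = E_D[OF k]
  obtain u where u: "is_iso C u" "Dom C u = Dom C \<alpha>'" "Cod C u = Dom C \<alpha>" "\<alpha> \<cdot> u = \<alpha>'" "\<beta> \<cdot> u = \<beta>'"
    by (rule pullback_unique[OF q p])
  have uA: "u \<in> Arr C" using u by (auto simp: is_iso_def)
  have uk: "(u \<cdot> k, \<alpha>) \<in> E"
    by (rule E_isoI[of k \<alpha>' "Ide C (Dom C k)" u "Ide C (Cod C \<alpha>)" "Dom C k" "Dom C \<alpha>" "Cod C \<alpha>" "u \<cdot> k" \<alpha>, OF k])
      (use u uA pD(1) kD(1-3) is_pullbackD(1,6)[OF q] pD(3,6) in \<open>simp_all add: cat_simps is_iso_Ide\<close>)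
  have z: "\<gamma> \<cdot> Zer C (Dom C i) (Dom C \<gamma>) = \<delta> \<cdot> i" using pD iD by (simp add: arith_simps)
  obtain j where j: "j \<in> Arr C" "Dom C j = Dom C i" "Cod C j = Dom C \<alpha>" "\<alpha> \<cdot> j = Zer C (Dom C i) (Dom C \<gamma>)" "\<beta> \<cdot> j = i"
    by (rule pullback_ex[OF p _ _ _ _ _ z]) (use pD iD in \<open>simp_all add: arith_simps\<close>)
  have "is_kernel_of C j \<alpha>"
  proof (rule kernelI)
    fix x assume x: "x \<in> Arr C" "Cod C x = Dom C \<alpha>" "\<alpha> \<cdot> x = Zer C (Dom C x) (Cod C \<alpha>)"
    have "\<delta> \<cdot> (\<beta> \<cdot> x) = \<gamma> \<cdot> (\<alpha> \<cdot> x)" by (rule Cmp_cong_right[OF pD(9)[symmetric]]) (use x pD in auto)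
    also have "\<dots> = Zer C (Dom C (\<beta> \<cdot> x)) (Cod C \<delta>)" using x pD(1-8) by (simp add: arith_simps)
    finally have z: "\<delta> \<cdot> (\<beta> \<cdot> x) = Zer C (Dom C (\<beta> \<cdot> x)) (Cod C \<delta>)" .
    obtain v where v: "v \<in> Arr C" "Dom C v = Dom C (\<beta> \<cdot> x)" "Cod C v = Dom C i" "i \<cdot> v = \<beta> \<cdot> x"
      by (rule kernel_ex[OF E_kernel[OF i] _ _ z]) (use x pD in \<open>simp_all add: cat_simps\<close>)
    have "j \<cdot> v = x"
    proof (rule pullback_eq[OF p])
      show "\<alpha> \<cdot> (j \<cdot> v) = \<alpha> \<cdot> x" using Cmp_cong_right1[OF j(4), of v] j v x pD(1-8) iD(1) by (simp add: arith_simps)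
      show "\<beta> \<cdot> (j \<cdot> v) = \<beta> \<cdot> x" using Cmp_cong_right1[OF j(5), of v] j v x pD(1-8) by (simp add: arith_simps)
    qed (use j v x pD(1-8) in \<open>simp_all add: cat_simps\<close>)
    then show "\<exists>u\<in>Arr C. Dom C u = Dom C x \<and> Cod C u = Dom C j \<and> j \<cdot> u = x"
      using v j x pD(1-8) by (intro bexI[of _ v]) (simp_all add: cat_simps)
  next
    show "is_mono C j"
    proof (rule monoI)
      fix x assume x: "x \<in> Arr C" "Cod C x = Dom C j" "j \<cdot> x = Zer C (Dom C x) (Cod C j)"
      have "i \<cdot> x = \<beta> \<cdot> (j \<cdot> x)" using Cmp_cong_right1[OF j(5), of x] j x pD by simp
      also have "\<dots> = Zer C (Dom C x) (Cod C i)" using x j(1-3) pD(1-8) iD(3) by (simp add: arith_simps)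
      finally show "x = Zer C (Dom C x) (Cod C x)" using mono_zero[OF iD(5), of x] x j by simp
    qed (rule j)
  qed (use j pD in auto)
  then have "(j, \<alpha>) \<in> E" by (rule E_kernel_transfer[OF uk])
  then show thesis using that j by auto
qed

lemma ses_pushout:
  assumes "is_pushout C \<alpha> \<beta> \<gamma> \<delta>" and "(\<alpha>, p) \<in> E"
  obtains q where "(\<delta>, q) \<in> E" "Cod C q = Cod C p" "q \<cdot> \<gamma> = p"
  using exact_structure.ses_pullback[OF exact_structure_op, of \<delta> \<gamma> \<beta> \<alpha> p] assms by auto

lemma ses_pullback_ex:
  assumes "(i, \<delta>) \<in> E" "\<gamma> \<in> Arr C" "Cod C \<gamma> = Cod C \<delta>"
  obtains j \<alpha> \<beta> where "is_pullback C \<alpha> \<beta> \<gamma> \<delta>" "(j, \<alpha>) \<in> E" "Dom C j = Dom C i" "\<beta> \<cdot> j = i"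
proof -
  obtain \<alpha> \<beta> where p: "is_pullback C \<alpha> \<beta> \<gamma> \<delta>"
    using E_pullback[of \<delta> \<gamma>] assms by (auto simp: is_deflation_def)
  then show thesis using ses_pullback[OF p assms(1)] that by blast
qed

lemma ses_pushout_ex:
  assumes "(\<alpha>, p) \<in> E" "\<beta> \<in> Arr C" "Dom C \<alpha> = Dom C \<beta>"
  obtains q \<gamma> \<delta> where "is_pushout C \<alpha> \<beta> \<gamma> \<delta>" "(\<delta>, q) \<in> E" "Cod C q = Cod C p" "q \<cdot> \<gamma> = p"
proof -
  obtain \<gamma> \<delta> where p: "is_pushout C \<alpha> \<beta> \<gamma> \<delta>"
    using E_pushout[of \<alpha> \<beta>] assms by (auto simp: is_inflation_def)
  then show thesis using ses_pushout[OF p assms(1)] that by blast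
qed

lemma ses_Cmp_deflation:
  assumes j: "(j, p) \<in> E" and k: "(k, q) \<in> E" and sq: "is_pullback C a b k p"
  shows "(b, q \<cdot> p) \<in> E"
proof -
  note jD = E_D[OF j] and kD = E_D[OF k] and sD = is_pullbackD[OF sq]
  have "is_deflation E (q \<cdot> p)"
    using E_deflation_Cmp[of p q] j k sD kD by (auto simp: is_deflation_def)
  then obtain i where i: "(i, q \<cdot> p) \<in> E" by (auto simp: is_deflation_def)
  show ?thesis
  proof (rule E_kernel_transfer[OF i], rule kernelI)
    have "(q \<cdot> p) \<cdot> b = q \<cdot> (k \<cdot> a)" using kD(1-3) sD by (simp add: cat_simps)
    also have "\<dots> = Zer C (Dom C k) (Cod C q) \<cdot> a"
      by (rule Cmp_cong_right1[OF kD(4)]) (use kD(1-3) sD(1-8) in auto)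
    finally show "(q \<cdot> p) \<cdot> b = Zer C (Dom C b) (Cod C (q \<cdot> p))"
      using kD(1-3) sD(1-8) by (simp add: arith_simps)
  next
    fix x assume x: "x \<in> Arr C" "Cod C x = Dom C (q \<cdot> p)" "(q \<cdot> p) \<cdot> x = Zer C (Dom C x) (Cod C (q \<cdot> p))"
    have z: "q \<cdot> (p \<cdot> x) = Zer C (Dom C (p \<cdot> x)) (Cod C q)"
      using x kD(1-3) sD(1-8) by (simp add: arith_simps)
    obtain v where v: "v \<in> Arr C" "Dom C v = Dom C (p \<cdot> x)" "Cod C v = Dom C k" "k \<cdot> v = p \<cdot> x"
      by (rule kernel_ex[OF E_kernel[OF k] _ _ z]) (use x kD(1-3) sD(1-8) in \<open>simp_all add: cat_simps\<close>)
    obtain u where "u \<in> Arr C" "Dom C u = Dom C x" "Cod C u = Dom C a" "a \<cdot> u = v" "b \<cdot> u = x"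
      by (rule pullback_ex[OF sq, of v x]) (use v x kD(1-3) sD(1-8) in \<open>simp_all add: cat_simps\<close>)
    then show "\<exists>u\<in>Arr C. Dom C u = Dom C x \<and> Cod C u = Dom C b \<and> b \<cdot> u = x" using sD by auto
  next
    show "is_mono C b"
    proof (rule monoI)
      fix x assume x: "x \<in> Arr C" "Cod C x = Dom C b" "b \<cdot> x = Zer C (Dom C x) (Cod C b)"
      have "k \<cdot> (a \<cdot> x) = p \<cdot> (b \<cdot> x)" by (rule Cmp_cong_right[OF sD(9)]) (use x sD in auto)
      also have "\<dots> = Zer C (Dom C (a \<cdot> x)) (Cod C k)" using x sD(1-8) by (simp add: arith_simps)
      finally have "k \<cdot> (a \<cdot> x) = Zer C (Dom C (a \<cdot> x)) (Cod C k)" .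
      from mono_zero[OF kD(5) _ _ this] have "a \<cdot> x = Zer C (Dom C x) (Cod C a)"
        using x(1,2) sD(1-8) by (simp add: cat_simps)
      then show "x = Zer C (Dom C x) (Cod C x)"
        by - (rule pullback_eq[OF sq], use x sD(1-8) in \<open>simp_all add: arith_simps\<close>)
    qed (use sD in auto)
  qed (use kD(1-3) sD(1-8) in \<open>simp_all add: cat_simps\<close>)
qed

lemma ses_Cmp_inflation:
  assumes "(p, j) \<in> E" "(q, k) \<in> E" "is_pushout C p k b a"
  shows "(p \<cdot> q, b) \<in> E"
  using exact_structure.ses_Cmp_deflation[OF exact_structure_op, of j p k q a b] assms by simp

text \<open>The lift is constructed after pulling back along the deflation \<open>p\<close>, corrected by an arrow
  into the common kernel, and then descends again.\<close>

lemma pullback_of_ses: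
  assumes e: "(i, p) \<in> E" and e': "(i', p') \<in> E" and b: "b \<in> Hom C (Dom C p) (Dom C p')"
    and c: "c \<in> Hom C (Cod C p) (Cod C p')" and bi: "b \<cdot> i = i'" and pb: "p' \<cdot> b = c \<cdot> p"
  shows "is_pullback C b p p' c"
proof (rule pullbackI)
  note eD = E_D[OF e] and eD' = E_D[OF e']
  have di: "Dom C i' = Dom C i" unfolding bi[symmetric] using eD b by (simp add: cat_simps)
  show "is_comm_square C b p p' c" using eD eD' b c pb by (simp add: is_comm_square_def Hom_iff)
  have uniq: "h = Zer C (Dom C h) (Cod C h)"
    if h: "h \<in> Arr C" "Cod C h = Dom C b" "b \<cdot> h = Zer C (Dom C h) (Cod C b)"
      "p \<cdot> h = Zer C (Dom C h) (Cod C p)" for h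
  proof -
    obtain v where v: "v \<in> Arr C" "Dom C v = Dom C h" "Cod C v = Dom C i" "i \<cdot> v = h"
      by (rule kernel_ex[OF E_kernel[OF e], of h]) (use h b in \<open>simp_all add: Hom_iff\<close>)
    have "i' \<cdot> v = b \<cdot> (i \<cdot> v)" by (rule Cmp_cong_right1[OF bi, symmetric]) (use v eD b in \<open>auto simp: Hom_iff\<close>)
    also have "\<dots> = Zer C (Dom C v) (Cod C i')" using v h b eD' by (simp add: Hom_iff)
    finally have "v = Zer C (Dom C v) (Cod C v)"
      using mono_zero[OF eD'(5), of v] v di by simp
    then have "h = i \<cdot> Zer C (Dom C h) (Dom C i)" using v by metis
    then show ?thesis using h(1,2) eD(1-3) b by (simp add: arith_simps)
  qed
  show "h = Zer C (Dom C h) (Cod C h)"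
    if "h \<in> Arr C" "Cod C h = Dom C b" "b \<cdot> h = Zer C (Dom C h) (Cod C b)"
      "p \<cdot> h = Zer C (Dom C h) (Cod C p)" for h using uniq[OF that] .
  fix x y assume x: "x \<in> Arr C" and y: "y \<in> Arr C" and xy: "Dom C x = Dom C y" "Cod C x = Dom C p'"
    "Cod C y = Dom C c" "p' \<cdot> x = c \<cdot> y"
  obtain k t s where sq: "is_pullback C t s y p" and k: "(k, t) \<in> E"
    by (rule ses_pullback_ex[OF e, of y]) (use y xy c in \<open>auto simp: Hom_iff\<close>)
  note sD = is_pullbackD[OF sq] and kD = E_D[OF k]
  have "p' \<cdot> (x \<cdot> t) = c \<cdot> (y \<cdot> t)"
    by (rule Cmp_cong_right[OF xy(4)]) (use x y xy sD c eD' in \<open>auto simp: Hom_iff\<close>)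
  also have "\<dots> = c \<cdot> (p \<cdot> s)" using sD by simp
  also have "\<dots> = p' \<cdot> (b \<cdot> s)"
    by (rule Cmp_cong_right[OF pb[symmetric]]) (use sD c b eD eD' in \<open>auto simp: Hom_iff\<close>)
  finally have "p' \<cdot> ((x \<cdot> t) \<boxplus> Neg C (b \<cdot> s)) = Zer C (Dom C t) (Cod C p')"
    using x y xy(1-3) sD(1-8) eD(1-3) eD'(1-3) b by (simp add: arith_simps)
  then obtain w where w: "w \<in> Arr C" "Dom C w = Dom C t" "Cod C w = Dom C i'" "i' \<cdot> w = (x \<cdot> t) \<boxplus> Neg C (b \<cdot> s)"
    using kernel_ex[OF E_kernel[OF e'], of "(x \<cdot> t) \<boxplus> Neg C (b \<cdot> s)"] x y xy(1-3) sD(1-8) eD(1-3) eD'(1-3) b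
    by (auto simp: Hom_iff Cmp_cat Sum_cat Neg_cat)
  define s' where "s' = s \<boxplus> (i \<cdot> w)"
  have s': "s' \<in> Hom C (Dom C t) (Dom C p)"
    using w sD(1-8) eD(1-3) di by (simp add: s'_def cat_simps Sum_cat)
  have "b \<cdot> s' = (b \<cdot> s) \<boxplus> (i' \<cdot> w)"
    using w(1-3) sD(1-8) eD(1-3) di b Cmp_cong_right1[OF bi, of w] by (simp add: s'_def cat_simps Cmp_Sum_R)
  also have "\<dots> = x \<cdot> t" unfolding w(4) using x y xy(1-3) sD(1-8) eD(1-3) b by (simp add: arith_simps)
  finally have bs: "b \<cdot> s' = x \<cdot> t" .
  have "p \<cdot> s' = (p \<cdot> s) \<boxplus> (p \<cdot> (i \<cdot> w))"
    using w(1-3) sD(1-8) eD(1-3) di by (simp add: s'_def cat_simps Cmp_Sum_R)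
  also have "p \<cdot> (i \<cdot> w) = Zer C (Dom C i) (Cod C p) \<cdot> w"
    by (rule Cmp_cong_right1[OF eD(4)]) (use w(1-3) eD(1-3) di in auto)
  also have "(p \<cdot> s) \<boxplus> \<dots> = y \<cdot> t" unfolding sD(9) using w(1-3) eD(1-3) sD(1-8) di by (simp add: arith_simps)
  finally have ps: "p \<cdot> s' = y \<cdot> t" .
  have tk: "z \<cdot> (t \<cdot> k) = Zer C (Dom C k) (Cod C z)" if "z \<in> Arr C" "Dom C z = Dom C y" for z
    unfolding kD(4) using that kD(1-3) sD(1-8) by (simp add: arith_simps)
  have "b \<cdot> (s' \<cdot> k) = x \<cdot> (t \<cdot> k)" "p \<cdot> (s' \<cdot> k) = y \<cdot> (t \<cdot> k)"
    using Cmp_cong_right[OF bs, of k] Cmp_cong_right[OF ps, of k] s' b eD(1-3) kD(1-3) sD(1-8) x y xy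
    by (auto simp: Hom_iff)
  then have "s' \<cdot> k = Zer C (Dom C (s' \<cdot> k)) (Cod C (s' \<cdot> k))"
    by - (rule uniq, use tk x y xy(1-3) s' b kD(1-3) eD(1-3) sD(1-8) in \<open>simp_all add: cat_simps\<close>)
  then obtain u where u: "u \<in> Arr C" "Dom C u = Cod C t" "Cod C u = Cod C s'" "u \<cdot> t = s'"
    using cokernel_ex[OF E_cokernel[OF k], of s'] s' kD by (auto simp: Hom_iff Cmp_cat)
  have "b \<cdot> u = x"
    by (rule epi_cancel[OF kD(6)]) (use u s' b x xy(1,2) sD(1-8) bs in \<open>simp_all add: cat_simps\<close>)
  moreover have "p \<cdot> u = y"
    by (rule epi_cancel[OF kD(6)]) (use u s' y eD(1-3) sD(1-8) ps in \<open>simp_all add: cat_simps\<close>)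
  ultimately show "\<exists>u \<in> Arr C. Dom C u = Dom C y \<and> Cod C u = Dom C b \<and> b \<cdot> u = x \<and> p \<cdot> u = y"
    using u s' b sD by (intro bexI[of _ u]) (auto simp: Hom_iff)
qed

lemma pushout_of_ses:
  assumes "(i, p) \<in> E" "(i', p') \<in> E" "b \<in> Hom C (Cod C i') (Cod C i)"
    "c \<in> Hom C (Dom C i') (Dom C i)" "p \<cdot> b = p'" "b \<cdot> i' = i \<cdot> c"
  shows "is_pushout C c i' i b"
  using exact_structure.pullback_of_ses[OF exact_structure_op, of p i p' i' b c] assms by simp

lemma projection_deflation:
  assumes b: "is_biprod C A B P i j p q"
  shows "is_deflation E p"
proof -
  note bD = is_biprodD[OF b]
  have B: "B \<in> Obj C" using bD by (simp add: Hom_iff)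
  obtain z where z: "(Ide C B, z) \<in> E" using E_inflation_Ide[OF B] by (auto simp: is_inflation_def)
  have z': "z = Zer C B (Cod C z)" "z \<in> Hom C B (Cod C z)" using E_D[OF z] B by (simp_all add: cat_simps)
  have "is_pullback C p q (Zer C A (Cod C z)) z"
  proof (rule pullbackI)
    have "z \<cdot> q = Zer C P (Cod C z)" by (subst z') (use bD(1-4) z'(2) in \<open>simp add: arith_simps\<close>)
    then show "is_comm_square C p q (Zer C A (Cod C z)) z"
      using bD(1-4) z'(2) by (simp add: is_comm_square_def arith_simps)
  next
    fix x y assume "x \<in> Arr C" "y \<in> Arr C" "Dom C x = Dom C y" "Cod C x = Dom C (Zer C A (Cod C z))"
      "Cod C y = Dom C z"
    then show "\<exists>u\<in>Arr C. Dom C u = Dom C y \<and> Cod C u = Dom C p \<and> p \<cdot> u = x \<and> q \<cdot> u = y"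
      using bD(1-4) z'(2) biprod_simps[OF b]
      by (intro bexI[of _ "(i \<cdot> x) \<boxplus> (j \<cdot> y)"]) (simp_all add: arith_simps)
  next
    fix h assume "h \<in> Arr C" "Cod C h = Dom C p" "p \<cdot> h = Zer C (Dom C h) (Cod C p)"
      "q \<cdot> h = Zer C (Dom C h) (Cod C q)"
    then show "h = Zer C (Dom C h) (Cod C h)"
      by - (rule biprod_ext[OF b, of _ "Dom C h"], use bD(1-4) in \<open>simp_all add: arith_simps\<close>)
  qed
  from ses_pullback[OF this z] show ?thesis by (auto simp: is_deflation_def)
qed

lemma injection_inflation: "is_biprod C A B P i j p q \<Longrightarrow> is_inflation E i"
  using exact_structure.projection_deflation[OF exact_structure_op, of A B P p q i j] by simp

lemma section_biprod:
  assumes j: "(j, p) \<in> E" and s: "s \<in> Hom C (Cod C p) (Dom C p)" "p \<cdot> s = Ide C (Cod C p)"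
  shows "\<exists>r. is_biprod C (Cod C p) (Dom C j) (Dom C p) s j p r"
proof -
  note jD = E_D[OF j]
  define e where "e = Ide C (Dom C p) \<boxplus> Neg C (s \<cdot> p)"
  have e: "e \<in> Hom C (Dom C p) (Dom C p)" using jD(1-3) s(1) by (simp add: e_def arith_simps)
  have pe: "p \<cdot> e = Zer C (Dom C e) (Cod C p)"
    using jD(1-3) s Cmp_cong_right1[OF s(2), of p] e by (simp add: e_def arith_simps)
  obtain r where r: "r \<in> Arr C" "Dom C r = Dom C e" "Cod C r = Dom C j" "j \<cdot> r = e"
    by (rule kernel_ex[OF E_kernel[OF j] _ _ pe]) (use e in \<open>simp_all add: Hom_iff\<close>)
  have r': "r \<in> Hom C (Dom C p) (Dom C j)" using r(1-3) e jD by (simp add: cat_simps)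
  have jr: "j \<cdot> (r \<cdot> x) = e \<cdot> x" if "x \<in> Arr C" "Cod C x = Dom C p" for x
    by (rule Cmp_cong_right1[OF r(4)]) (use r' jD that in \<open>auto simp: Hom_iff\<close>)
  have "j \<cdot> (r \<cdot> j) = j \<cdot> Ide C (Dom C j)"
    using jr[of j] jD(1-4) s(1) by (simp add: e_def arith_simps)
  then have rj: "r \<cdot> j = Ide C (Dom C j)"
    by - (rule mono_cancel[OF jD(5)], use r' jD(1-3) in \<open>simp_all add: cat_simps\<close>)
  have "j \<cdot> (r \<cdot> s) = j \<cdot> Zer C (Cod C p) (Dom C j)"
    using jr[of s] jD(1-3) s by (simp add: e_def arith_simps)
  then have rs: "r \<cdot> s = Zer C (Cod C p) (Dom C j)"
    by - (rule mono_cancel[OF jD(5)], use r' s(1) jD(1-3) in \<open>simp_all add: arith_simps\<close>)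
  have "(s \<cdot> p) \<boxplus> (j \<cdot> r) = Ide C (Dom C p)"
    unfolding r(4) e_def using s(1) jD(1-3) by (simp add: arith_simps)
  then show ?thesis unfolding is_biprod_def
    using r' s jD(1-4) rj rs by (intro exI[of _ r]) (simp add: cat_simps)
qed

lemma ses_sum_right:
  assumes i: "(i, p) \<in> E" and b: "is_biprod C (Dom C i) A P \<iota> \<kappa> \<pi> \<rho>"
    and b': "is_biprod C (Cod C i) A P' \<iota>' \<kappa>' \<pi>' \<rho>'"
  obtains q where "((\<iota>' \<cdot> (i \<cdot> \<pi>)) \<boxplus> (\<kappa>' \<cdot> \<rho>), q) \<in> E" "Cod C q = Cod C p"
proof -
  note iD = E_D[OF i] and bD = is_biprodD[OF b] and bS = biprod_simps[OF b]
    and bD' = is_biprodD[OF b'] and bS' = biprod_simps[OF b']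
  define i' where "i' = (\<iota>' \<cdot> (i \<cdot> \<pi>)) \<boxplus> (\<kappa>' \<cdot> \<rho>)"
  have i': "i' \<in> Hom C P P'" using iD(1-3) bD(1-4) bD'(1-4) by (simp add: i'_def arith_simps)
  have "is_pushout C i \<iota> \<iota>' i'"
  proof (rule pushoutI)
    show "is_comm_square C i \<iota> \<iota>' i'"
      using iD(1-3) bD bS bD'(1-4) i' by (simp add: is_comm_square_def) (simp add: i'_def arith_simps)
  next
    fix x y assume h: "x \<in> Arr C" "y \<in> Arr C" "Cod C x = Cod C y" "Dom C x = Cod C i"
      "Dom C y = Cod C \<iota>" "x \<cdot> i = y \<cdot> \<iota>"
    let ?u = "(x \<cdot> \<pi>') \<boxplus> ((y \<cdot> \<kappa>) \<cdot> \<rho>')"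
    have u: "?u \<in> Hom C P' (Cod C y)" using h(1-5) iD(1-3) bD(1-4) bD'(1-4) by (simp add: arith_simps)
    have "?u \<cdot> i' = (x \<cdot> (i \<cdot> \<pi>)) \<boxplus> ((y \<cdot> \<kappa>) \<cdot> \<rho>)"
      using h(1-5) iD(1-3) bD(1-4) bD' bS' by (simp add: i'_def arith_simps)
    also have "x \<cdot> (i \<cdot> \<pi>) = y \<cdot> (\<iota> \<cdot> \<pi>)"
      by (rule Cmp_cong_right[OF h(6)]) (use h iD bD in \<open>auto simp: Hom_iff\<close>)
    also have "\<dots> \<boxplus> ((y \<cdot> \<kappa>) \<cdot> \<rho>) = y \<cdot> ((\<iota> \<cdot> \<pi>) \<boxplus> (\<kappa> \<cdot> \<rho>))"
      using h(1-5) bD(1-4) by (simp add: cat_simps Cmp_Sum_R)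
    also have "\<dots> = y" unfolding bD using h(1-5) bD(1-4) by (simp add: cat_simps)
    finally have "?u \<cdot> i' = y" .
    moreover have "?u \<cdot> \<iota>' = x" using h(1-5) iD(1-3) bD(1-4) bD' bS' by (simp add: arith_simps)
    ultimately show "\<exists>u \<in> Arr C. Cod C u = Cod C y \<and> Dom C u = Cod C \<iota>' \<and> u \<cdot> \<iota>' = x \<and> u \<cdot> i' = y"
      using u bD'(1-4) by (intro bexI[of _ ?u]) (simp_all add: Hom_iff)
  next
    fix h assume h: "h \<in> Arr C" "Dom C h = Cod C i'" "h \<cdot> \<iota>' = Zer C (Dom C \<iota>') (Cod C h)"
      "h \<cdot> i' = Zer C (Dom C i') (Cod C h)"
    have "h \<cdot> \<kappa>' = (h \<cdot> i') \<cdot> \<kappa>"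
      using h(1,2) i' iD(1-3) bD bS bD'(1-4) by (simp add: i'_def arith_simps)
    also have "\<dots> = Zer C A (Cod C h)" unfolding h(4) using h(1,2) i' bD(1-4) by (simp add: arith_simps)
    finally have h\<kappa>: "h \<cdot> \<kappa>' = Zer C A (Cod C h)" .
    have "h = h \<cdot> ((\<iota>' \<cdot> \<pi>') \<boxplus> (\<kappa>' \<cdot> \<rho>'))" unfolding bD' using h(1,2) i' by (simp add: cat_simps)
    also have "\<dots> = ((h \<cdot> \<iota>') \<cdot> \<pi>') \<boxplus> ((h \<cdot> \<kappa>') \<cdot> \<rho>')"
      using h(1,2) i' bD'(1-4) by (simp add: cat_simps Cmp_Sum_R)
    also have "\<dots> = Zer C P' (Cod C h)" unfolding h(3) h\<kappa> using h(1,2) i' bD'(1-4) by (simp add: arith_simps)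
    finally show "h = Zer C (Dom C h) (Cod C h)" using h(2) i' by (simp add: Hom_iff)
  qed
  then show thesis using ses_pushout[OF _ i] that unfolding i'_def by blast
qed

text \<open>The arrow \<open>(g, u)\<close> is the composite of the injection \<open>(1, g) : D \<rightarrow> D \<oplus> B\<close> and of
  \<open>u \<oplus> 1 : D \<oplus> B \<rightarrow> U \<oplus> B\<close>.\<close>

lemma inflation_column:
  assumes b: "is_biprod C B U P \<iota> \<kappa> \<pi> \<rho>" and g: "g \<in> Hom C D B" and u: "u \<in> Hom C D U" "is_inflation E u"
  shows "is_inflation E ((\<iota> \<cdot> g) \<boxplus> (\<kappa> \<cdot> u))"
proof -
  note bD = is_biprodD[OF b]
  obtain R k l r s where c: "is_biprod C D B R k l r s"
    by (rule biprod_ex[of D B]) (use g in \<open>auto simp: Hom_iff\<close>)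
  note cD = is_biprodD[OF c] and cS = biprod_simps[OF c]
  obtain p where p: "(u, p) \<in> E" using u(2) by (auto simp: is_inflation_def)
  obtain q where q: "((\<kappa> \<cdot> (u \<cdot> r)) \<boxplus> (\<iota> \<cdot> s), q) \<in> E"
    by (rule ses_sum_right[OF p, of B R k l r s P \<kappa> \<iota> \<rho> \<pi>]) (use c is_biprod_sym[OF b] u in \<open>auto simp: Hom_iff\<close>)
  have "is_inflation E (k \<boxplus> (l \<cdot> g))" by (rule injection_inflation[OF biprod_shear[OF c g]])
  then have "is_inflation E (((\<kappa> \<cdot> (u \<cdot> r)) \<boxplus> (\<iota> \<cdot> s)) \<cdot> (k \<boxplus> (l \<cdot> g)))"
    using q cD(1-4) bD(1-4) u g by (intro E_inflation_Cmp) (auto simp: is_inflation_def arith_simps)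
  also have "((\<kappa> \<cdot> (u \<cdot> r)) \<boxplus> (\<iota> \<cdot> s)) \<cdot> (k \<boxplus> (l \<cdot> g)) = (\<iota> \<cdot> g) \<boxplus> (\<kappa> \<cdot> u)"
    using cD cS bD(1-4) u g by (simp add: arith_simps)
  finally show ?thesis .
qed

end

section \<open>Additive quotients\<close>

definition arr_class :: "('o, 'm) acat \<Rightarrow> 'o set \<Rightarrow> 'm \<Rightarrow> 'm set" where
  "arr_class K \<W> f = quot_rel K \<W> `` {f}"

locale additive_quotient = additive_category K for K :: "('o, 'm) acat" (structure) +
  fixes \<W> :: "'o set"
  assumes \<W>_Obj: "\<W> \<subseteq> Obj K"
    and \<W>_nonempty: "\<W> \<noteq> {}"
    and \<W>_sum: "\<lbrakk>A \<in> \<W>; B \<in> \<W>\<rbrakk> \<Longrightarrow> \<exists>P \<in> \<W>. is_direct_sum K A B P"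
begin

abbreviation null :: "'m \<Rightarrow> bool" where "null \<equiv> factors_through K \<W>"

abbreviation cls :: "'m \<Rightarrow> 'm set" where "cls \<equiv> arr_class K \<W>"

abbreviation Q :: "('o, 'm set) acat" where "Q \<equiv> quot_cat K \<W>"

lemma nullI:
  assumes "u \<in> Hom K A W" "v \<in> Hom K W B" "W \<in> \<W>" shows "null (v \<cdot> u)"
proof -
  have "v \<cdot> u \<in> Arr K" "Dom K (v \<cdot> u) = A" "Cod K (v \<cdot> u) = B" using assms by (simp_all add: cat_simps)
  then show ?thesis unfolding factors_through_def using assms by auto
qed

lemma nullE:
  assumes "null h" "h \<in> Hom K A B"
  obtains W u v where "W \<in> \<W>" "u \<in> Hom K A W" "v \<in> Hom K W B" "h = v \<cdot> u"
  using assms unfolding factors_through_def by (auto simp: Hom_def)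

lemma null_Arr: "null h \<Longrightarrow> h \<in> Arr K"
  by (simp add: factors_through_def)

lemma null_Zer: assumes "A \<in> Obj K" "B \<in> Obj K" shows "null (Zer K A B)"
proof -
  obtain W where "W \<in> \<W>" using \<W>_nonempty by auto
  then have "null (Zer K W B \<cdot> Zer K A W)"
    using assms \<W>_Obj by (intro nullI[of _ A W _ B]) (auto simp: arith_simps)
  then show ?thesis using assms \<W>_Obj \<open>W \<in> \<W>\<close> by (simp add: arith_simps subset_iff)
qed

lemma null_comp_left: assumes "null h" "h \<in> Hom K A B" "g \<in> Hom K B D" shows "null (g \<cdot> h)"
proof -
  obtain W u v where h: "W \<in> \<W>" "u \<in> Hom K A W" "v \<in> Hom K W B" "h = v \<cdot> u"
    by (rule nullE[OF assms(1,2)])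
  have "null ((g \<cdot> v) \<cdot> u)" using h assms by (intro nullI[of _ A W _ D]) (auto simp: cat_simps)
  then show ?thesis using h assms by (simp add: cat_simps)
qed

lemma null_comp_right: assumes "null h" "h \<in> Hom K A B" "g \<in> Hom K D A" shows "null (h \<cdot> g)"
proof -
  obtain W u v where h: "W \<in> \<W>" "u \<in> Hom K A W" "v \<in> Hom K W B" "h = v \<cdot> u"
    by (rule nullE[OF assms(1,2)])
  have "null (v \<cdot> (u \<cdot> g))" using h assms by (intro nullI[of _ D W _ B]) (auto simp: cat_simps)
  then show ?thesis using h assms by (simp add: cat_simps)
qed

lemma null_Sum: assumes "null f" "null g" "f \<in> Hom K A B" "g \<in> Hom K A B" shows "null (f \<boxplus> g)"
proof -
  obtain W u v where f: "W \<in> \<W>" "u \<in> Hom K A W" "v \<in> Hom K W B" "f = v \<cdot> u"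
    by (rule nullE[OF assms(1,3)])
  obtain W' u' v' where g: "W' \<in> \<W>" "u' \<in> Hom K A W'" "v' \<in> Hom K W' B" "g = v' \<cdot> u'"
    by (rule nullE[OF assms(2,4)])
  obtain P i j p q where P: "P \<in> \<W>" and b: "is_biprod K W W' P i j p q"
    using \<W>_sum[OF f(1) g(1)] by (auto simp: is_direct_sum_def)
  note bD = is_biprodD[OF b]
  have "null (((v \<cdot> p) \<boxplus> (v' \<cdot> q)) \<cdot> ((i \<cdot> u) \<boxplus> (j \<cdot> u')))"
    using P f(1-3) g(1-3) bD(1-4) by (intro nullI[of _ A P _ B]) (auto simp: arith_simps)
  also have "((v \<cdot> p) \<boxplus> (v' \<cdot> q)) \<cdot> ((i \<cdot> u) \<boxplus> (j \<cdot> u')) = f \<boxplus> g"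
    using f g bD(1-4) biprod_simps[OF b] by (simp add: arith_simps)
  finally show ?thesis .
qed

lemma null_Neg: assumes "null f" shows "null (Neg K f)"
proof -
  have f: "f \<in> Hom K (Dom K f) (Cod K f)" using null_Arr[OF assms] by (simp add: Hom_def)
  have "null (Neg K (Ide K (Cod K f)) \<cdot> f)"
    using f by (intro null_comp_left[OF assms f]) (auto simp: arith_simps)
  then show ?thesis using f by (simp add: arith_simps)
qed

lemma null_diff_trans:
  assumes "null (f \<boxplus> Neg K g)" "null (g \<boxplus> Neg K h)" "f \<in> Hom K A B" "g \<in> Hom K A B" "h \<in> Hom K A B"
  shows "null (f \<boxplus> Neg K h)"
proof -
  have "null ((f \<boxplus> Neg K g) \<boxplus> (g \<boxplus> Neg K h))"
    by (rule null_Sum[OF assms(1,2), of A B]) (use assms(3-5) in \<open>auto simp: arith_simps\<close>)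
  also have "(f \<boxplus> Neg K g) \<boxplus> (g \<boxplus> Neg K h) = f \<boxplus> (Neg K g \<boxplus> (g \<boxplus> Neg K h))"
    using assms(3-5) by (intro Sum_assoc) (auto simp: arith_simps)
  also have "\<dots> = f \<boxplus> Neg K h" using assms(3-5) by (subst Neg_cancel) (auto simp: arith_simps)
  finally show ?thesis .
qed

lemma null_diff_sym:
  assumes "null (f \<boxplus> Neg K g)" "f \<in> Hom K A B" "g \<in> Hom K A B"
  shows "null (g \<boxplus> Neg K f)"
  using null_Neg[OF assms(1)] assms(2,3) by (simp add: arith_simps)

lemma quot_rel_iff:
  "(f, g) \<in> quot_rel K \<W> \<longleftrightarrow> f \<in> Arr K \<and> g \<in> Hom K (Dom K f) (Cod K f) \<and> null (f \<boxplus> Neg K g)"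
proof -
  have "(\<exists>h \<in> Hom K A B. null h \<and> g = f \<boxplus> h) \<longleftrightarrow> null (f \<boxplus> Neg K g)"
    if f: "f \<in> Hom K A B" and g: "g \<in> Hom K A B" for A B
  proof
    assume "\<exists>h \<in> Hom K A B. null h \<and> g = f \<boxplus> h"
    then obtain h where h: "h \<in> Hom K A B" "null h" "g = f \<boxplus> h" by auto
    have "f \<boxplus> Neg K g = Neg K h" unfolding h(3) using f h(1) by (simp add: arith_simps)
    then show "null (f \<boxplus> Neg K g)" using null_Neg[OF h(2)] by simp
  next
    assume n: "null (f \<boxplus> Neg K g)"
    have "null (g \<boxplus> Neg K f)" by (rule null_diff_sym[OF n f g])
    moreover have "g = f \<boxplus> (g \<boxplus> Neg K f)" using f g by (simp add: arith_simps)
    moreover have "g \<boxplus> Neg K f \<in> Hom K A B" using f g by (simp add: arith_simps)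
    ultimately show "\<exists>h \<in> Hom K A B. null h \<and> g = f \<boxplus> h" by blast
  qed
  from this[of "Dom K f" "Cod K f"] show ?thesis by (auto simp: quot_rel_def Hom_iff)
qed

lemma equiv_quot_rel: "equiv (Arr K) (quot_rel K \<W>)"
proof (rule equivI)
  show "quot_rel K \<W> \<subseteq> Arr K \<times> Arr K" by (auto simp: quot_rel_iff Hom_def)
  show "refl_on (Arr K) (quot_rel K \<W>)"
    by (auto simp: refl_on_def quot_rel_iff arith_simps null_Zer)
  show "sym (quot_rel K \<W>)"
    by (rule symI) (auto simp: quot_rel_iff Hom_iff intro: null_diff_sym)
  show "trans (quot_rel K \<W>)"
    by (rule transI) (auto simp: quot_rel_iff Hom_iff intro: null_diff_trans)
qed

lemma cls_eq_iff:
  assumes "f \<in> Hom K A B" "g \<in> Hom K A B"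
  shows "cls f = cls g \<longleftrightarrow> null (f \<boxplus> Neg K g)"
  using eq_equiv_class_iff[OF equiv_quot_rel, of f g] assms by (simp add: quot_rel_iff Hom_iff arr_class_def)

lemma cls_memD:
  assumes "f' \<in> cls f" "f \<in> Hom K A B" shows "f' \<in> Hom K A B" "null (f \<boxplus> Neg K f')"
  using assms by (auto simp: quot_rel_iff Hom_iff arr_class_def)

lemma cls_self: "f \<in> Arr K \<Longrightarrow> f \<in> cls f"
  using equiv_class_self[OF equiv_quot_rel] by (auto simp: arr_class_def)

lemma cls_image:
  assumes "x \<in> X" "\<And>y. y \<in> X \<Longrightarrow> (x, y) \<in> quot_rel K \<W>"
  shows "quot_rel K \<W> `` X = cls x"
proof -
  have "cls y = cls x" if "y \<in> X" for y
    using equiv_class_eq[OF equiv_quot_rel assms(2)[OF that]] by (simp add: arr_class_def)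
  then have "(\<Union>y \<in> X. cls y) = (\<Union>y \<in> X. cls x)" by (rule SUP_cong[OF refl])
  also have "\<dots> = cls x" using assms(1) by blast
  finally have "(\<Union>y \<in> X. cls y) = cls x" .
  then show ?thesis unfolding arr_class_def by (subst Image_eq_UN) simp
qed

lemma Q_simps [simp]: "Obj Q = Obj K" "Ide Q A = cls (Ide K A)" "Zer Q A B = cls (Zer K A B)"
  by (simp_all add: quot_cat_def arr_class_def)

lemma Arr_Q: "Arr Q = cls ` Arr K"
  by (auto simp: quot_cat_def quotient_def arr_class_def)

lemma Dom_cls: assumes "f \<in> Arr K" shows "Dom Q (cls f) = Dom K f" "Cod Q (cls f) = Cod K f"
proof -
  have *: "h ` cls f = {h f}" if "\<And>g. g \<in> cls f \<Longrightarrow> h g = h f" for h :: "'m \<Rightarrow> 'o"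
    using image_constant[OF cls_self[OF assms], of "h f"] image_cong[OF refl that, of "cls f"] by simp
  have "Dom K ` cls f = {Dom K f}" "Cod K ` cls f = {Cod K f}"
    using cls_memD(1)[OF _ Arr_Hom[OF assms]] by (auto simp: Hom_def intro!: *)
  then show "Dom Q (cls f) = Dom K f" "Cod Q (cls f) = Cod K f" by (simp_all add: quot_cat_def)
qed

lemma Hom_Q: "Hom Q A B = cls ` Hom K A B"
  by (auto simp: Hom_def Arr_Q Dom_cls)

lemma Cmp_cls:
  assumes f: "f \<in> Hom K A B" and g: "g \<in> Hom K B D"
  shows "cls g \<cdot>\<^bsub>Q\<^esub> cls f = cls (g \<cdot> f)"
proof -
  have "quot_rel K \<W> `` {g' \<cdot> f' |g' f'. g' \<in> cls g \<and> f' \<in> cls f} = cls (g \<cdot> f)"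
  proof (rule cls_image)
    show "g \<cdot> f \<in> {g' \<cdot> f' |g' f'. g' \<in> cls g \<and> f' \<in> cls f}"
      using cls_self f g by (auto simp: Hom_iff)
    fix y assume "y \<in> {g' \<cdot> f' |g' f'. g' \<in> cls g \<and> f' \<in> cls f}"
    then obtain g' f' where y: "y = g' \<cdot> f'" "g' \<in> cls g" "f' \<in> cls f" by auto
    note g' = cls_memD[OF y(2) g] and f' = cls_memD[OF y(3) f]
    have "null (((g \<boxplus> Neg K g') \<cdot> f) \<boxplus> (g' \<cdot> (f \<boxplus> Neg K f')))"
    proof (rule null_Sum)
      show "null ((g \<boxplus> Neg K g') \<cdot> f)"
        by (rule null_comp_right[OF g'(2), of B D]) (use f g g'(1) in \<open>auto simp: arith_simps\<close>)
      show "null (g' \<cdot> (f \<boxplus> Neg K f'))"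
        by (rule null_comp_left[OF f'(2), of A B]) (use f g'(1) f'(1) in \<open>auto simp: arith_simps\<close>)
    qed (use f g g'(1) f'(1) in \<open>auto simp: arith_simps\<close>)
    also have "((g \<boxplus> Neg K g') \<cdot> f) \<boxplus> (g' \<cdot> (f \<boxplus> Neg K f')) = (g \<cdot> f) \<boxplus> Neg K (g' \<cdot> f')"
      using f g g'(1) f'(1) by (simp add: arith_simps)
    finally show "(g \<cdot> f, y) \<in> quot_rel K \<W>"
      unfolding quot_rel_iff y using f g f'(1) g'(1) by (auto simp: arith_simps)
  qed
  then show ?thesis by (simp add: quot_cat_def)
qed

lemma Sum_cls:
  assumes f: "f \<in> Hom K A B" and g: "g \<in> Hom K A B"
  shows "cls f \<boxplus>\<^bsub>Q\<^esub> cls g = cls (f \<boxplus> g)"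
proof -
  have "quot_rel K \<W> `` {f' \<boxplus> g' |f' g'. f' \<in> cls f \<and> g' \<in> cls g} = cls (f \<boxplus> g)"
  proof (rule cls_image)
    show "f \<boxplus> g \<in> {f' \<boxplus> g' |f' g'. f' \<in> cls f \<and> g' \<in> cls g}"
      using cls_self f g by (auto simp: Hom_iff)
    fix y assume "y \<in> {f' \<boxplus> g' |f' g'. f' \<in> cls f \<and> g' \<in> cls g}"
    then obtain g' f' where y: "y = f' \<boxplus> g'" "g' \<in> cls g" "f' \<in> cls f" by auto
    note g' = cls_memD[OF y(2) g] and f' = cls_memD[OF y(3) f]
    have "null ((f \<boxplus> Neg K f') \<boxplus> (g \<boxplus> Neg K g'))"
      by (rule null_Sum[OF f'(2) g'(2)]) (use f g g'(1) f'(1) in \<open>auto simp: arith_simps\<close>)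
    also have "(f \<boxplus> Neg K f') \<boxplus> (g \<boxplus> Neg K g') = (f \<boxplus> g) \<boxplus> Neg K (f' \<boxplus> g')"
      using f g g'(1) f'(1) by (simp add: arith_simps)
    finally show "(f \<boxplus> g, y) \<in> quot_rel K \<W>"
      unfolding quot_rel_iff y using f g f'(1) g'(1) by (auto simp: arith_simps)
  qed
  then show ?thesis by (simp add: quot_cat_def)
qed

lemma cls_simps:
  "\<lbrakk>f \<in> Arr K; g \<in> Arr K; Cod K f = Dom K g\<rbrakk> \<Longrightarrow> cls g \<cdot>\<^bsub>Q\<^esub> cls f = cls (g \<cdot> f)"
  "\<lbrakk>f \<in> Arr K; g \<in> Arr K; Dom K f = Dom K g; Cod K f = Cod K g\<rbrakk> \<Longrightarrow> cls f \<boxplus>\<^bsub>Q\<^esub> cls g = cls (f \<boxplus> g)"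
  using Cmp_cls[of f "Dom K f" "Dom K g" g "Cod K g"] Sum_cls[of f "Dom K g" "Cod K g" g]
  by (simp_all add: Hom_def)

lemma category_Q: "category Q"
proof
  show "Dom Q F \<in> Obj Q" "Cod Q F \<in> Obj Q" if "F \<in> Arr Q" for F
    using that by (auto simp: Arr_Q Dom_cls Dom_closed Cod_closed)
qed (auto simp: Hom_Q cls_simps cat_simps)

lemma preadditive_Q: "preadditive_category Q"
proof (rule preadditive_category.intro[OF category_Q], rule preadditive_category_axioms.intro)
  fix A B assume AB: "A \<in> Obj Q" "B \<in> Obj Q"
  show "comm_group (hom_group Q A B)"
  proof (rule comm_groupI, unfold hom_group_def monoid.simps partial_object.simps)
    show "\<exists>y \<in> Hom Q A B. y \<boxplus>\<^bsub>Q\<^esub> x = Zer Q A B" if x: "x \<in> Hom Q A B" for x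
    proof -
      obtain f where f: "f \<in> Hom K A B" "x = cls f" using x unfolding Hom_Q by blast
      then show ?thesis
        by (intro bexI[of _ "cls (Neg K f)"]) (auto simp: Hom_Q cls_simps arith_simps)
    qed
  qed (use AB in \<open>auto simp: Hom_Q cls_simps arith_simps\<close>)
qed (auto simp: Hom_Q cls_simps arith_simps)

lemma biprod_Q:
  assumes b: "is_biprod K A B P i j p q"
  shows "is_biprod Q A B P (cls i) (cls j) (cls p) (cls q)"
proof -
  note bD = is_biprodD[OF b]
  have "cls i \<in> Hom Q A P" "cls j \<in> Hom Q B P" "cls p \<in> Hom Q P A" "cls q \<in> Hom Q P B"
    unfolding Hom_Q by (rule imageI, rule bD)+
  moreover have "cls p \<cdot>\<^bsub>Q\<^esub> cls i = Ide Q A" "cls q \<cdot>\<^bsub>Q\<^esub> cls j = Ide Q B"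
    "cls q \<cdot>\<^bsub>Q\<^esub> cls i = Zer Q A B" "cls p \<cdot>\<^bsub>Q\<^esub> cls j = Zer Q B A"
    using Cmp_cls[OF bD(1) bD(3)] Cmp_cls[OF bD(2) bD(4)] Cmp_cls[OF bD(1) bD(4)] Cmp_cls[OF bD(2) bD(3)]
    by (simp_all only: bD Q_simps)
  moreover have "(cls i \<cdot>\<^bsub>Q\<^esub> cls p) \<boxplus>\<^bsub>Q\<^esub> (cls j \<cdot>\<^bsub>Q\<^esub> cls q) = Ide Q P"
    using Sum_cls[of "i \<cdot> p" P P "j \<cdot> q"] Cmp_closed[OF bD(3) bD(1)] Cmp_closed[OF bD(4) bD(2)]
      Cmp_cls[OF bD(3) bD(1)] Cmp_cls[OF bD(4) bD(2)] by (simp only: bD Q_simps)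
  moreover have "A \<in> Obj Q" "B \<in> Obj Q" "P \<in> Obj Q" using bD(1,2) by (simp_all add: Hom_iff)
  ultimately show ?thesis unfolding is_biprod_def by blast
qed

lemma additive_Q: "additive_category Q"
proof (rule additive_category.intro[OF preadditive_Q], rule additive_category_axioms.intro)
  obtain Z where Z: "is_zero_obj K Z" using ex_zero_obj by auto
  have one: "\<exists>!F. F \<in> cls ` X" if "\<exists>!f. f \<in> X" for X using that by auto
  have "is_zero_obj Q Z" using Z unfolding is_zero_obj_def Hom_Q Q_simps by (intro conjI ballI one) auto
  then show "\<exists>Z. is_zero_obj Q Z" by blast
  show "\<exists>P. is_direct_sum Q A B P" if "A \<in> Obj Q" "B \<in> Obj Q" for A B
    using ex_direct_sum[of A B] that biprod_Q unfolding is_direct_sum_def by (metis Q_simps(1))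
qed

end

lemma quot_rel_op: "quot_rel (op_cat K) \<W> = quot_rel K \<W>"
proof -
  have "factors_through (op_cat K) \<W> h = factors_through K \<W> h" for h
    by (auto simp: factors_through_def)
  then show ?thesis by (simp add: quot_rel_def)
qed

lemma quot_cat_op: "quot_cat (op_cat K) \<W> = op_cat (quot_cat K \<W>)"
proof -
  have "{g \<cdot>\<^bsub>op_cat K\<^esub> f |g f. g \<in> G \<and> f \<in> F} = {g \<cdot>\<^bsub>K\<^esub> f |g f. g \<in> F \<and> f \<in> G}" for F G by auto
  then show ?thesis by (simp add: quot_cat_def op_cat_def quot_rel_op[unfolded op_cat_def])
qed

section \<open>Full subcategories\<close>

lemma full_subcat_simps [simp]:
  "Obj (full_subcat C \<H>) = Obj C \<inter> \<H>" "Arr (full_subcat C \<H>) = {f \<in> Arr C. Dom C f \<in> \<H> \<and> Cod C f \<in> \<H>}"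
  "Dom (full_subcat C \<H>) = Dom C" "Cod (full_subcat C \<H>) = Cod C" "Ide (full_subcat C \<H>) = Ide C"
  "Cmp (full_subcat C \<H>) = Cmp C" "Zer (full_subcat C \<H>) = Zer C" "Sum (full_subcat C \<H>) = Sum C"
  by (simp_all add: full_subcat_def)

lemma Hom_full_subcat [simp]:
  "Hom (full_subcat C \<H>) A B = (if A \<in> \<H> \<and> B \<in> \<H> then Hom C A B else {})"
  by (auto simp: Hom_def)

lemma full_subcat_op: "full_subcat (op_cat C) \<H> = op_cat (full_subcat C \<H>)"
  by (auto simp: full_subcat_def op_cat_def)

lemma is_biprod_full_subcat:
  "is_biprod (full_subcat C \<H>) A B P i j p q \<longleftrightarrow> A \<in> \<H> \<and> B \<in> \<H> \<and> P \<in> \<H> \<and> is_biprod C A B P i j p q"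
  by (auto simp: is_biprod_def)

lemma is_direct_sum_full_subcat:
  "is_direct_sum (full_subcat C \<H>) A B P \<longleftrightarrow> A \<in> \<H> \<and> B \<in> \<H> \<and> P \<in> \<H> \<and> is_direct_sum C A B P"
  unfolding is_direct_sum_def is_biprod_full_subcat by blast

lemma (in additive_category) additive_full_subcat:
  assumes "Z \<in> \<H>" "is_zero_obj C Z"
    and sum: "\<And>A B. A \<in> \<H> \<Longrightarrow> B \<in> \<H> \<Longrightarrow> A \<in> Obj C \<Longrightarrow> B \<in> Obj C \<Longrightarrow> \<exists>P \<in> \<H>. is_direct_sum C A B P"
  shows "additive_category (full_subcat C \<H>)"
proof -
  have cat: "category (full_subcat C \<H>)"
    by unfold_locales (auto simp: cat_simps split: if_splits)
  have pre: "preadditive_category (full_subcat C \<H>)"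
  proof (rule preadditive_category.intro[OF cat], rule preadditive_category_axioms.intro)
    fix A B assume "A \<in> Obj (full_subcat C \<H>)" "B \<in> Obj (full_subcat C \<H>)"
    then have "hom_group (full_subcat C \<H>) A B = hom_group C A B" "A \<in> Obj C" "B \<in> Obj C"
      by (auto simp: hom_group_def)
    then show "comm_group (hom_group (full_subcat C \<H>) A B)" by (simp add: hom_comm_group)
  qed (auto simp: Cmp_Sum_right Cmp_Sum_left split: if_splits)
  have "is_zero_obj (full_subcat C \<H>) Z" using assms(1,2) by (auto simp: is_zero_obj_def)
  moreover have "\<exists>P. is_direct_sum (full_subcat C \<H>) A B P"
    if "A \<in> Obj (full_subcat C \<H>)" "B \<in> Obj (full_subcat C \<H>)" for A B
    using sum[of A B] that unfolding is_direct_sum_def is_biprod_full_subcat by simp blast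
  ultimately show ?thesis
    by (intro additive_category.intro[OF pre] additive_category_axioms.intro) blast+
qed

lemma (in additive_category) additive_subcat_zero:
  assumes "is_additive_subcat C \<U>" obtains Z where "Z \<in> \<U>" "is_zero_obj C Z"
proof -
  interpret K: additive_category "full_subcat C \<U>" using assms by (simp add: is_additive_subcat_def)
  obtain Z where Z: "is_zero_obj (full_subcat C \<U>) Z" using K.ex_zero_obj by blast
  then have ZO: "Z \<in> \<U>" "Z \<in> Obj C" by (auto simp: is_zero_obj_def)
  have "\<exists>!f. f \<in> Hom C Z Z" using Z ZO unfolding is_zero_obj_def by fastforce
  moreover have "Ide C Z \<in> Hom C Z Z" "Zer C Z Z \<in> Hom C Z Z" using ZO by (simp_all add: arith_simps)
  ultimately have I: "Ide C Z = Zer C Z Z" by blast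
  have to: "f = Zer C A Z" if "f \<in> Hom C A Z" for f A
  proof -
    have "f = Ide C Z \<cdot> f" using that by (simp add: cat_simps)
    also have "\<dots> = Zer C A Z" unfolding I using that by (simp add: arith_simps)
    finally show ?thesis .
  qed
  have out: "f = Zer C Z A" if "f \<in> Hom C Z A" for f A
  proof -
    have "f = f \<cdot> Ide C Z" using that by (simp add: cat_simps)
    also have "\<dots> = Zer C Z A" unfolding I using that by (simp add: arith_simps)
    finally show ?thesis .
  qed
  have "is_zero_obj C Z" unfolding is_zero_obj_def
  proof (intro conjI ballI ZO)
    fix A assume "A \<in> Obj C"
    then have "Zer C A Z \<in> Hom C A Z" "Zer C Z A \<in> Hom C Z A" using ZO by (simp_all add: arith_simps)
    then show "\<exists>!f. f \<in> Hom C A Z" "\<exists>!f. f \<in> Hom C Z A" using to out by blast+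
  qed
  then show thesis using that ZO by blast
qed

lemma additive_subcat_sum:
  assumes "is_additive_subcat C \<U>" "A \<in> \<U>" "B \<in> \<U>" shows "\<exists>P \<in> \<U>. is_direct_sum C A B P"
proof -
  interpret K: additive_category "full_subcat C \<U>" using assms by (simp add: is_additive_subcat_def)
  have "A \<in> Obj (full_subcat C \<U>)" "B \<in> Obj (full_subcat C \<U>)"
    using assms by (auto simp: is_additive_subcat_def)
  then show ?thesis using K.ex_direct_sum unfolding is_direct_sum_full_subcat by blast
qed

section \<open>Limits in a quotient of a full subcategory\<close>

locale subquotient = additive_category C for C :: "('o, 'm) acat" (structure) +
  fixes \<H> \<W> :: "'o set"
  assumes \<H>_Obj: "\<H> \<subseteq> Obj C"
    and \<W>_\<H>: "\<W> \<subseteq> \<H>"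
    and \<H>_zero: "\<exists>Z \<in> \<H>. is_zero_obj C Z"
    and \<H>_sum: "\<lbrakk>A \<in> \<H>; B \<in> \<H>\<rbrakk> \<Longrightarrow> \<exists>P \<in> \<H>. is_direct_sum C A B P"
    and \<W>_nonempty: "\<W> \<noteq> {}"
    and \<W>_sum: "\<lbrakk>A \<in> \<W>; B \<in> \<W>\<rbrakk> \<Longrightarrow> \<exists>P \<in> \<W>. is_direct_sum C A B P"
begin

abbreviation (input) K where "K \<equiv> full_subcat C \<H>"

lemma additive_quotient_C: "additive_quotient C \<W>"
  by unfold_locales (use \<H>_Obj \<W>_\<H> \<W>_nonempty \<W>_sum in auto)

sublocale ambient: additive_quotient C \<W> by (rule additive_quotient_C)

lemma additive_quotient_K: "additive_quotient K \<W>"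
proof -
  have "additive_category K" using \<H>_zero \<H>_sum by (auto intro: additive_full_subcat)
  moreover have "\<exists>P \<in> \<W>. is_direct_sum K A B P" if AB: "A \<in> \<W>" "B \<in> \<W>" for A B
  proof -
    obtain P where "P \<in> \<W>" "is_direct_sum C A B P" using \<W>_sum[OF AB] by blast
    then show ?thesis using AB \<W>_\<H> unfolding is_direct_sum_full_subcat by blast
  qed
  moreover have "\<W> \<subseteq> Obj K" using \<H>_Obj \<W>_\<H> by auto
  ultimately show ?thesis
    using \<W>_nonempty by (intro additive_quotient.intro additive_quotient_axioms.intro)
qed

sublocale sub: additive_quotient K \<W> by (rule additive_quotient_K)

abbreviation Q :: "('o, 'm set) acat" where "Q \<equiv> quot_cat K \<W>"
abbreviation cl :: "'m \<Rightarrow> 'm set" where "cl \<equiv> arr_class K \<W>"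
abbreviation null :: "'m \<Rightarrow> bool" where "null \<equiv> factors_through C \<W>"

lemma null_K:
  assumes "f \<in> Hom C A B" "A \<in> \<H>" "B \<in> \<H>" shows "factors_through K \<W> f = null f"
  using assms \<W>_\<H> unfolding factors_through_def by (auto simp: Hom_iff subset_iff)

lemma Neg_K:
  assumes "f \<in> Hom C A B" "A \<in> \<H>" "B \<in> \<H>" shows "Neg K f = Neg C f"
  using assms by (simp add: Neg_def hom_group_def Hom_iff)

lemma cl_eq_iff:
  assumes "f \<in> Hom C A B" "g \<in> Hom C A B" "A \<in> \<H>" "B \<in> \<H>"
  shows "cl f = cl g \<longleftrightarrow> null (f \<boxplus> Neg C g)"
  using sub.cls_eq_iff[of f A B g] assms null_K[of "f \<boxplus> Neg C g" A B] Neg_K[of g A B]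
  by (simp add: arith_simps)

lemma cl_eq_Zer_iff:
  assumes "f \<in> Hom C A B" "A \<in> \<H>" "B \<in> \<H>"
  shows "cl f = Zer Q A B \<longleftrightarrow> null f"
  using cl_eq_iff[of f A B "Zer C A B"] assms by (simp add: arith_simps)

lemma cl_Cmp:
  assumes "f \<in> Hom C A B" "g \<in> Hom C B D" "A \<in> \<H>" "B \<in> \<H>" "D \<in> \<H>"
  shows "cl g \<cdot>\<^bsub>Q\<^esub> cl f = cl (g \<cdot> f)"
  using sub.Cmp_cls[of f A B g D] assms by simp

lemma cl_Dom:
  assumes "f \<in> Hom C A B" "A \<in> \<H>" "B \<in> \<H>"
  shows "cl f \<in> Arr Q" "Dom Q (cl f) = A" "Cod Q (cl f) = B"
  using sub.Dom_cls[of f] assms by (auto simp: sub.Arr_Q Hom_iff)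

lemma Hom_QE:
  assumes "F \<in> Hom Q A B"
  obtains f where "f \<in> Hom C A B" "A \<in> \<H>" "B \<in> \<H>" "F = cl f"
  using assms unfolding sub.Hom_Q by (auto split: if_splits)

lemma Arr_QE:
  assumes "F \<in> Arr Q"
  obtains f A B where "f \<in> Hom C A B" "A \<in> \<H>" "B \<in> \<H>" "F = cl f" "Dom Q F = A" "Cod Q F = B"
proof -
  have "F \<in> Hom Q (Dom Q F) (Cod Q F)" using assms by (simp add: Hom_def)
  then show thesis using that by (elim Hom_QE) auto
qed

lemma Q_monoD:
  assumes m: "is_mono Q (cl f)" and f: "f \<in> Hom C A B" "A \<in> \<H>" "B \<in> \<H>"
    and h: "h \<in> Hom C Z A" "Z \<in> \<H>" "null (f \<cdot> h)"
  shows "null h"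
proof -
  interpret Q: preadditive_category Q by (rule sub.preadditive_Q)
  have "cl h = Zer Q (Dom Q (cl h)) (Cod Q (cl h))"
  proof (rule Q.mono_zero[OF m])
    have "f \<cdot> h \<in> Hom C Z B" using f h by (simp add: cat_simps)
    then show "cl f \<cdot>\<^bsub>Q\<^esub> cl h = Zer Q (Dom Q (cl h)) (Cod Q (cl f))"
      using cl_eq_Zer_iff[of "f \<cdot> h" Z B] f h by (simp add: cl_Cmp[of h Z A f B] cl_Dom[of h Z A] cl_Dom[of f A B])
  qed (use f h in \<open>simp_all add: cl_Dom[of h Z A] cl_Dom[of f A B]\<close>)
  then show ?thesis using cl_eq_Zer_iff[of h Z A] f h by (simp add: cl_Dom[of h Z A])
qed

lemma Q_monoI:
  assumes f: "f \<in> Hom C A B" "A \<in> \<H>" "B \<in> \<H>"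
    and "\<And>h Z. h \<in> Hom C Z A \<Longrightarrow> Z \<in> \<H> \<Longrightarrow> null (f \<cdot> h) \<Longrightarrow> null h"
  shows "is_mono Q (cl f)"
proof -
  interpret Q: preadditive_category Q by (rule sub.preadditive_Q)
  show ?thesis
  proof (rule Q.monoI)
    fix H assume H: "H \<in> Arr Q" "Cod Q H = Dom Q (cl f)" "cl f \<cdot>\<^bsub>Q\<^esub> H = Zer Q (Dom Q H) (Cod Q (cl f))"
    obtain h Z where h: "h \<in> Hom C Z A" "Z \<in> \<H>" "H = cl h"
      using Arr_QE[OF H(1)] H(2) f by (metis cl_Dom(2))
    have "f \<cdot> h \<in> Hom C Z B" using f h by (simp add: cat_simps)
    then have "null (f \<cdot> h)" using H(3) f h cl_eq_Zer_iff[of "f \<cdot> h" Z B]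
      by (simp add: cl_Cmp[of h Z A f B] cl_Dom[of h Z A] cl_Dom[of f A B])
    then have "null h" using assms(4) h by blast
    then show "H = Zer Q (Dom Q H) (Cod Q H)"
      using cl_eq_Zer_iff[OF h(1,2) f(2)] unfolding h(3) cl_Dom[OF h(1,2) f(2)] by simp
  qed (use f in \<open>simp add: cl_Dom[of f A B]\<close>)
qed

lemma Q_kernelI:
  assumes k: "k \<in> Hom C X A" "X \<in> \<H>" and f: "f \<in> Hom C A B" "A \<in> \<H>" "B \<in> \<H>" and fk: "null (f \<cdot> k)"
    and ex: "\<And>x Z. x \<in> Hom C Z A \<Longrightarrow> Z \<in> \<H> \<Longrightarrow> null (f \<cdot> x) \<Longrightarrow> \<exists>u \<in> Hom C Z X. null ((k \<cdot> u) \<boxplus> Neg C x)"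
    and uniq: "\<And>h Z. h \<in> Hom C Z X \<Longrightarrow> Z \<in> \<H> \<Longrightarrow> null (k \<cdot> h) \<Longrightarrow> null h"
  shows "is_kernel_of Q (cl k) (cl f)"
proof -
  interpret Q: preadditive_category Q by (rule sub.preadditive_Q)
  note D = cl_Dom[OF k(1,2) f(2)] cl_Dom[OF f]
  show ?thesis
  proof (rule Q.kernelI)
    have "f \<cdot> k \<in> Hom C X B" using f k by (simp add: cat_simps)
    then show "cl f \<cdot>\<^bsub>Q\<^esub> cl k = Zer Q (Dom Q (cl k)) (Cod Q (cl f))"
      using cl_eq_Zer_iff[of "f \<cdot> k" X B] f k fk by (simp add: cl_Cmp[of k X A f B] D)
  next
    fix H assume H: "H \<in> Arr Q" "Cod Q H = Dom Q (cl f)" "cl f \<cdot>\<^bsub>Q\<^esub> H = Zer Q (Dom Q H) (Cod Q (cl f))"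
    obtain h Z where h: "h \<in> Hom C Z A" "Z \<in> \<H>" "H = cl h"
      using Arr_QE[OF H(1)] H(2) D(5) by metis
    have "f \<cdot> h \<in> Hom C Z B" using f h by (simp add: cat_simps)
    then have "null (f \<cdot> h)" using H(3) f h cl_eq_Zer_iff[of "f \<cdot> h" Z B]
      by (simp add: cl_Cmp[of h Z A f B] cl_Dom[of h Z A] D)
    then obtain u where u: "u \<in> Hom C Z X" "null ((k \<cdot> u) \<boxplus> Neg C h)" using ex h by blast
    have "k \<cdot> u \<in> Hom C Z A" using k u by (simp add: cat_simps)
    then have "cl k \<cdot>\<^bsub>Q\<^esub> cl u = H" using cl_eq_iff[of "k \<cdot> u" Z A h] u h k f by (simp add: cl_Cmp[of u Z X k A])
    then show "\<exists>U \<in> Arr Q. Dom Q U = Dom Q H \<and> Cod Q U = Dom Q (cl k) \<and> cl k \<cdot>\<^bsub>Q\<^esub> U = H"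
      using u h k f cl_Dom[of u Z X] cl_Dom[of h Z A] D by (intro bexI[of _ "cl u"]) auto
  qed (use D k f uniq in \<open>auto intro!: Q_monoI\<close>)
qed

lemma Q_pullbackI:
  assumes \<alpha>: "\<alpha> \<in> Hom C P A" and \<beta>: "\<beta> \<in> Hom C P B" and \<gamma>: "\<gamma> \<in> Hom C A D" and \<delta>: "\<delta> \<in> Hom C B D"
    and \<O>: "P \<in> \<H>" "A \<in> \<H>" "B \<in> \<H>" "D \<in> \<H>" and sq: "null ((\<gamma> \<cdot> \<alpha>) \<boxplus> Neg C (\<delta> \<cdot> \<beta>))"
    and ex: "\<And>x y Z. x \<in> Hom C Z A \<Longrightarrow> y \<in> Hom C Z B \<Longrightarrow> Z \<in> \<H> \<Longrightarrow> null ((\<gamma> \<cdot> x) \<boxplus> Neg C (\<delta> \<cdot> y)) \<Longrightarrow>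
      \<exists>u \<in> Hom C Z P. null ((\<alpha> \<cdot> u) \<boxplus> Neg C x) \<and> null ((\<beta> \<cdot> u) \<boxplus> Neg C y)"
    and uniq: "\<And>h Z. h \<in> Hom C Z P \<Longrightarrow> Z \<in> \<H> \<Longrightarrow> null (\<alpha> \<cdot> h) \<Longrightarrow> null (\<beta> \<cdot> h) \<Longrightarrow> null h"
  shows "is_pullback Q (cl \<alpha>) (cl \<beta>) (cl \<gamma>) (cl \<delta>)"
proof -
  interpret Q: preadditive_category Q by (rule sub.preadditive_Q)
  note D = cl_Dom[OF \<alpha> \<O>(1,2)] cl_Dom[OF \<beta> \<O>(1,3)] cl_Dom[OF \<gamma> \<O>(2,4)] cl_Dom[OF \<delta> \<O>(3,4)]
  show ?thesis
  proof (rule Q.pullbackI)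
    have "\<gamma> \<cdot> \<alpha> \<in> Hom C P D" "\<delta> \<cdot> \<beta> \<in> Hom C P D" using \<alpha> \<beta> \<gamma> \<delta> by (simp_all add: cat_simps)
    then show "is_comm_square Q (cl \<alpha>) (cl \<beta>) (cl \<gamma>) (cl \<delta>)"
      using cl_eq_iff[of "\<gamma> \<cdot> \<alpha>" P D "\<delta> \<cdot> \<beta>"] \<alpha> \<beta> \<gamma> \<delta> \<O> sq D
      by (simp add: is_comm_square_def cl_Cmp[of \<alpha> P A \<gamma> D] cl_Cmp[of \<beta> P B \<delta> D])
  next
    fix X Y assume XY: "X \<in> Arr Q" "Y \<in> Arr Q" "Dom Q X = Dom Q Y" "Cod Q X = Dom Q (cl \<gamma>)"
      "Cod Q Y = Dom Q (cl \<delta>)" "cl \<gamma> \<cdot>\<^bsub>Q\<^esub> X = cl \<delta> \<cdot>\<^bsub>Q\<^esub> Y"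
    obtain x Z where x: "x \<in> Hom C Z A" "Z \<in> \<H>" "X = cl x" "Dom Q X = Z"
      using Arr_QE[OF XY(1)] XY(4) D(8) by metis
    obtain y where y: "y \<in> Hom C Z B" "Y = cl y"
      using Arr_QE[OF XY(2)] XY(3,5) x(4) D(11) by metis
    have "\<gamma> \<cdot> x \<in> Hom C Z D" "\<delta> \<cdot> y \<in> Hom C Z D" using \<gamma> \<delta> x y by (simp_all add: cat_simps)
    then have "null ((\<gamma> \<cdot> x) \<boxplus> Neg C (\<delta> \<cdot> y))"
      using XY(6) x y \<gamma> \<delta> \<O> cl_eq_iff[of "\<gamma> \<cdot> x" Z D "\<delta> \<cdot> y"]
      by (simp add: cl_Cmp[of x Z A \<gamma> D] cl_Cmp[of y Z B \<delta> D])
    then obtain u where u: "u \<in> Hom C Z P" "null ((\<alpha> \<cdot> u) \<boxplus> Neg C x)" "null ((\<beta> \<cdot> u) \<boxplus> Neg C y)"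
      using ex[OF x(1) y(1) x(2)] by blast
    have "\<alpha> \<cdot> u \<in> Hom C Z A" "\<beta> \<cdot> u \<in> Hom C Z B" using \<alpha> \<beta> u by (simp_all add: cat_simps)
    then have "cl \<alpha> \<cdot>\<^bsub>Q\<^esub> cl u = X" "cl \<beta> \<cdot>\<^bsub>Q\<^esub> cl u = Y"
      using cl_eq_iff[of "\<alpha> \<cdot> u" Z A x] cl_eq_iff[of "\<beta> \<cdot> u" Z B y] u x y \<alpha> \<beta> \<O>
      by (simp_all add: cl_Cmp[of u Z P \<alpha> A] cl_Cmp[of u Z P \<beta> B])
    then show "\<exists>U \<in> Arr Q. Dom Q U = Dom Q Y \<and> Cod Q U = Dom Q (cl \<alpha>) \<and> cl \<alpha> \<cdot>\<^bsub>Q\<^esub> U = X \<and> cl \<beta> \<cdot>\<^bsub>Q\<^esub> U = Y"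
      using cl_Dom[of u Z P] u x(2,4) XY(3) \<O> D by (intro bexI[of _ "cl u"]) auto
  next
    fix H assume H: "H \<in> Arr Q" "Cod Q H = Dom Q (cl \<alpha>)" "cl \<alpha> \<cdot>\<^bsub>Q\<^esub> H = Zer Q (Dom Q H) (Cod Q (cl \<alpha>))"
      "cl \<beta> \<cdot>\<^bsub>Q\<^esub> H = Zer Q (Dom Q H) (Cod Q (cl \<beta>))"
    obtain h Z where h: "h \<in> Hom C Z P" "Z \<in> \<H>" "H = cl h" "Dom Q H = Z"
      using Arr_QE[OF H(1)] H(2) D(2) by metis
    have "\<alpha> \<cdot> h \<in> Hom C Z A" "\<beta> \<cdot> h \<in> Hom C Z B" using \<alpha> \<beta> h by (simp_all add: cat_simps)
    then have "null (\<alpha> \<cdot> h)" "null (\<beta> \<cdot> h)"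
      using H(3,4) h \<alpha> \<beta> \<O> D cl_eq_Zer_iff[of "\<alpha> \<cdot> h" Z A] cl_eq_Zer_iff[of "\<beta> \<cdot> h" Z B]
      by (simp_all add: cl_Cmp[of h Z P \<alpha> A] cl_Cmp[of h Z P \<beta> B])
    then have "null h" using uniq h by blast
    then show "H = Zer Q (Dom Q H) (Cod Q H)"
      using cl_eq_Zer_iff[OF h(1,2) \<O>(1)] unfolding h(3) cl_Dom[OF h(1,2) \<O>(1)] by simp
  qed
qed

lemma subquotient_op: "subquotient (op_cat C) \<H> \<W>"
  by (intro subquotient.intro subquotient_axioms.intro additive_category_op additive_category_axioms)
    (use \<H>_Obj \<W>_\<H> \<H>_zero \<H>_sum \<W>_nonempty \<W>_sum in auto)

lemma op_Q: "quot_cat (full_subcat (op_cat C) \<H>) \<W> = op_cat Q"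
  "arr_class (full_subcat (op_cat C) \<H>) \<W> = cl"
  by (auto simp: full_subcat_op quot_cat_op quot_rel_op arr_class_def)

lemma op_null: "factors_through (op_cat C) \<W> = null"
  by (rule ext) (auto simp: factors_through_def)

lemma Q_cokernelI:
  assumes "c \<in> Hom C B X" "X \<in> \<H>" "f \<in> Hom C A B" "A \<in> \<H>" "B \<in> \<H>" "null (c \<cdot> f)"
    and "\<And>x Z. x \<in> Hom C B Z \<Longrightarrow> Z \<in> \<H> \<Longrightarrow> null (x \<cdot> f) \<Longrightarrow> \<exists>u \<in> Hom C X Z. null ((u \<cdot> c) \<boxplus> Neg C x)"
    and "\<And>h Z. h \<in> Hom C X Z \<Longrightarrow> Z \<in> \<H> \<Longrightarrow> null (h \<cdot> c) \<Longrightarrow> null h"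
  shows "is_cokernel_of Q (cl c) (cl f)"
  using subquotient.Q_kernelI[OF subquotient_op, of c X B f A] assms by (simp add: op_Q op_null)

lemma Q_pushoutI:
  assumes "\<alpha> \<in> Hom C D A" "\<beta> \<in> Hom C D B" "\<gamma> \<in> Hom C A P" "\<delta> \<in> Hom C B P"
    "P \<in> \<H>" "A \<in> \<H>" "B \<in> \<H>" "D \<in> \<H>" "null ((\<gamma> \<cdot> \<alpha>) \<boxplus> Neg C (\<delta> \<cdot> \<beta>))"
    and ex: "\<And>x y Z. x \<in> Hom C A Z \<Longrightarrow> y \<in> Hom C B Z \<Longrightarrow> Z \<in> \<H> \<Longrightarrow> null ((x \<cdot> \<alpha>) \<boxplus> Neg C (y \<cdot> \<beta>)) \<Longrightarrow>
      \<exists>u \<in> Hom C P Z. null ((u \<cdot> \<gamma>) \<boxplus> Neg C x) \<and> null ((u \<cdot> \<delta>) \<boxplus> Neg C y)"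
    and "\<And>h Z. h \<in> Hom C P Z \<Longrightarrow> Z \<in> \<H> \<Longrightarrow> null (h \<cdot> \<gamma>) \<Longrightarrow> null (h \<cdot> \<delta>) \<Longrightarrow> null h"
  shows "is_pushout Q (cl \<alpha>) (cl \<beta>) (cl \<gamma>) (cl \<delta>)"
proof -
  have "is_pullback (op_cat Q) (cl \<gamma>) (cl \<delta>) (cl \<alpha>) (cl \<beta>)"
    using subquotient.Q_pullbackI[OF subquotient_op, of \<gamma> P A \<delta> B \<alpha> D \<beta>] assms by (simp add: op_Q op_null)
  then show ?thesis using is_pushout_sym by fastforce
qed

end

section \<open>Pullbacks and pushouts modulo null arrows\<close>

definition extends_to :: "('o, 'm) acat \<Rightarrow> 'o set \<Rightarrow> 'm \<Rightarrow> bool" where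
  "extends_to C \<Y> \<alpha> \<longleftrightarrow> (\<forall>Y \<in> \<Y>. \<forall>f \<in> Hom C (Dom C \<alpha>) Y. \<exists>g \<in> Hom C (Cod C \<alpha>) Y. g \<cdot>\<^bsub>C\<^esub> \<alpha> = f)"

definition lifts_from :: "('o, 'm) acat \<Rightarrow> 'o set \<Rightarrow> 'm \<Rightarrow> bool" where
  "lifts_from C \<X> \<gamma> \<longleftrightarrow> (\<forall>X \<in> \<X>. \<forall>f \<in> Hom C X (Cod C \<gamma>). \<exists>g \<in> Hom C X (Dom C \<gamma>). \<gamma> \<cdot>\<^bsub>C\<^esub> g = f)"

lemma extends_toE:
  assumes "extends_to C \<Y> \<alpha>" "Y \<in> \<Y>" "\<alpha> \<in> Hom C A B" "f \<in> Hom C A Y"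
  obtains g where "g \<in> Hom C B Y" "g \<cdot>\<^bsub>C\<^esub> \<alpha> = f"
proof -
  have "Dom C \<alpha> = A" "Cod C \<alpha> = B" using assms(3) by (simp_all add: Hom_def)
  then show thesis using assms that unfolding extends_to_def by blast
qed

lemma lifts_fromE:
  assumes "lifts_from C \<X> \<gamma>" "X \<in> \<X>" "\<gamma> \<in> Hom C A B" "f \<in> Hom C X B"
  obtains g where "g \<in> Hom C X A" "\<gamma> \<cdot>\<^bsub>C\<^esub> g = f"
proof -
  have "Dom C \<gamma> = A" "Cod C \<gamma> = B" using assms(3) by (simp_all add: Hom_def)
  then show thesis using assms that unfolding lifts_from_def by blast
qed

lemma extends_to_op [simp]: "extends_to (op_cat C) \<Y> \<alpha> = lifts_from C \<Y> \<alpha>"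
  and lifts_from_op [simp]: "lifts_from (op_cat C) \<X> \<gamma> = extends_to C \<X> \<gamma>"
  by (simp_all add: extends_to_def lifts_from_def)

lemma B_minus_op [simp]: "B_minus (op_cat C) (E\<inverse>) \<W> \<V> = B_plus C E \<W> \<V>"
  and B_plus_op [simp]: "B_plus (op_cat C) (E\<inverse>) \<W> \<S> = B_minus C E \<W> \<S>"
  unfolding B_plus_def B_minus_def ses_def seq_def by auto

lemma B_minusE:
  assumes "Z \<in> B_minus C E \<W> \<S>"
  obtains i p U where "(i, p) \<in> E" "i \<in> Hom C Z U" "p \<in> Hom C U (Cod C p)" "U \<in> \<W>" "Cod C p \<in> \<S>"
  using assms by (auto simp: B_minus_def ses_def seq_def Hom_def)

lemma B_minusI:
  assumes "(i, p) \<in> E" "i \<in> Arr C" "p \<in> Arr C" "Cod C i = Dom C p" "Dom C i \<in> Obj C"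
    "Dom C p \<in> \<W>" "Cod C p \<in> \<S>"
  shows "Dom C i \<in> B_minus C E \<W> \<S>"
  using assms unfolding B_minus_def ses_def seq_def by (auto simp: Hom_def)

lemma B_plusE:
  assumes "Z \<in> B_plus C E \<W> \<V>"
  obtains j p U where "(j, p) \<in> E" "p \<in> Hom C U Z" "j \<in> Hom C (Dom C j) U" "U \<in> \<W>" "Dom C j \<in> \<V>"
proof -
  obtain V W j p where "V \<in> \<V>" "W \<in> \<W>" "(j, p) \<in> E" "j \<in> Hom C V W" "p \<in> Hom C W Z"
    using assms by (auto simp: B_plus_def ses_def seq_def)
  then show thesis using that[of j p W] by (simp add: Hom_def)
qed

text \<open>The properties of a twin cotorsion pair that survive in the quotient. Passing to the opposite
  category exchanges \<open>\<S>\<close> with \<open>\<V>\<close> and \<open>ext\<close> with \<open>lift\<close>, so every lemma of this locale has a dual.\<close>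

locale heart_core = exact_structure C E + subquotient C \<H> \<W>
  for C :: "('o, 'm) acat" (structure) and E \<H> \<W> +
  fixes \<S> \<V> :: "'o set"
  assumes \<H>_minus: "\<H> \<subseteq> B_minus C E \<W> \<S>"
    and \<H>_plus: "\<H> \<subseteq> B_plus C E \<W> \<V>"
    and ext: "\<lbrakk>(i, p) \<in> E; Cod C p \<in> \<S>\<rbrakk> \<Longrightarrow> extends_to C (\<W> \<union> \<V>) i"
    and lift: "\<lbrakk>(j, p) \<in> E; Dom C j \<in> \<V>\<rbrakk> \<Longrightarrow> lifts_from C (\<W> \<union> \<S>) p"
begin

lemma heart_core_op: "heart_core (op_cat C) (E\<inverse>) \<H> \<W> \<V> \<S>"
  by (intro heart_core.intro heart_core_axioms.intro exact_structure_op subquotient_op)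
    (use \<H>_minus \<H>_plus ext lift in auto)

text \<open>Every null arrow from \<open>Z\<close> factors through the same arrow \<open>Z \<rightarrow> U\<close>, since the objects of \<open>\<W>\<close> are
  injective with respect to it.\<close>

lemma null_extends:
  assumes "null h" "h \<in> Hom C Z B" "(i, p) \<in> E" "i \<in> Hom C Z U" "Cod C p \<in> \<S>"
  obtains y where "y \<in> Hom C U B" "y \<cdot> i = h"
proof -
  obtain W u v where h: "W \<in> \<W>" "u \<in> Hom C Z W" "v \<in> Hom C W B" "h = v \<cdot> u"
    by (rule ambient.nullE[OF assms(1,2)])
  obtain g where g: "g \<in> Hom C U W" "g \<cdot> i = u"
    by (rule extends_toE[OF ext[OF assms(3,5)] _ assms(4) h(2)]) (use h in auto)
  show thesis by (rule that[of "v \<cdot> g"]) (use g h assms(4) in \<open>auto simp: cat_simps\<close>)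
qed

lemma null_from: "f \<in> Hom C A B \<Longrightarrow> A \<in> \<W> \<Longrightarrow> null f"
  using ambient.nullI[of "Ide C A" A A f B] by (auto simp: cat_simps)

lemma null_to: "f \<in> Hom C A B \<Longrightarrow> B \<in> \<W> \<Longrightarrow> null f"
  using ambient.nullI[of f A B "Ide C B" B] by (auto simp: cat_simps)

text \<open>Both composites extend along \<open>Z \<rightarrowtail> U\<close>. The two extensions agree over \<open>D\<close> up to an arrow that
  factors through the cokernel of \<open>Z \<rightarrowtail> U\<close>; lifting this arrow through \<open>\<gamma>\<close> corrects them, and they
  define an extension of \<open>h\<close> to \<open>U\<close>.\<close>

lemma null_pullback_cancel:
  assumes sq: "is_pullback C \<alpha> \<beta> \<gamma> \<delta>" and \<gamma>: "lifts_from C \<S> \<gamma>" and Z: "Z \<in> B_minus C E \<W> \<S>"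
    and h: "h \<in> Hom C Z (Dom C \<alpha>)" "null (\<alpha> \<cdot> h)" "null (\<beta> \<cdot> h)"
  shows "null h"
proof -
  note sD = is_pullbackD[OF sq]
  obtain i p U where i: "(i, p) \<in> E" "i \<in> Hom C Z U" "p \<in> Hom C U (Cod C p)" "U \<in> \<W>" "Cod C p \<in> \<S>"
    by (rule B_minusE[OF Z])
  have \<alpha>h: "\<alpha> \<cdot> h \<in> Hom C Z (Dom C \<gamma>)" and \<beta>h: "\<beta> \<cdot> h \<in> Hom C Z (Dom C \<delta>)"
    using h sD(1-8) by (simp_all add: cat_simps)
  obtain y where y: "y \<in> Hom C U (Dom C \<gamma>)" "y \<cdot> i = \<alpha> \<cdot> h"
    by (rule null_extends[OF h(2) \<alpha>h i(1,2,5)])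
  obtain z where z: "z \<in> Hom C U (Dom C \<delta>)" "z \<cdot> i = \<beta> \<cdot> h"
    by (rule null_extends[OF h(3) \<beta>h i(1,2,5)])
  let ?d = "(\<gamma> \<cdot> y) \<boxplus> Neg C (\<delta> \<cdot> z)"
  have d: "?d \<in> Hom C U (Cod C \<gamma>)" using y(1) z(1) sD(1-8) by (simp add: arith_simps)
  have "?d \<cdot> i = (\<gamma> \<cdot> (y \<cdot> i)) \<boxplus> Neg C (\<delta> \<cdot> (z \<cdot> i))"
    using y(1) z(1) sD(1-8) i(2) by (simp add: arith_simps)
  also have "\<gamma> \<cdot> (y \<cdot> i) = \<delta> \<cdot> (z \<cdot> i)"
    unfolding y z by (rule Cmp_cong_right[OF sD(9)]) (use h sD in \<open>auto simp: Hom_iff\<close>)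
  also have "\<dots> \<boxplus> Neg C \<dots> = Zer C Z (Cod C \<gamma>)" using z(1) i(2) sD(1-8) by (simp add: arith_simps)
  finally have "?d \<cdot> i = Zer C (Dom C i) (Cod C ?d)" using d i(2) by (simp add: Hom_iff)
  then obtain w where w: "w \<in> Arr C" "Dom C w = Cod C p" "Cod C w = Cod C \<gamma>" "w \<cdot> p = ?d"
    using cokernel_ex[OF E_cokernel[OF i(1)], of ?d] d i(2) by (auto simp: Hom_iff)
  obtain w' where w': "w' \<in> Hom C (Cod C p) (Dom C \<gamma>)" "\<gamma> \<cdot> w' = w"
    using \<gamma> i(5) w unfolding lifts_from_def by (metis Arr_Hom)
  have "\<gamma> \<cdot> (w' \<cdot> p) = ?d"
    using Cmp_cong_right1[OF w'(2), of p] w w'(1) i(3) sD by (simp add: Hom_iff)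
  then have "\<gamma> \<cdot> (y \<boxplus> Neg C (w' \<cdot> p)) = (\<gamma> \<cdot> y) \<boxplus> Neg C ?d"
    using w'(1) i(3) y(1) sD(1-8) by (simp add: cat_simps Neg_cat Cmp_Sum_R Cmp_Neg_R)
  also have "\<dots> = \<delta> \<cdot> z" using y(1) z(1) sD(1-8) by (simp add: arith_simps)
  finally have eq: "\<gamma> \<cdot> (y \<boxplus> Neg C (w' \<cdot> p)) = \<delta> \<cdot> z" .
  obtain t where t: "t \<in> Arr C" "Dom C t = Dom C z" "Cod C t = Dom C \<alpha>" "\<alpha> \<cdot> t = y \<boxplus> Neg C (w' \<cdot> p)" "\<beta> \<cdot> t = z"
    by (rule pullback_ex[OF sq _ _ _ _ _ eq]) (use y(1) z(1) w'(1) i(3) sD(1-8) in \<open>simp_all add: arith_simps\<close>)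
  have "t \<cdot> i = h"
  proof (rule pullback_eq[OF sq])
    have pi: "w' \<cdot> (p \<cdot> i) = Zer C Z (Dom C \<gamma>)"
      unfolding E_D(4)[OF i(1)] using w'(1) i(2,3) sD by (simp add: arith_simps)
    have "\<alpha> \<cdot> (t \<cdot> i) = (y \<boxplus> Neg C (w' \<cdot> p)) \<cdot> i"
      by (rule Cmp_cong_right1[OF t(4)]) (use t(1-3) i(2) z(1) sD in \<open>auto simp: Hom_iff\<close>)
    also have "\<dots> = (y \<cdot> i) \<boxplus> Neg C (w' \<cdot> (p \<cdot> i))"
      using y(1) w'(1) i(2,3) by (simp add: cat_simps Neg_cat Cmp_Sum_L Cmp_Neg_L)
    also have "\<dots> = \<alpha> \<cdot> h" unfolding pi y using \<alpha>h sD by (simp add: arith_simps)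
    finally show "\<alpha> \<cdot> (t \<cdot> i) = \<alpha> \<cdot> h" .
    show "\<beta> \<cdot> (t \<cdot> i) = \<beta> \<cdot> h"
      using Cmp_cong_right1[OF t(5), of i] t(1-3) i(2) z sD by (auto simp: Hom_iff)
  qed (use t(1-3) i(2) z(1) h(1) sD(1-8) in \<open>simp_all add: cat_simps\<close>)
  moreover have "t \<in> Hom C U (Dom C \<alpha>)" using t(1-3) z(1) sD by (simp add: cat_simps)
  ultimately show ?thesis using ambient.nullI[OF i(2) _ i(4)] by auto
qed

lemma null_pushout_cancel:
  assumes "is_pushout C \<alpha> \<beta> \<gamma> \<delta>" "extends_to C \<V> \<alpha>" "Z \<in> B_plus C E \<W> \<V>"
    "h \<in> Hom C (Cod C \<delta>) Z" "null (h \<cdot> \<gamma>)" "null (h \<cdot> \<delta>)"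
  shows "null h"
proof -
  interpret op: heart_core "op_cat C" "E\<inverse>" \<H> \<W> \<V> \<S> by (rule heart_core_op)
  show ?thesis using op.null_pullback_cancel[of \<gamma> \<delta> \<alpha> \<beta> Z h] assms(2-6) is_pushout_sym[OF assms(1)]
      is_pushoutD(8)[OF assms(1)] by (simp add: op_null)
qed

text \<open>Up to null arrows \<open>i\<close> is zero, so \<open>\<theta>\<close> becomes a cokernel of \<open>(-\<alpha>, \<beta>)\<close>.\<close>

lemma Q_pushout_of_difference:
  assumes \<alpha>: "\<alpha> \<in> Hom C A B" and \<beta>: "\<beta> \<in> Hom C A B'" and \<O>: "A \<in> \<H>" "B \<in> \<H>" "B' \<in> \<H>" "Cod C \<theta> \<in> \<H>"
    and i: "(i, p) \<in> E" "i \<in> Hom C A U" "U \<in> \<W>" "Cod C p \<in> \<S>"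
    and c: "is_biprod C B B' R k l r s" and po: "is_pushout C i ((l \<cdot> \<beta>) \<boxplus> Neg C (k \<cdot> \<alpha>)) \<mu> \<theta>"
  shows "is_pushout Q (cl \<alpha>) (cl \<beta>) (cl (\<theta> \<cdot> k)) (cl (\<theta> \<cdot> l))"
proof -
  note sD = is_pushoutD[OF po] and cD = is_biprodD[OF c] and cS = biprod_simps[OF c]
  define f where "f = (l \<cdot> \<beta>) \<boxplus> Neg C (k \<cdot> \<alpha>)"
  define D where "D = Cod C \<theta>"
  have D: "D \<in> \<H>" using \<O> by (simp add: D_def)
  have f: "f \<in> Hom C A R" using \<alpha> \<beta> cD(1-4) by (simp add: f_def arith_simps)
  have \<mu>: "\<mu> \<in> Hom C U D" and \<theta>: "\<theta> \<in> Hom C R D"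
    using sD f[unfolded f_def] i(2) by (simp_all add: D_def Hom_iff Cod_closed)
  have \<theta>k: "\<theta> \<cdot> k \<in> Hom C B D" and \<theta>l: "\<theta> \<cdot> l \<in> Hom C B' D" using \<theta> cD by (simp_all add: cat_simps)
  show ?thesis
  proof (rule Q_pushoutI[OF \<alpha> \<beta> \<theta>k \<theta>l D \<O>(2,3,1)])
    have "null (Neg C (\<mu> \<cdot> i))" using ambient.nullI[OF i(2) \<mu> i(3)] by (rule ambient.null_Neg)
    also have "Neg C (\<mu> \<cdot> i) = ((\<theta> \<cdot> k) \<cdot> \<alpha>) \<boxplus> Neg C ((\<theta> \<cdot> l) \<cdot> \<beta>)"
      unfolding sD(9) using \<theta> \<alpha> \<beta> cD(1-4) by (simp add: arith_simps)
    finally show "null (((\<theta> \<cdot> k) \<cdot> \<alpha>) \<boxplus> Neg C ((\<theta> \<cdot> l) \<cdot> \<beta>))" .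
  next
    fix x y Z assume h: "x \<in> Hom C B Z" "y \<in> Hom C B' Z" "Z \<in> \<H>" "null ((x \<cdot> \<alpha>) \<boxplus> Neg C (y \<cdot> \<beta>))"
    define z where "z = (x \<cdot> r) \<boxplus> (y \<cdot> s)"
    have z: "z \<in> Hom C R Z" "z \<cdot> k = x" "z \<cdot> l = y" using h cD cS by (simp_all add: z_def arith_simps)
    have "null (Neg C ((x \<cdot> \<alpha>) \<boxplus> Neg C (y \<cdot> \<beta>)))" using h(4) by (rule ambient.null_Neg)
    also have "Neg C ((x \<cdot> \<alpha>) \<boxplus> Neg C (y \<cdot> \<beta>)) = z \<cdot> f"
      using h(1,2) \<alpha> \<beta> cD cS by (simp add: f_def z_def arith_simps)
    finally have "null (z \<cdot> f)" .
    moreover have "z \<cdot> f \<in> Hom C A Z" using z f by (simp add: cat_simps)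
    ultimately obtain v where v: "v \<in> Hom C U Z" "v \<cdot> i = z \<cdot> f" by (rule null_extends[OF _ _ i(1,2,4)])
    obtain u where u: "u \<in> Arr C" "Dom C u = Cod C \<mu>" "Cod C u = Cod C z" "u \<cdot> \<mu> = v" "u \<cdot> \<theta> = z"
      by (rule pushout_ex[OF po _ _ _ _ _ v(2)[unfolded f_def]])
        (use v z i f[unfolded f_def] in \<open>simp_all add: Hom_iff\<close>)
    have u': "u \<in> Hom C D Z" using u(1-3) \<mu> z by (simp add: Hom_iff)
    have "u \<cdot> (\<theta> \<cdot> k) = x" "u \<cdot> (\<theta> \<cdot> l) = y"
      using Cmp_cong_right1[OF u(5), of k] Cmp_cong_right1[OF u(5), of l] u' \<theta> cD(1,2) z by (auto simp: Hom_iff)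
    then show "\<exists>u \<in> Hom C D Z. null ((u \<cdot> (\<theta> \<cdot> k)) \<boxplus> Neg C x) \<and> null ((u \<cdot> (\<theta> \<cdot> l)) \<boxplus> Neg C y)"
      using u' h(1,2) by (intro bexI[of _ u]) (simp_all add: Hom_iff Neg_right ambient.null_Zer)
  next
    fix h Z assume h: "h \<in> Hom C D Z" "Z \<in> \<H>" "null (h \<cdot> (\<theta> \<cdot> k))" "null (h \<cdot> (\<theta> \<cdot> l))"
    have h\<theta>: "h \<cdot> (\<theta> \<cdot> k) \<in> Hom C B Z" "h \<cdot> (\<theta> \<cdot> l) \<in> Hom C B' Z" using h(1) \<theta>k \<theta>l by (simp_all add: cat_simps)
    have "h \<cdot> \<theta> = (h \<cdot> \<theta>) \<cdot> ((k \<cdot> r) \<boxplus> (l \<cdot> s))" unfolding cD using h(1) \<theta> by (simp add: cat_simps)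
    also have "\<dots> = ((h \<cdot> (\<theta> \<cdot> k)) \<cdot> r) \<boxplus> ((h \<cdot> (\<theta> \<cdot> l)) \<cdot> s)"
      using h(1) \<theta> cD(1-4) by (simp add: cat_simps Cmp_Sum_R)
    also have "null \<dots>"
      by (rule ambient.null_Sum[OF ambient.null_comp_right[OF h(3) h\<theta>(1) cD(3)]
            ambient.null_comp_right[OF h(4) h\<theta>(2) cD(4)] Cmp_closed[OF cD(3) h\<theta>(1)] Cmp_closed[OF cD(4) h\<theta>(2)]])
    finally have "null (h \<cdot> \<theta>)" .
    moreover have "null (h \<cdot> \<mu>)" using null_from[OF Cmp_closed[OF \<mu> h(1)] i(3)] .
    moreover have "extends_to C \<V> i" using ext[OF i(1,4)] by (simp add: extends_to_def)
    ultimately show "null h" using null_pushout_cancel[OF po, of Z h] h \<H>_plus by (auto simp: D_def)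
  qed
qed

text \<open>Modulo null arrows \<open>\<alpha>\<close> agrees with the inflation \<open>(\<alpha>, i) : A \<rightarrowtail> B \<oplus> U\<close>, along which pushouts
  exist. Such a pushout \<open>D\<close> is also the pushout of \<open>i\<close> along \<open>A \<rightarrow> B \<oplus> B'\<close>; this gives its universal
  property in the quotient and presents \<open>D\<close> as an extension of \<open>B \<oplus> B'\<close> by an object of \<open>\<S>\<close>.\<close>

lemma pushout_construction:
  assumes \<alpha>: "\<alpha> \<in> Hom C A B" and \<beta>: "\<beta> \<in> Hom C A B'" and \<O>: "A \<in> \<H>" "B \<in> \<H>" "B' \<in> \<H>"
  obtains i p U P \<iota> \<kappa> \<pi> \<rho> n \<gamma> \<delta> R \<theta> q where
    "(i, p) \<in> E" "i \<in> Hom C A U" "U \<in> \<W>" "Cod C p \<in> \<S>"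
    "is_biprod C B U P \<iota> \<kappa> \<pi> \<rho>" "((\<iota> \<cdot> \<alpha>) \<boxplus> (\<kappa> \<cdot> i), n) \<in> E"
    "is_pushout C ((\<iota> \<cdot> \<alpha>) \<boxplus> (\<kappa> \<cdot> i)) \<beta> \<gamma> \<delta>"
    "is_direct_sum C B B' R" "(\<theta>, q) \<in> E" "\<theta> \<in> Hom C R (Cod C \<delta>)" "Cod C q \<in> \<S>"
    "Cod C \<delta> \<in> \<H> \<longrightarrow> is_pushout Q (cl \<alpha>) (cl \<beta>) (cl (\<gamma> \<cdot> \<iota>)) (cl \<delta>)"
proof -
  have "A \<in> B_minus C E \<W> \<S>" using \<O> \<H>_minus by auto
  then obtain i p U where i: "(i, p) \<in> E" "i \<in> Hom C A U" "U \<in> \<W>" "Cod C p \<in> \<S>" by (rule B_minusE)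
  obtain P \<iota> \<kappa> \<pi> \<rho> where b: "is_biprod C B U P \<iota> \<kappa> \<pi> \<rho>"
    by (rule biprod_ex[of B U]) (use \<alpha> i in \<open>simp_all add: Hom_iff\<close>)
  note bD = is_biprodD[OF b]
  have "is_inflation E ((\<iota> \<cdot> \<alpha>) \<boxplus> (\<kappa> \<cdot> i))"
    by (rule inflation_column[OF b \<alpha> i(2)]) (use i(1) in \<open>auto simp: is_inflation_def\<close>)
  then obtain n where n: "((\<iota> \<cdot> \<alpha>) \<boxplus> (\<kappa> \<cdot> i), n) \<in> E" by (auto simp: is_inflation_def)
  have \<alpha>': "(\<iota> \<cdot> \<alpha>) \<boxplus> (\<kappa> \<cdot> i) \<in> Hom C A P" using \<alpha> i(2) bD(1-4) by (simp add: arith_simps)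
  obtain \<gamma> \<delta> where po: "is_pushout C ((\<iota> \<cdot> \<alpha>) \<boxplus> (\<kappa> \<cdot> i)) \<beta> \<gamma> \<delta>"
    by (rule ses_pushout_ex[OF n, of \<beta>]) (use \<alpha>' \<beta> in \<open>auto simp: Hom_iff\<close>)
  note sD = is_pushoutD[OF po]
  have \<gamma>: "\<gamma> \<in> Hom C P (Cod C \<delta>)" and \<delta>: "\<delta> \<in> Hom C B' (Cod C \<delta>)"
    using sD \<alpha>' \<beta> by (simp_all add: Hom_iff Cod_closed)
  obtain R k l r s where c: "is_biprod C B B' R k l r s"
    by (rule biprod_ex[of B B']) (use \<alpha> \<beta> in \<open>simp_all add: Hom_iff\<close>)
  note cD = is_biprodD[OF c] and cS = biprod_simps[OF c]
  define \<theta> where "\<theta> = ((\<gamma> \<cdot> \<iota>) \<cdot> r) \<boxplus> (\<delta> \<cdot> s)"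
  have \<theta>: "\<theta> \<in> Hom C R (Cod C \<delta>)" "\<theta> \<cdot> k = \<gamma> \<cdot> \<iota>" "\<theta> \<cdot> l = \<delta>"
    using \<gamma> \<delta> bD(1) cD cS by (simp_all add: \<theta>_def arith_simps)
  have po': "is_pushout C i ((l \<cdot> \<beta>) \<boxplus> Neg C (k \<cdot> \<alpha>)) (\<gamma> \<cdot> \<kappa>) \<theta>"
    unfolding \<theta>_def by (rule pushout_transpose[OF b c \<alpha> \<beta> i(2) po])
  obtain q where q: "(\<theta>, q) \<in> E" "Cod C q = Cod C p" by (rule ses_pushout[OF po' i(1)])
  have "is_direct_sum C B B' R" using c by (auto simp: is_direct_sum_def)
  moreover have "is_pushout Q (cl \<alpha>) (cl \<beta>) (cl (\<gamma> \<cdot> \<iota>)) (cl \<delta>)" if "Cod C \<delta> \<in> \<H>"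
    using Q_pushout_of_difference[OF \<alpha> \<beta> \<O> _ i c po'] that \<theta> by (simp add: Hom_iff)
  ultimately show thesis using that[OF i b n po _ q(1) \<theta>(1)] q(2) i(4) by simp
qed

lemma pullback_construction:
  assumes "\<alpha> \<in> Hom C B A" "\<beta> \<in> Hom C B' A" "A \<in> \<H>" "B \<in> \<H>" "B' \<in> \<H>"
  obtains U P \<iota> \<kappa> \<pi> \<rho> j g \<delta> \<gamma> where
    "U \<in> \<W>" "is_biprod C B U P \<iota> \<kappa> \<pi> \<rho>" "(j, g) \<in> E" "g \<in> Hom C P A"
    "is_pullback C \<delta> \<gamma> \<beta> g"
    "Dom C \<delta> \<in> \<H> \<longrightarrow> is_pullback Q (cl (\<pi> \<cdot> \<gamma>)) (cl \<delta>) (cl \<alpha>) (cl \<beta>)"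
proof -
  interpret op: heart_core "op_cat C" "E\<inverse>" \<H> \<W> \<V> \<S> by (rule heart_core_op)
  show thesis
  proof (rule op.pushout_construction[of \<alpha> A B \<beta> B'])
    fix U i p P \<iota> \<kappa> \<pi> \<rho> n \<gamma> \<delta> R \<theta> q
    assume h: "i \<in> Hom (op_cat C) A U" "U \<in> \<W>"
      "is_biprod (op_cat C) B U P \<iota> \<kappa> \<pi> \<rho>" "((\<iota> \<cdot>\<^bsub>op_cat C\<^esub> \<alpha>) \<boxplus>\<^bsub>op_cat C\<^esub> (\<kappa> \<cdot>\<^bsub>op_cat C\<^esub> i), n) \<in> E\<inverse>"
      "is_pushout (op_cat C) ((\<iota> \<cdot>\<^bsub>op_cat C\<^esub> \<alpha>) \<boxplus>\<^bsub>op_cat C\<^esub> (\<kappa> \<cdot>\<^bsub>op_cat C\<^esub> i)) \<beta> \<gamma> \<delta>"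
      "Cod (op_cat C) \<delta> \<in> \<H> \<longrightarrow> is_pushout (quot_cat (full_subcat (op_cat C) \<H>) \<W>)
        (arr_class (full_subcat (op_cat C) \<H>) \<W> \<alpha>) (arr_class (full_subcat (op_cat C) \<H>) \<W> \<beta>)
        (arr_class (full_subcat (op_cat C) \<H>) \<W> (\<gamma> \<cdot>\<^bsub>op_cat C\<^esub> \<iota>)) (arr_class (full_subcat (op_cat C) \<H>) \<W> \<delta>)"
    let ?g = "(\<alpha> \<cdot> \<iota>) \<boxplus> (i \<cdot> \<kappa>)"
    have "?g \<in> Hom C P A" using h(1,3) assms(1) is_biprodD(3,4)[of P _ _ \<iota> \<kappa> \<pi> \<rho>] 
      by (auto simp: is_biprod_def arith_simps)
    then show thesis
      using that[of U P \<pi> \<rho> \<iota> \<kappa> n ?g \<delta> \<gamma>] h(2-6) by (auto simp: op_Q intro: is_pullback_sym)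
  qed (use assms in auto)
qed

text \<open>In the quotient \<open>Cod i\<close> is a zero object, so this pushout is a cokernel.\<close>

lemma pushout_cokernel:
  assumes po: "is_pushout C i f \<gamma> c" and i: "(i, p) \<in> E" "Cod C i \<in> \<W>" "Cod C p \<in> \<S>"
    and \<O>: "Dom C f \<in> \<H>" "Cod C f \<in> \<H>" "Cod C c \<in> \<H>"
  shows "is_cokernel_of Q (cl c) (cl f)"
proof -
  note sD = is_pushoutD[OF po]
  define A B X where "A = Dom C f" and "B = Cod C f" and "X = Cod C c"
  have H: "A \<in> \<H>" "B \<in> \<H>" "X \<in> \<H>" using \<O> by (simp_all add: A_def B_def X_def)
  have h: "i \<in> Hom C A (Cod C i)" "f \<in> Hom C A B" "\<gamma> \<in> Hom C (Cod C i) X" "c \<in> Hom C B X"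
    using sD by (simp_all add: A_def B_def X_def Hom_def)
  show ?thesis
  proof (rule Q_cokernelI[OF h(4) H(3) h(2) H(1,2)])
    show "null (c \<cdot> f)" using ambient.nullI[OF h(1,3) i(2)] sD(9) by simp
  next
    fix x Z assume x: "x \<in> Hom C B Z" "Z \<in> \<H>" "null (x \<cdot> f)"
    have "x \<cdot> f \<in> Hom C A Z" using x h by (simp add: cat_simps)
    then obtain y where y: "y \<in> Hom C (Cod C i) Z" "y \<cdot> i = x \<cdot> f"
      by (rule null_extends[OF x(3) _ i(1) h(1) i(3)])
    obtain u where u: "u \<in> Arr C" "Dom C u = Cod C \<gamma>" "Cod C u = Cod C x" "u \<cdot> \<gamma> = y" "u \<cdot> c = x"
      by (rule pushout_ex[OF po _ _ _ _ _ y(2)]) (use x y h in \<open>simp_all add: Hom_iff\<close>)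
    then show "\<exists>u \<in> Hom C X Z. null ((u \<cdot> c) \<boxplus> Neg C x)"
      using x(1) h(3) by (intro bexI[of _ u]) (simp_all add: Hom_iff Neg_right ambient.null_Zer)
  next
    fix h' Z assume h': "h' \<in> Hom C X Z" "Z \<in> \<H>" "null (h' \<cdot> c)"
    have "h' \<cdot> \<gamma> \<in> Hom C (Cod C i) Z" using h h' by (simp add: cat_simps)
    then have "null (h' \<cdot> \<gamma>)" using null_from i(2) by blast
    moreover have "extends_to C \<V> i" using ext[OF i(1,3)] by (simp add: extends_to_def)
    ultimately show "null h'" using null_pushout_cancel[OF po, of Z h'] h' \<H>_plus by (auto simp: X_def)
  qed
qed

text \<open>Choosing \<open>V \<rightarrowtail> W \<twoheadrightarrow> D\<close> presents \<open>c : B \<rightarrowtail> D\<close> as the pushout of the inflation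
  \<open>Z = ker (W \<twoheadrightarrow> D \<twoheadrightarrow> S) \<rightarrowtail> W\<close> along \<open>Z \<rightarrow> B\<close>.\<close>

lemma inflation_cokernel:
  assumes c: "(c, q) \<in> E" "Cod C q \<in> \<S>" and \<O>: "Dom C c \<in> \<H>" "Cod C c \<in> \<H>"
    and \<H>: "\<And>j a. \<lbrakk>(j, a) \<in> E; Dom C j \<in> \<V>; Cod C a = Dom C c; Dom C a \<in> B_minus C E \<W> \<S>\<rbrakk>
      \<Longrightarrow> Dom C a \<in> \<H>"
  shows "is_cokernel Q (cl c)"
proof -
  note cD = E_D[OF c(1)]
  have "Cod C c \<in> B_plus C E \<W> \<V>" using \<O> \<H>_plus by auto
  then obtain j u W where u: "(j, u) \<in> E" "u \<in> Hom C W (Cod C c)" "j \<in> Hom C (Dom C j) W" "W \<in> \<W>" "Dom C j \<in> \<V>"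
    by (rule B_plusE)
  obtain j' a i where pb: "is_pullback C a i c u" and j': "(j', a) \<in> E" "Dom C j' = Dom C j"
    by (rule ses_pullback_ex[OF u(1), of c]) (use cD u in \<open>auto simp: Hom_iff\<close>)
  note pD = is_pullbackD[OF pb]
  have i: "(i, q \<cdot> u) \<in> E" by (rule ses_Cmp_deflation[OF u(1) c(1) pb])
  have "is_pushout C a i c u"
    by (rule pushout_of_ses[OF c(1) i]) (use pD u in \<open>auto simp: Hom_iff Dom_closed\<close>)
  then have po: "is_pushout C i a u c" by (rule is_pushout_sym)
  have qu: "Dom C (q \<cdot> u) = W" "Cod C (q \<cdot> u) = Cod C q" using cD u by (simp_all add: cat_simps)
  have "Dom C i \<in> B_minus C E \<W> \<S>"
    by (rule B_minusI[OF i]) (use E_D[OF i] qu u(4) c(2) in \<open>simp_all add: Dom_closed\<close>)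
  then have "Dom C a \<in> \<H>" using \<H>[OF j'(1)] j'(2) u(5) pD by simp
  then have "is_cokernel_of Q (cl c) (cl a)"
    using \<O> pD u qu c(2) by (intro pushout_cokernel[OF po i]) (simp_all add: Hom_iff)
  then show ?thesis by (auto simp: is_cokernel_def)
qed

lemma deflation_kernel:
  assumes "(v, k) \<in> E" "Dom C v \<in> \<V>" "Cod C k \<in> \<H>" "Dom C k \<in> \<H>"
    and "\<And>a q. \<lbrakk>(a, q) \<in> E; Cod C q \<in> \<S>; Dom C a = Cod C k; Cod C a \<in> B_plus C E \<W> \<V>\<rbrakk>
      \<Longrightarrow> Cod C a \<in> \<H>"
  shows "is_kernel Q (cl k)"
proof -
  interpret op: heart_core "op_cat C" "E\<inverse>" \<H> \<W> \<V> \<S> by (rule heart_core_op)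
  show ?thesis using op.inflation_cokernel[of k v] assms by (simp add: op_Q)
qed

end

section \<open>Cotorsion pairs\<close>

text \<open>The vanishing of Ext groups is used in the form that all extensions split.\<close>

locale split_cotorsion = exact_structure C E for C :: "('o, 'm) acat" (structure) and E +
  fixes \<U> \<V> :: "'o set"
  assumes \<U>_Obj: "\<U> \<subseteq> Obj C" and \<V>_Obj: "\<V> \<subseteq> Obj C"
    and \<U>_summand: "closed_under_summands C \<U>" and \<V>_summand: "closed_under_summands C \<V>"
    and split: "\<lbrakk>(i, p) \<in> E; Dom C i \<in> \<V>; Cod C p \<in> \<U>\<rbrakk>
      \<Longrightarrow> \<exists>s r. is_biprod C (Dom C i) (Cod C p) (Cod C i) i s r p"
    and \<U>_cover: "B \<in> Obj C \<Longrightarrow> \<exists>j p. (j, p) \<in> E \<and> Cod C p = B \<and> Dom C p \<in> \<U> \<and> Dom C j \<in> \<V>"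
    and \<V>_hull: "B \<in> Obj C \<Longrightarrow> \<exists>i p. (i, p) \<in> E \<and> Dom C i = B \<and> Cod C i \<in> \<V> \<and> Cod C p \<in> \<U>"
begin

lemma split_cotorsion_op: "split_cotorsion (op_cat C) (E\<inverse>) \<V> \<U>"
proof (intro split_cotorsion.intro split_cotorsion_axioms.intro exact_structure_op)
  fix i p assume h: "(i, p) \<in> E\<inverse>" "Dom (op_cat C) i \<in> \<U>" "Cod (op_cat C) p \<in> \<V>"
  then obtain s r where "is_biprod C (Dom C p) (Cod C i) (Cod C p) p s r i"
    using split[of p i] by auto
  then show "\<exists>s r. is_biprod (op_cat C) (Dom (op_cat C) i) (Cod (op_cat C) p) (Cod (op_cat C) i) i s r p"
    using is_biprod_sym E_D(3)[of p i] h by fastforce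
next
  show "closed_under_summands (op_cat C) \<V>" "closed_under_summands (op_cat C) \<U>"
    using \<U>_summand \<V>_summand by (simp_all add: closed_under_summands_def)
  show "\<exists>j p. (j, p) \<in> E\<inverse> \<and> Cod (op_cat C) p = B \<and> Dom (op_cat C) p \<in> \<V> \<and> Dom (op_cat C) j \<in> \<U>"
    if "B \<in> Obj (op_cat C)" for B using \<V>_hull[of B] that by auto
  show "\<exists>i p. (i, p) \<in> E\<inverse> \<and> Dom (op_cat C) i = B \<and> Cod (op_cat C) i \<in> \<U> \<and> Cod (op_cat C) p \<in> \<V>"
    if "B \<in> Obj (op_cat C)" for B using \<U>_cover[of B] that by auto
qed (use \<U>_Obj \<V>_Obj in simp_all)

lemma extends_to_\<V>:
  assumes i: "(i, p) \<in> E" "Cod C p \<in> \<U>" shows "extends_to C \<V> i"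
  unfolding extends_to_def
proof (intro ballI)
  fix Y f assume Y: "Y \<in> \<V>" and f: "f \<in> Hom C (Dom C i) Y"
  obtain q \<gamma> \<delta> where po: "is_pushout C i f \<gamma> \<delta>" and q: "(\<delta>, q) \<in> E" "Cod C q = Cod C p"
    by (rule ses_pushout_ex[OF i(1), of f]) (use f in \<open>auto simp: Hom_iff\<close>)
  note pD = is_pushoutD[OF po]
  obtain s r where "is_biprod C (Dom C \<delta>) (Cod C q) (Cod C \<delta>) \<delta> s r q"
    using split[OF q(1)] q(2) i(2) Y f pD by (auto simp: Hom_iff)
  then have r: "r \<in> Hom C (Cod C \<delta>) (Dom C \<delta>)" "r \<cdot> \<delta> = Ide C (Dom C \<delta>)" by (simp_all add: is_biprod_def)
  have "(r \<cdot> \<gamma>) \<cdot> i = r \<cdot> (\<delta> \<cdot> f)" using r(1) pD by (simp add: cat_simps)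
  also have "\<dots> = Ide C (Dom C \<delta>) \<cdot> f" by (rule Cmp_cong_right1[OF r(2)]) (use r(1) pD in \<open>auto simp: Hom_iff\<close>)
  also have "\<dots> = f" using f pD by (simp add: cat_simps)
  finally show "\<exists>g \<in> Hom C (Cod C i) Y. g \<cdot> i = f"
    using r(1) f pD by (intro bexI[of _ "r \<cdot> \<gamma>"]) (simp_all add: cat_simps)
qed

lemma lifts_from_\<U>: "(j, p) \<in> E \<Longrightarrow> Dom C j \<in> \<V> \<Longrightarrow> lifts_from C \<U> p"
  using split_cotorsion.extends_to_\<V>[OF split_cotorsion_op, of p j] by simp

lemma \<U>I:
  assumes "X \<in> Obj C" and "\<And>j p. \<lbrakk>(j, p) \<in> E; Dom C j \<in> \<V>; Cod C p = X\<rbrakk>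
    \<Longrightarrow> \<exists>s \<in> Hom C X (Dom C p). p \<cdot> s = Ide C X"
  shows "X \<in> \<U>"
proof -
  obtain j p where j: "(j, p) \<in> E" "Cod C p = X" "Dom C p \<in> \<U>" "Dom C j \<in> \<V>"
    using \<U>_cover[OF assms(1)] by blast
  obtain s where s: "s \<in> Hom C X (Dom C p)" "p \<cdot> s = Ide C X" using assms(2) j by blast
  have "is_direct_sum C X (Dom C j) (Dom C p)"
    using section_biprod[OF j(1), of s] s j(2) unfolding is_direct_sum_def by blast
  then show ?thesis using \<U>_summand j(3) unfolding closed_under_summands_def by blast
qed

text \<open>Let \<open>g : B \<rightarrow> R\<close> be a deflation with kernel in \<open>\<V>\<close>. It splits over the subobject of \<open>R\<close>, and a
  retraction there onto the kernel extends to \<open>B\<close>, because the quotient of \<open>R\<close> is in \<open>\<U>\<close>.\<close>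

lemma \<U>_extension:
  assumes i: "(i, p) \<in> E" "Dom C i \<in> \<U>" "Cod C p \<in> \<U>"
  shows "Cod C i \<in> \<U>"
proof (rule \<U>I)
  note iD = E_D[OF i(1)]
  show "Cod C i \<in> Obj C" by (rule Cod_closed[OF iD(1)])
  fix j g assume g: "(j, g) \<in> E" "Dom C j \<in> \<V>" "Cod C g = Cod C i"
  note gD = E_D[OF g(1)]
  obtain j' a b where pb: "is_pullback C a b i g" and j': "(j', a) \<in> E" "Dom C j' = Dom C j" "b \<cdot> j' = j"
    by (rule ses_pullback_ex[OF g(1), of i]) (use iD g in auto)
  note pD = is_pullbackD[OF pb] and jD = E_D[OF j'(1)]
  have b: "(b, p \<cdot> g) \<in> E" by (rule ses_Cmp_deflation[OF g(1) i(1) pb])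
  obtain s' r where "is_biprod C (Dom C j') (Cod C a) (Cod C j') j' s' r a"
    using split[OF j'(1)] j'(2) g(2) i(2) pD by auto
  then have r: "r \<in> Hom C (Dom C a) (Dom C j)" "r \<cdot> j' = Ide C (Dom C j)"
    using jD j'(2) by (simp_all add: is_biprod_def)
  have "extends_to C \<V> b" using extends_to_\<V>[OF b] i(3) gD iD g(3) by (simp add: cat_simps)
  moreover have "b \<in> Hom C (Dom C a) (Dom C g)" using pD by (simp add: Hom_iff Dom_closed)
  ultimately obtain t where t: "t \<in> Hom C (Dom C g) (Dom C j)" "t \<cdot> b = r"
    using extends_toE[OF _ g(2) _ r(1)] by blast
  have "t \<cdot> j = t \<cdot> (b \<cdot> j')" by (simp add: j')
  also have "\<dots> = r \<cdot> j'" by (rule Cmp_cong_right1[OF t(2)]) (use t(1) pD jD in \<open>auto simp: Hom_iff\<close>)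
  finally have tj: "t \<cdot> j = Ide C (Dom C j)" using r by simp
  define e where "e = Ide C (Dom C g) \<boxplus> Neg C (j \<cdot> t)"
  have e: "e \<in> Hom C (Dom C g) (Dom C g)" using gD(1-3) t(1) by (simp add: e_def arith_simps)
  have ej: "e \<cdot> j = Zer C (Dom C j) (Cod C e)" using gD(1-3) t(1) tj e by (simp add: e_def arith_simps)
  obtain s where s: "s \<in> Arr C" "Dom C s = Cod C g" "Cod C s = Cod C e" "s \<cdot> g = e"
    by (rule cokernel_ex[OF E_cokernel[OF g(1)] _ _ ej]) (use e gD in \<open>simp_all add: Hom_iff\<close>)
  have s': "s \<in> Hom C (Cod C g) (Dom C g)" using s(1-3) e gD by (simp add: cat_simps)
  have gj: "g \<cdot> (j \<cdot> t) = Zer C (Dom C g) (Cod C g)"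
    using Cmp_cong_right1[OF gD(4), of t] gD(1-3) t(1) by (simp add: arith_simps)
  have "(g \<cdot> s) \<cdot> g = g \<cdot> e" using s s' gD by (simp add: cat_simps)
  also have "\<dots> = Ide C (Cod C g) \<cdot> g" using gD(1-3) t(1) gj by (simp add: e_def arith_simps)
  finally have "g \<cdot> s = Ide C (Cod C g)"
    by - (rule epi_cancel[OF gD(6)], use s' gD(1-3) in \<open>simp_all add: cat_simps\<close>)
  then show "\<exists>s \<in> Hom C (Cod C i) (Dom C g). g \<cdot> s = Ide C (Cod C i)" using s' g(3) by auto
qed

lemma \<V>_extension: "(i, p) \<in> E \<Longrightarrow> Dom C i \<in> \<V> \<Longrightarrow> Cod C p \<in> \<V> \<Longrightarrow> Cod C i \<in> \<V>"
  using split_cotorsion.\<U>_extension[OF split_cotorsion_op, of p i] E_D(3)[of i p] by simp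

lemma \<V>I:
  assumes "X \<in> Obj C" and "\<And>i p. \<lbrakk>(i, p) \<in> E; Cod C p \<in> \<U>; Dom C i = X\<rbrakk>
    \<Longrightarrow> \<exists>r \<in> Hom C (Cod C i) X. r \<cdot> i = Ide C X"
  shows "X \<in> \<V>"
  using split_cotorsion.\<U>I[OF split_cotorsion_op, of X] assms by auto

end

lemma (in exact_category) split_cotorsion:
  assumes cp: "cotorsion_pair C E \<U> \<V>" shows "split_cotorsion C E \<U> \<V>"
proof -
  interpret exact_structure C E by (rule exact_structure)
  have "\<exists>s r. is_biprod C (Dom C i) (Cod C p) (Cod C i) i s r p"
    if i: "(i, p) \<in> E" "Dom C i \<in> \<V>" "Cod C p \<in> \<U>" for i p
  proof -
    note iD = E_D[OF i(1)]
    have "Cod C i \<in> Obj C" using iD by (intro Cod_closed)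
    then have x: "(i, p) \<in> extensions C E (Cod C p) (Dom C i)"
      using i iD unfolding extensions_def seq_def by (auto simp: Hom_def)
    have refl: "((i, p), (i, p)) \<in> ext_rel C E (Cod C p) (Dom C i)"
      using x iD Dom_closed[OF iD(2)] unfolding ext_rel_def
      by (auto simp: cat_simps is_iso_Ide intro!: bexI[of _ "Ide C (Cod C i)"])
    have "ext_rel C E (Cod C p) (Dom C i) `` {(i, p)} \<in> Ext1 C E (Cod C p) (Dom C i)"
      unfolding Ext1_def using x by (rule quotientI)
    also have "Ext1 C E (Cod C p) (Dom C i) = {Ext1_zero C E (Cod C p) (Dom C i)}"
      using cp i by (simp add: cotorsion_pair_def)
    finally have "ext_rel C E (Cod C p) (Dom C i) `` {(i, p)} = Ext1_zero C E (Cod C p) (Dom C i)"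
      by (rule singletonD)
    then have "(i, p) \<in> Ext1_zero C E (Cod C p) (Dom C i)" using refl by (metis ImageI singletonI)
    then show ?thesis by (simp add: Ext1_zero_def)
  qed
  moreover have "\<exists>j p. (j, p) \<in> E \<and> Cod C p = B \<and> Dom C p \<in> \<U> \<and> Dom C j \<in> \<V>"
    "\<exists>i p. (i, p) \<in> E \<and> Dom C i = B \<and> Cod C i \<in> \<V> \<and> Cod C p \<in> \<U>" if "B \<in> Obj C" for B
  proof -
    have ses: "\<exists>i p. (i, p) \<in> E \<and> Dom C i = X \<and> Cod C i = Y \<and> Dom C p = Y \<and> Cod C p = Z"
      if "ses C E X Y Z" for X Y Z
      using that by (auto simp: ses_def seq_def Hom_def)
    have "\<exists>V\<in>\<V>. \<exists>U\<in>\<U>. ses C E V U B" "\<exists>V\<in>\<V>. \<exists>U\<in>\<U>. ses C E B V U"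
      using cp that unfolding cotorsion_pair_def by simp_all
    then obtain V U V' U' where V: "V \<in> \<V>" "U \<in> \<U>" "ses C E V U B" "V' \<in> \<V>" "U' \<in> \<U>" "ses C E B V' U'"
      by blast
    show "\<exists>j p. (j, p) \<in> E \<and> Cod C p = B \<and> Dom C p \<in> \<U> \<and> Dom C j \<in> \<V>"
      using ses[OF V(3)] V(1,2) by metis
    show "\<exists>i p. (i, p) \<in> E \<and> Dom C i = B \<and> Cod C i \<in> \<V> \<and> Cod C p \<in> \<U>"
      using ses[OF V(6)] V(4,5) by metis
  qed
  ultimately show ?thesis
    using cp by unfold_locales (auto simp: cotorsion_pair_def is_additive_subcat_def)
qed

section \<open>The heart of a twin cotorsion pair\<close>

text \<open>The case \<open>\<U> \<subseteq> \<T>\<close>. As then \<open>\<W> = \<T> \<inter> \<U> = \<U>\<close> and \<open>\<B>\<^sup>+\<close> contains all objects, the heart is determined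
  by \<open>\<B>\<^sup>-\<close> alone, which is called \<open>\<H>\<close> below.\<close>

locale twin_cotorsion = exact_structure C E +
  st: split_cotorsion C E \<S> \<T> + uv: split_cotorsion C E \<U> \<V>
  for C :: "('o, 'm) acat" (structure) and E \<S> \<T> \<U> \<V> +
  assumes \<S>_\<U>: "\<S> \<subseteq> \<U>" and \<U>_\<T>: "\<U> \<subseteq> \<T>"
    and \<U>_zero: "\<exists>Z \<in> \<U>. is_zero_obj C Z"
    and \<U>_sum: "\<lbrakk>A \<in> \<U>; B \<in> \<U>\<rbrakk> \<Longrightarrow> \<exists>P \<in> \<U>. is_direct_sum C A B P"
begin

abbreviation \<H> where "\<H> \<equiv> B_minus C E \<U> \<S>"

lemma B_plus_all: "B_plus C E \<U> \<V> = Obj C"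
proof -
  have "B \<in> B_plus C E \<U> \<V>" if B: "B \<in> Obj C" for B
  proof -
    obtain j p where j: "(j, p) \<in> E" "Cod C p = B" "Dom C p \<in> \<U>" "Dom C j \<in> \<V>"
      using uv.\<U>_cover[OF B] by blast
    then have "ses C E (Dom C j) (Dom C p) B"
      using E_D[OF j(1)] unfolding ses_def seq_def by (auto simp: Hom_def)
    then show ?thesis using j B unfolding B_plus_def by blast
  qed
  then show ?thesis by (auto simp: B_plus_def)
qed

lemma \<H>I:
  assumes "(i, p) \<in> E" "Cod C i \<in> \<U>" "Cod C p \<in> \<S>" shows "Dom C i \<in> \<H>"
  by (rule B_minusI[OF assms(1)]) (use E_D[OF assms(1)] assms in \<open>auto simp: Dom_closed\<close>)

lemma \<H>E:
  assumes "A \<in> \<H>" obtains i p U where "(i, p) \<in> E" "i \<in> Hom C A U" "U \<in> \<U>" "Cod C p \<in> \<S>"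
  using assms by (elim B_minusE)

text \<open>The pushout of \<open>U\<close> (for \<open>A \<rightarrowtail> U \<twoheadrightarrow> S\<close>) along an extension \<open>A \<rightarrowtail> D\<close> with quotient in \<open>\<S> \<subseteq> \<U>\<close> is an
  extension of objects of \<open>\<U>\<close>, and \<open>D\<close> embeds into it with quotient \<open>S\<close>.\<close>

lemma \<H>_extension:
  assumes i: "(i, q) \<in> E" "Dom C i \<in> \<H>" "Cod C q \<in> \<S>" shows "Cod C i \<in> \<H>"
proof -
  obtain a p U where a: "(a, p) \<in> E" "a \<in> Hom C (Dom C i) U" "U \<in> \<U>" "Cod C p \<in> \<S>" by (rule \<H>E[OF i(2)])
  obtain q' \<gamma> \<delta> where po: "is_pushout C i a \<gamma> \<delta>" and q': "(\<delta>, q') \<in> E" "Cod C q' = Cod C q"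
    by (rule ses_pushout_ex[OF i(1), of a]) (use a in \<open>auto simp: Hom_iff\<close>)
  note pD = is_pushoutD[OF po]
  obtain p' where p': "(\<gamma>, p') \<in> E" "Cod C p' = Cod C p"
    by (rule ses_pushout[OF is_pushout_sym[OF po] a(1)])
  have "Cod C \<delta> \<in> \<U>"
    by (rule uv.\<U>_extension[OF q'(1)]) (use q' i \<S>_\<U> a pD in \<open>auto simp: Hom_iff\<close>)
  then have "Dom C \<gamma> \<in> \<H>" using p' a pD by (intro \<H>I[OF p'(1)]) auto
  then show ?thesis using pD by simp
qed

text \<open>The composite \<open>P \<rightarrowtail> A \<rightarrowtail> U\<close> has as cokernel an extension of two objects of \<open>\<S>\<close>.\<close>

lemma \<H>_subobject:
  assumes i: "(i, q) \<in> E" "Cod C i \<in> \<H>" "Cod C q \<in> \<S>" shows "Dom C i \<in> \<H>"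
proof -
  note iD = E_D[OF i(1)]
  obtain a p U where a: "(a, p) \<in> E" "a \<in> Hom C (Cod C i) U" "U \<in> \<U>" "Cod C p \<in> \<S>" by (rule \<H>E[OF i(2)])
  obtain p' b c where po: "is_pushout C a q b c" and p': "(c, p') \<in> E" "Cod C p' = Cod C p"
    by (rule ses_pushout_ex[OF a(1), of q]) (use iD a in \<open>auto simp: Hom_iff\<close>)
  note pD = is_pushoutD[OF po]
  have ai: "(a \<cdot> i, b) \<in> E" by (rule ses_Cmp_inflation[OF a(1) i(1) po])
  have "Cod C c \<in> \<S>" by (rule st.\<U>_extension[OF p'(1)]) (use p' a i pD in auto)
  then have "Dom C (a \<cdot> i) \<in> \<H>" using a iD pD by (intro \<H>I[OF ai]) (auto simp: cat_simps)
  then show ?thesis using a iD by (simp add: cat_simps)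
qed

text \<open>For \<open>A \<rightarrowtail> T \<twoheadrightarrow> S\<close> with \<open>A \<in> \<U>\<close>, the object \<open>T\<close> is in \<open>\<U>\<close> as an extension of \<open>S\<close> by \<open>A\<close>.\<close>

lemma \<U>_\<H>: "\<U> \<subseteq> \<H>"
proof
  fix A assume A: "A \<in> \<U>"
  then have "A \<in> Obj C" using uv.\<U>_Obj by auto
  then obtain i p where i: "(i, p) \<in> E" "Dom C i = A" "Cod C i \<in> \<T>" "Cod C p \<in> \<S>"
    using st.\<V>_hull by blast
  have "Cod C i \<in> \<U>" using uv.\<U>_extension[OF i(1)] i A \<S>_\<U> by auto
  then show "A \<in> \<H>" using \<H>I[OF i(1)] i by simp
qed

lemma \<H>_sum:
  assumes "A \<in> \<H>" "B \<in> \<H>" and b: "is_direct_sum C A B P" shows "P \<in> \<H>"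
proof -
  obtain i p U where i: "(i, p) \<in> E" "i \<in> Hom C A U" "U \<in> \<U>" "Cod C p \<in> \<S>" by (rule \<H>E[OF assms(1)])
  obtain i' p' U' where i': "(i', p') \<in> E" "i' \<in> Hom C B U'" "U' \<in> \<U>" "Cod C p' \<in> \<S>" by (rule \<H>E[OF assms(2)])
  obtain a1 a2 a3 a4 where a: "is_biprod C A B P a1 a2 a3 a4" using b by (auto simp: is_direct_sum_def)
  obtain R b1 b2 b3 b4 where b: "is_biprod C A U' R b1 b2 b3 b4"
    by (rule biprod_ex[of A U']) (use i i' in \<open>auto simp: Hom_iff\<close>)
  obtain R' where R': "R' \<in> \<U>" "is_direct_sum C U U' R'" using \<U>_sum i i' by blast
  then obtain c1 c2 c3 c4 where c: "is_biprod C U U' R' c1 c2 c3 c4" by (auto simp: is_direct_sum_def)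
  have UR: "is_biprod C (Cod C i) U' R' c1 c2 c3 c4" "is_biprod C (Dom C i) U' R b1 b2 b3 b4"
    using b c i by (simp_all add: Hom_iff)
  obtain q where q: "((c1 \<cdot> (i \<cdot> b3)) \<boxplus> (c2 \<cdot> b4), q) \<in> E" "Cod C q = Cod C p"
    by (rule ses_sum_right[OF i(1) UR(2,1)])
  have "(c1 \<cdot> (i \<cdot> b3)) \<boxplus> (c2 \<cdot> b4) \<in> Hom C R R'"
    using is_biprodD(1-4)[OF b] is_biprodD(1-4)[OF c] i(2) by (simp add: arith_simps)
  then have R: "R \<in> \<H>" using \<H>I[OF q(1)] q(2) i R' by (simp add: Hom_iff)
  have AR: "is_biprod C (Dom C i') A P a2 a1 a4 a3" "is_biprod C (Cod C i') A R b2 b1 b4 b3"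
    using is_biprod_sym[OF a] is_biprod_sym[OF b] i' by (simp_all add: Hom_iff)
  obtain q' where q': "((b2 \<cdot> (i' \<cdot> a4)) \<boxplus> (b1 \<cdot> a3), q') \<in> E" "Cod C q' = Cod C p'"
    by (rule ses_sum_right[OF i'(1) AR])
  have "(b2 \<cdot> (i' \<cdot> a4)) \<boxplus> (b1 \<cdot> a3) \<in> Hom C P R"
    using is_biprodD(1-4)[OF a] is_biprodD(1-4)[OF b] i'(2) by (simp add: arith_simps)
  then show ?thesis using \<H>_subobject[OF q'(1)] q'(2) R i' by (simp add: Hom_iff)
qed

sublocale core: heart_core C E \<H> \<U> \<S> \<V>
proof
  show "\<H> \<subseteq> Obj C" by (auto simp: B_minus_def)
  then show "\<H> \<subseteq> B_plus C E \<U> \<V>" unfolding B_plus_all .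
  show "\<exists>Z \<in> \<H>. is_zero_obj C Z" using \<U>_zero \<U>_\<H> by blast
  show "\<exists>P \<in> \<H>. is_direct_sum C A B P" if "A \<in> \<H>" "B \<in> \<H>" for A B
  proof -
    have "A \<in> Obj C" "B \<in> Obj C" using that by (auto simp: B_minus_def)
    then obtain P where "is_direct_sum C A B P" using ex_direct_sum by blast
    then show ?thesis using \<H>_sum that by blast
  qed
  show "extends_to C (\<U> \<union> \<V>) i" if "(i, p) \<in> E" "Cod C p \<in> \<S>" for i p
    using st.extends_to_\<V>[OF that] uv.extends_to_\<V>[OF that(1)] that \<S>_\<U> \<U>_\<T>
    unfolding extends_to_def by blast
  show "lifts_from C (\<U> \<union> \<S>) p" if "(j, p) \<in> E" "Dom C j \<in> \<V>" for j p
    using uv.lifts_from_\<U>[OF that] \<S>_\<U> unfolding lifts_from_def by blast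
qed (use \<U>_\<H> \<U>_zero \<U>_sum in auto)

abbreviation Q where "Q \<equiv> quot_cat (full_subcat C \<H>) \<U>"
abbreviation cl where "cl \<equiv> arr_class (full_subcat C \<H>) \<U>"
abbreviation null where "null \<equiv> factors_through C \<U>"

lemma cokernel_representative:
  assumes f: "f \<in> Hom C A B" "A \<in> \<H>" "B \<in> \<H>"
  obtains c q where "(c, q) \<in> E" "Cod C q \<in> \<S>" "Dom C c = B" "Cod C c \<in> \<H>" "is_cokernel_of Q (cl c) (cl f)"
proof -
  obtain i p U where i: "(i, p) \<in> E" "i \<in> Hom C A U" "U \<in> \<U>" "Cod C p \<in> \<S>" by (rule \<H>E[OF f(2)])
  obtain q \<gamma> c where po: "is_pushout C i f \<gamma> c" and c: "(c, q) \<in> E" "Cod C q = Cod C p"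
    by (rule ses_pushout_ex[OF i(1), of f]) (use i f in \<open>auto simp: Hom_iff\<close>)
  note pD = is_pushoutD[OF po]
  have D: "Dom C c = B" using pD f by (simp add: Hom_iff)
  have H: "Cod C c \<in> \<H>" using \<H>_extension[OF c(1)] c(2) i D f by simp
  have "is_cokernel_of Q (cl c) (cl f)"
    by (rule core.pushout_cokernel[OF po i(1)]) (use i f H in \<open>auto simp: Hom_iff\<close>)
  then show thesis using that c i D H by simp
qed

text \<open>\<open>\<H>\<close> is coreflective modulo null arrows: for \<open>Y \<rightarrowtail> T \<twoheadrightarrow> S\<close> and a deflation \<open>U \<twoheadrightarrow> T\<close> with kernel in
  \<open>\<V>\<close>, the pullback \<open>X\<close> of \<open>U\<close> to \<open>Y\<close> has a short exact sequence \<open>X \<rightarrowtail> U \<twoheadrightarrow> S\<close>.\<close>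

lemma coreflection:
  assumes Y: "Y \<in> Obj C"
  obtains r j where "(j, r) \<in> E" "Dom C j \<in> \<V>" "r \<in> Hom C (Dom C r) Y" "Dom C r \<in> \<H>"
    "lifts_from C \<H> r" "\<And>h Z. h \<in> Hom C Z (Dom C r) \<Longrightarrow> Z \<in> \<H> \<Longrightarrow> null (r \<cdot> h) \<Longrightarrow> null h"
proof -
  obtain i p where i: "(i, p) \<in> E" "Dom C i = Y" "Cod C i \<in> \<T>" "Cod C p \<in> \<S>" using st.\<V>_hull[OF Y] by blast
  note iD = E_D[OF i(1)]
  have "Cod C i \<in> Obj C" by (rule Cod_closed[OF iD(1)])
  then obtain j u where u: "(j, u) \<in> E" "Cod C u = Cod C i" "Dom C u \<in> \<U>" "Dom C j \<in> \<V>"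
    using uv.\<U>_cover by blast
  note uD = E_D[OF u(1)]
  have lift_u: "lifts_from C \<U> u" by (rule uv.lifts_from_\<U>[OF u(1,4)])
  obtain j' r s where pb: "is_pullback C r s i u" and j': "(j', r) \<in> E" "Dom C j' = Dom C j"
    by (rule ses_pullback_ex[OF u(1), of i]) (use iD u in auto)
  note pD = is_pullbackD[OF pb]
  have s: "(s, p \<cdot> u) \<in> E" by (rule ses_Cmp_deflation[OF u(1) i(1) pb])
  have r: "r \<in> Hom C (Dom C r) Y" using pD i by (simp add: Hom_iff Dom_closed Y)
  have "Dom C s \<in> \<H>" using \<H>I[OF s] pD(1-7) u iD i(4) by (simp add: cat_simps)
  then have H: "Dom C r \<in> \<H>" using pD by simp
  have "lifts_from C \<H> r" unfolding lifts_from_def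
  proof (intro ballI)
    fix Z z assume Z: "Z \<in> \<H>" and z: "z \<in> Hom C Z (Cod C r)"
    obtain a q U where a: "(a, q) \<in> E" "a \<in> Hom C Z U" "U \<in> \<U>" "Cod C q \<in> \<S>" by (rule \<H>E[OF Z])
    have iz: "i \<cdot> z \<in> Hom C Z (Cod C i)" using z pD iD by (simp add: cat_simps)
    obtain y where y: "y \<in> Hom C U (Cod C i)" "y \<cdot> a = i \<cdot> z"
      by (rule extends_toE[OF st.extends_to_\<V>[OF a(1,4)] i(3) a(2) iz])
    have u': "u \<in> Hom C (Dom C u) (Cod C i)" using uD u(2) Cod_closed[OF iD(1)] by (simp add: Hom_iff Dom_closed)
    obtain w where w: "w \<in> Hom C U (Dom C u)" "u \<cdot> w = y" by (rule lifts_fromE[OF lift_u a(3) u' y(1)])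
    have "u \<cdot> (w \<cdot> a) = y \<cdot> a" by (rule Cmp_cong_right1[OF w(2)]) (use w a u' in \<open>auto simp: Hom_iff\<close>)
    then have eq: "i \<cdot> z = u \<cdot> (w \<cdot> a)" using y by simp
    obtain t where "t \<in> Arr C" "Dom C t = Dom C (w \<cdot> a)" "Cod C t = Dom C r" "r \<cdot> t = z" "s \<cdot> t = w \<cdot> a"
      by (rule pullback_ex[OF pb _ _ _ _ _ eq]) (use z w a pD in \<open>simp_all add: cat_simps\<close>)
    then show "\<exists>t \<in> Hom C Z (Dom C r). r \<cdot> t = z"
      using w a pD by (intro bexI[of _ t]) (simp_all add: cat_simps)
  qed
  moreover have "null h" if h: "h \<in> Hom C Z (Dom C r)" "Z \<in> \<H>" "null (r \<cdot> h)" for h Z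
  proof (rule core.null_pullback_cancel[OF is_pullback_sym[OF pb] _ h(2)])
    show "lifts_from C \<S> u" using lift_u \<S>_\<U> unfolding lifts_from_def by blast
    have "s \<cdot> h \<in> Hom C Z (Dom C u)" using h pD by (simp add: cat_simps)
    then show "null (s \<cdot> h)" using core.null_to u(3) by blast
  qed (use h pD in auto)
  ultimately show thesis using that j' u r H by simp
qed

text \<open>The pullback \<open>K\<close> of a deflation \<open>U \<twoheadrightarrow> B\<close> along \<open>f\<close> has the universal property of a kernel, but is
  not in \<open>\<H>\<close> in general; its coreflection is.\<close>

lemma kernel_representative:
  assumes f: "f \<in> Hom C A B" "A \<in> \<H>" "B \<in> \<H>"
  obtains k v where "(v, k) \<in> E" "Dom C v \<in> \<V>" "Cod C k = A" "Dom C k \<in> \<H>" "is_kernel_of Q (cl k) (cl f)"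
proof -
  have BO: "B \<in> Obj C" using f by (simp add: Hom_iff)
  obtain j u where u: "(j, u) \<in> E" "Cod C u = B" "Dom C u \<in> \<U>" "Dom C j \<in> \<V>" using uv.\<U>_cover[OF BO] by blast
  note uD = E_D[OF u(1)]
  have lift_u: "lifts_from C \<U> u" by (rule uv.lifts_from_\<U>[OF u(1,4)])
  have u': "u \<in> Hom C (Dom C u) B" using uD u BO by (simp add: Hom_iff Dom_closed)
  obtain j' k s where pb: "is_pullback C k s f u" and j': "(j', k) \<in> E" "Dom C j' = Dom C j"
    by (rule ses_pullback_ex[OF u(1), of f]) (use f u in \<open>auto simp: Hom_iff\<close>)
  note pD = is_pullbackD[OF pb] and jD = E_D[OF j'(1)]
  have k: "k \<in> Hom C (Dom C k) A" using pD f by (simp add: Hom_iff Dom_closed)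
  obtain r l where l: "(l, r) \<in> E" "Dom C l \<in> \<V>" and r: "r \<in> Hom C (Dom C r) (Dom C k)" and H: "Dom C r \<in> \<H>"
    and lift_r: "lifts_from C \<H> r" and uniq: "\<And>h Z. h \<in> Hom C Z (Dom C r) \<Longrightarrow> Z \<in> \<H> \<Longrightarrow> null (r \<cdot> h) \<Longrightarrow> null h"
    by (rule coreflection[of "Dom C k"]) (use k in \<open>auto simp: Hom_iff\<close>)
  obtain l' a b where pb': "is_pullback C a b j' r" and l': "(l', a) \<in> E" "Dom C l' = Dom C l"
    by (rule ses_pullback_ex[OF l(1), of j']) (use jD r in \<open>auto simp: Hom_iff\<close>)
  note pD' = is_pullbackD[OF pb']
  have v: "(b, k \<cdot> r) \<in> E" by (rule ses_Cmp_deflation[OF l(1) j'(1) pb'])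
  have "Cod C l' \<in> \<V>"
    by (rule uv.\<V>_extension[OF l'(1)]) (use l' l j' u pD' in auto)
  then have bV: "Dom C b \<in> \<V>" using pD' E_D(3)[OF l'(1)] by simp
  have kr: "k \<cdot> r \<in> Hom C (Dom C r) A" using k r by (simp add: cat_simps)
  have s: "s \<in> Hom C (Dom C k) (Dom C u)" using pD by (simp add: Hom_iff Dom_closed)
  have "is_kernel_of Q (cl (k \<cdot> r)) (cl f)"
  proof (rule core.Q_kernelI[OF kr H f])
    have sr: "s \<cdot> r \<in> Hom C (Dom C r) (Dom C u)" using s r by (simp add: cat_simps)
    have "f \<cdot> (k \<cdot> r) = u \<cdot> (s \<cdot> r)" by (rule Cmp_cong_right[OF pD(9)]) (use pD r in \<open>auto simp: Hom_iff\<close>)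
    then show "null (f \<cdot> (k \<cdot> r))" using core.ambient.nullI[OF sr u' u(3)] by simp
  next
    fix x Z assume x: "x \<in> Hom C Z A" "Z \<in> \<H>" "null (f \<cdot> x)"
    have "f \<cdot> x \<in> Hom C Z B" using x f by (simp add: cat_simps)
    then obtain W y z where W: "W \<in> \<U>" "y \<in> Hom C Z W" "z \<in> Hom C W B" "f \<cdot> x = z \<cdot> y"
      by (rule core.ambient.nullE[OF x(3)])
    obtain w where w: "w \<in> Hom C W (Dom C u)" "u \<cdot> w = z" by (rule lifts_fromE[OF lift_u W(1) u' W(3)])
    have "u \<cdot> (w \<cdot> y) = z \<cdot> y" by (rule Cmp_cong_right1[OF w(2)]) (use w W u' in \<open>auto simp: Hom_iff\<close>)
    then have eq: "f \<cdot> x = u \<cdot> (w \<cdot> y)" using W by simp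
    obtain t where t: "t \<in> Arr C" "Dom C t = Dom C (w \<cdot> y)" "Cod C t = Dom C k" "k \<cdot> t = x" "s \<cdot> t = w \<cdot> y"
      by (rule pullback_ex[OF pb _ _ _ _ _ eq]) (use x f w W u' in \<open>simp_all add: cat_simps\<close>)
    have t': "t \<in> Hom C Z (Dom C k)" using t(1-3) w W k by (simp add: cat_simps)
    obtain t2 where t2: "t2 \<in> Hom C Z (Dom C r)" "r \<cdot> t2 = t"
      by (rule lifts_fromE[OF lift_r x(2) r t'])
    have "(k \<cdot> r) \<cdot> t2 = x" using t2 k r t by (simp add: cat_simps)
    then show "\<exists>u \<in> Hom C Z (Dom C r). null (((k \<cdot> r) \<cdot> u) \<boxplus> Neg C x)"
      using t2(1) x(1) by (intro bexI[of _ t2]) (simp_all add: Hom_iff Neg_right core.ambient.null_Zer)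
  next
    fix h Z assume h: "h \<in> Hom C Z (Dom C r)" "Z \<in> \<H>" "null ((k \<cdot> r) \<cdot> h)"
    have rh: "r \<cdot> h \<in> Hom C Z (Dom C s)" using r h pD by (simp add: cat_simps)
    have "null (r \<cdot> h)"
    proof (rule core.null_pullback_cancel[OF is_pullback_sym[OF pb] _ h(2) rh])
      show "lifts_from C \<S> u" using lift_u \<S>_\<U> unfolding lifts_from_def by blast
      have "s \<cdot> (r \<cdot> h) \<in> Hom C Z (Dom C u)" using rh s by (simp add: cat_simps)
      then show "null (s \<cdot> (r \<cdot> h))" using core.null_to u(3) by blast
      show "null (k \<cdot> (r \<cdot> h))" using h k r by (simp add: cat_simps)
    qed
    then show "null h" using uniq h by blast
  qed
  then show thesis using that[OF v bV] kr H by (simp add: Hom_iff)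
qed

lemma iso_projection:
  assumes b: "is_biprod C B U P \<iota> \<kappa> \<pi> \<rho>" and H: "B \<in> \<H>" "U \<in> \<U>" "P \<in> \<H>"
  shows "is_iso Q (cl \<pi>)" "is_iso Q (cl \<iota>)"
proof -
  note bD = is_biprodD[OF b]
  have "null (\<kappa> \<cdot> \<rho>)" by (rule core.ambient.nullI[OF bD(4,2) H(2)])
  moreover have "\<kappa> \<cdot> \<rho> = Ide C P \<boxplus> Neg C (\<iota> \<cdot> \<pi>)"
    unfolding bD(9)[symmetric] using bD(1-4) by (simp add: arith_simps)
  moreover have "Ide C P \<in> Hom C P P" "\<iota> \<cdot> \<pi> \<in> Hom C P P" using bD(1-4) by (simp_all add: cat_simps)
  ultimately have "cl (Ide C P) = cl (\<iota> \<cdot> \<pi>)" using core.cl_eq_iff[of "Ide C P" P P] H by simp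
  then have eq: "cl \<iota> \<cdot>\<^bsub>Q\<^esub> cl \<pi> = cl (Ide C P)" "cl \<pi> \<cdot>\<^bsub>Q\<^esub> cl \<iota> = cl (Ide C B)"
    using core.cl_Cmp[OF bD(3,1) H(3,1,3)] core.cl_Cmp[OF bD(1,3) H(1,3,1)] bD(5) by simp_all
  note D = core.cl_Dom[OF bD(3) H(3,1)] core.cl_Dom[OF bD(1) H(1,3)]
  show "is_iso Q (cl \<pi>)" by (rule is_isoI[of _ _ "cl \<iota>"]) (use D eq in simp_all)
  show "is_iso Q (cl \<iota>)" by (rule is_isoI[of _ _ "cl \<pi>"]) (use D eq in simp_all)
qed

lemma inflation_cokernel:
  assumes "(c, q) \<in> E" "Cod C q \<in> \<S>" "Dom C c \<in> \<H>" "Cod C c \<in> \<H>"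
  shows "is_cokernel Q (cl c)"
  using assms by (rule core.inflation_cokernel)

lemma deflation_kernel:
  assumes "(v, k) \<in> E" "Dom C v \<in> \<V>" "Cod C k \<in> \<H>" "Dom C k \<in> \<H>"
  shows "is_kernel Q (cl k)"
proof (rule core.deflation_kernel[OF assms])
  show "Cod C a \<in> \<H>" if "(a, q) \<in> E" "Cod C q \<in> \<S>" "Dom C a = Cod C k" for a q
    using \<H>_extension[OF that(1) _ that(2)] that(3) assms(3) by simp
qed

text \<open>The pullback of \<open>c\<close> along a deflation \<open>g : P \<twoheadrightarrow> D\<close> is the kernel of \<open>P \<twoheadrightarrow> D \<twoheadrightarrow> S\<close>, so it is
  again an inflation with cokernel \<open>S\<close>.\<close>

lemma pullback_inflation:
  assumes c: "(c, q) \<in> E" "Cod C q \<in> \<S>" "Dom C c \<in> \<H>" "Cod C c \<in> \<H>"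
    and f: "f \<in> Hom C B (Cod C c)" "B \<in> \<H>"
  shows "\<exists>\<alpha> \<beta>. is_pullback Q \<alpha> \<beta> (cl f) (cl c) \<and> is_cokernel Q \<alpha>"
proof -
  interpret Q: preadditive_category Q by (rule core.sub.preadditive_Q)
  have c': "c \<in> Hom C (Dom C c) (Cod C c)" using E_D[OF c(1)] by (simp add: Hom_def)
  obtain U P \<iota> \<kappa> \<pi> \<rho> j g \<delta> \<gamma> where h: "U \<in> \<U>" "is_biprod C B U P \<iota> \<kappa> \<pi> \<rho>" "(j, g) \<in> E" "g \<in> Hom C P (Cod C c)"
    "is_pullback C \<delta> \<gamma> c g"
    "Dom C \<delta> \<in> \<H> \<longrightarrow> is_pullback Q (cl (\<pi> \<cdot> \<gamma>)) (cl \<delta>) (cl f) (cl c)"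
    by (rule core.pullback_construction[OF f(1) c' c(4) f(2) c(3)])
  note pD = is_pullbackD[OF h(5)] and bD = is_biprodD[OF h(2)]
  have P: "P \<in> \<H>" using \<H>_sum[OF f(2) _ , of U P] h(1,2) \<U>_\<H> unfolding is_direct_sum_def by blast
  have \<gamma>E: "(\<gamma>, q \<cdot> g) \<in> E" by (rule ses_Cmp_deflation[OF h(3) c(1) h(5)])
  have \<gamma>: "\<gamma> \<in> Hom C (Dom C \<gamma>) P" using pD h(4) by (simp add: Hom_iff Dom_closed)
  have qg: "Cod C (q \<cdot> g) \<in> \<S>" using E_D[OF c(1)] c(2) h(4) by (simp add: cat_simps)
  have H: "Dom C \<gamma> \<in> \<H>" using \<H>_subobject[OF \<gamma>E] \<gamma> P qg by (simp add: Hom_iff)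
  have "is_cokernel Q (cl \<gamma>)" by (rule inflation_cokernel[OF \<gamma>E qg H]) (use \<gamma> P in \<open>simp add: Hom_iff\<close>)
  then obtain F where "is_cokernel_of Q (cl \<gamma>) F" by (auto simp: is_cokernel_def)
  then have "is_cokernel_of Q (cl \<pi> \<cdot>\<^bsub>Q\<^esub> cl \<gamma>) F"
    by (rule Q.cokernel_iso[OF _ iso_projection(1)[OF h(2) f(2) h(1) P]])
      (use core.cl_Dom[OF \<gamma> H P] core.cl_Dom[OF bD(3) P f(2)] in simp)
  then have "is_cokernel Q (cl (\<pi> \<cdot> \<gamma>))"
    using core.cl_Cmp[OF \<gamma> bD(3) H P f(2)] by (auto simp: is_cokernel_def)
  then show ?thesis using h(6) H pD by auto
qed

text \<open>The pushout of \<open>k\<close> along an inflation \<open>(f, i)\<close> is a cokernel of \<open>V \<rightarrowtail> A \<rightarrowtail> B \<oplus> U\<close>, so it is again a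
  deflation with kernel \<open>V\<close>.\<close>

lemma pushout_deflation:
  assumes k: "(v, k) \<in> E" "Dom C v \<in> \<V>" "Cod C k \<in> \<H>" "Dom C k \<in> \<H>"
    and f: "f \<in> Hom C (Dom C k) B" "B \<in> \<H>"
  shows "\<exists>\<gamma> \<delta>. is_pushout Q (cl k) (cl f) \<gamma> \<delta> \<and> is_kernel Q \<delta>"
proof -
  interpret Q: preadditive_category Q by (rule core.sub.preadditive_Q)
  have k': "k \<in> Hom C (Dom C k) (Cod C k)" using E_D[OF k(1)] by (simp add: Hom_def)
  obtain i p U P \<iota> \<kappa> \<pi> \<rho> n \<gamma> \<delta> R \<theta> q where h: "(i, p) \<in> E" "i \<in> Hom C (Dom C k) U" "U \<in> \<U>" "Cod C p \<in> \<S>"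
    "is_biprod C B U P \<iota> \<kappa> \<pi> \<rho>" "((\<iota> \<cdot> f) \<boxplus> (\<kappa> \<cdot> i), n) \<in> E"
    "is_pushout C ((\<iota> \<cdot> f) \<boxplus> (\<kappa> \<cdot> i)) k \<gamma> \<delta>"
    "is_direct_sum C B (Cod C k) R" "(\<theta>, q) \<in> E" "\<theta> \<in> Hom C R (Cod C \<delta>)" "Cod C q \<in> \<S>"
    "Cod C \<delta> \<in> \<H> \<longrightarrow> is_pushout Q (cl f) (cl k) (cl (\<gamma> \<cdot> \<iota>)) (cl \<delta>)"
    by (rule core.pushout_construction[OF f(1) k' k(4) f(2) k(3)])
  note pD = is_pushoutD[OF h(7)] and bD = is_biprodD[OF h(5)]
  have P: "P \<in> \<H>" using \<H>_sum[OF f(2) _ , of U P] h(3,5) \<U>_\<H> unfolding is_direct_sum_def by blast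
  have "R \<in> \<H>" by (rule \<H>_sum[OF f(2) k(3) h(8)])
  then have H: "Cod C \<delta> \<in> \<H>" using \<H>_extension[OF h(9)] h(10,11) by (simp add: Hom_iff)
  have \<gamma>E: "(((\<iota> \<cdot> f) \<boxplus> (\<kappa> \<cdot> i)) \<cdot> v, \<gamma>) \<in> E" by (rule ses_Cmp_inflation[OF h(6) k(1) h(7)])
  have \<alpha>': "(\<iota> \<cdot> f) \<boxplus> (\<kappa> \<cdot> i) \<in> Hom C (Dom C k) P" using f h(2) bD(1-4) by (simp add: arith_simps)
  have \<gamma>: "\<gamma> \<in> Hom C P (Cod C \<delta>)" using pD \<alpha>' by (simp add: Hom_iff Cod_closed)
  have "is_kernel Q (cl \<gamma>)"
  proof (rule deflation_kernel[OF \<gamma>E])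
    show "Dom C (((\<iota> \<cdot> f) \<boxplus> (\<kappa> \<cdot> i)) \<cdot> v) \<in> \<V>" using \<alpha>' E_D[OF k(1)] k(2) by (simp add: cat_simps)
  qed (use \<gamma> H P in \<open>simp_all add: Hom_iff\<close>)
  then obtain F where "is_kernel_of Q (cl \<gamma>) F" by (auto simp: is_kernel_def)
  then have "is_kernel_of Q (cl \<gamma> \<cdot>\<^bsub>Q\<^esub> cl \<iota>) F"
    by (rule Q.kernel_iso[OF _ iso_projection(2)[OF h(5) f(2) h(3) P]])
      (use core.cl_Dom[OF \<gamma> P H] core.cl_Dom[OF bD(1) f(2) P] in simp)
  then have "is_kernel Q (cl (\<gamma> \<cdot> \<iota>))"
    using core.cl_Cmp[OF bD(1) \<gamma> f(2) P H] by (auto simp: is_kernel_def)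
  then show ?thesis using is_pushout_sym[OF h(12)[rule_format, OF H]] by blast
qed

text \<open>Let \<open>\<delta> x\<close> be null; it extends to \<open>d : W \<rightarrow> D\<close> for \<open>Z \<rightarrowtail> W \<twoheadrightarrow> S\<close>, and \<open>d\<close> induces \<open>e : S \<rightarrow> N\<close>, where
  \<open>N\<close> is the common cokernel of \<open>a = (f, i) : A \<rightarrowtail> P\<close> and of its pushout \<open>\<delta>\<close>. If \<open>e\<close> lifts to \<open>P\<close>,
  then \<open>d\<close> can be corrected to factor through \<open>\<delta>\<close>, and \<open>x\<close> factors through \<open>W\<close>.

  The obstruction is the extension \<open>A \<rightarrowtail> T \<twoheadrightarrow> S\<close> pulled back from \<open>P\<close>. It is the pushout of an extension
  \<open>Y \<rightarrowtail> V \<twoheadrightarrow> S\<close> with \<open>V \<in> \<U>\<close>, thus \<open>Y \<in> \<H>\<close>, along some \<open>z : Y \<rightarrow> A\<close>. As \<open>T\<close> maps to \<open>P\<close> over \<open>A\<close>, \<open>f z\<close>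
  is null; as \<open>f\<close> is monic in the heart, \<open>z\<close> is null, and the extension splits.\<close>

lemma pushout_mono:
  assumes f: "f \<in> Hom C A B" "A \<in> \<H>" "B \<in> \<H>" and m: "is_mono Q (cl f)"
    and g: "g \<in> Hom C A B'" "B' \<in> \<H>"
  shows "\<exists>\<gamma> \<delta>. is_comm_square Q (cl f) (cl g) \<gamma> \<delta> \<and> is_mono Q \<delta>"
proof -
  obtain i p U P \<iota> \<kappa> \<pi> \<rho> n \<gamma> \<delta> R \<theta> q where h: "(i, p) \<in> E" "i \<in> Hom C A U" "U \<in> \<U>" "Cod C p \<in> \<S>"
    "is_biprod C B U P \<iota> \<kappa> \<pi> \<rho>" "((\<iota> \<cdot> f) \<boxplus> (\<kappa> \<cdot> i), n) \<in> E"
    "is_pushout C ((\<iota> \<cdot> f) \<boxplus> (\<kappa> \<cdot> i)) g \<gamma> \<delta>"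
    "is_direct_sum C B B' R" "(\<theta>, q) \<in> E" "\<theta> \<in> Hom C R (Cod C \<delta>)" "Cod C q \<in> \<S>"
    "Cod C \<delta> \<in> \<H> \<longrightarrow> is_pushout Q (cl f) (cl g) (cl (\<gamma> \<cdot> \<iota>)) (cl \<delta>)"
    by (rule core.pushout_construction[OF f(1) g(1) f(2,3) g(2)])
  note pD = is_pushoutD[OF h(7)] and bD = is_biprodD[OF h(5)] and bS = biprod_simps[OF h(5)]
  have "R \<in> \<H>" by (rule \<H>_sum[OF f(3) g(2) h(8)])
  then have H: "Cod C \<delta> \<in> \<H>" using \<H>_extension[OF h(9)] h(10,11) by (simp add: Hom_iff)
  define a where "a = (\<iota> \<cdot> f) \<boxplus> (\<kappa> \<cdot> i)"
  have a: "a \<in> Hom C A P" and \<pi>a: "\<pi> \<cdot> a = f" using f h(2) bD bS by (simp_all add: a_def arith_simps)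
  have n: "(a, n) \<in> E" and po: "is_pushout C a g \<gamma> \<delta>" using h(6,7) by (simp_all add: a_def)
  define D N where "D = Cod C \<delta>" and "N = Cod C n"
  have \<gamma>: "\<gamma> \<in> Hom C P D" and \<delta>: "\<delta> \<in> Hom C B' D" using pD a g by (simp_all add: D_def a_def Hom_iff Cod_closed)
  have n': "n \<in> Hom C P N" using E_D[OF n] a by (simp add: N_def Hom_iff Cod_closed)
  obtain m where m': "(\<delta>, m) \<in> E" "Cod C m = N" "m \<cdot> \<gamma> = n" unfolding N_def by (rule ses_pushout[OF po n])
  have mH: "m \<in> Hom C D N" using E_D[OF m'(1)] m'(2) n' by (simp add: D_def Hom_iff Dom_closed)
  have "is_mono Q (cl \<delta>)"
  proof (rule core.Q_monoI[OF \<delta> g(2) H[folded D_def]])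
    fix x Z assume x: "x \<in> Hom C Z B'" "Z \<in> \<H>" "null (\<delta> \<cdot> x)"
    obtain iZ pZ W where Z: "(iZ, pZ) \<in> E" "iZ \<in> Hom C Z W" "W \<in> \<U>" "Cod C pZ \<in> \<S>" by (rule \<H>E[OF x(2)])
    define S where "S = Cod C pZ"
    have pZ: "pZ \<in> Hom C W S" and S: "S \<in> \<S>" using E_D[OF Z(1)] Z(2,4) by (simp_all add: S_def Hom_iff Cod_closed)
    have \<delta>x: "\<delta> \<cdot> x \<in> Hom C Z D" using \<delta> x by (simp add: cat_simps)
    obtain d where d: "d \<in> Hom C W D" "d \<cdot> iZ = \<delta> \<cdot> x" by (rule core.null_extends[OF x(3) \<delta>x Z(1,2,4)])
    have m\<delta>: "m \<cdot> (\<delta> \<cdot> y) = Zer C (Dom C y) N" if "y \<in> Arr C" "Cod C y = B'" for y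
      using Cmp_cong_right1[OF E_D(4)[OF m'(1)], of y] that mH \<delta> by (simp add: arith_simps)
    have md: "(m \<cdot> d) \<cdot> iZ = Zer C (Dom C iZ) (Cod C (m \<cdot> d))"
      using m\<delta>[of x] d x mH Z(2) by (simp add: cat_simps)
    obtain e where e: "e \<in> Arr C" "Dom C e = Cod C pZ" "Cod C e = Cod C (m \<cdot> d)" "e \<cdot> pZ = m \<cdot> d"
      by (rule cokernel_ex[OF E_cokernel[OF Z(1)] _ _ md]) (use d mH Z(2) in \<open>simp_all add: cat_simps\<close>)
    have e': "e \<in> Hom C S N" using e(1-3) d mH pZ by (simp add: S_def cat_simps)
    \<comment> \<open>It suffices to lift \<open>e\<close> to \<open>P\<close>; the pullback extension of \<open>S\<close> by \<open>A\<close> along \<open>e\<close> splits because \<open>f\<close>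
      is monic.\<close>
    obtain l c y where pb: "is_pullback C c y e n" and l: "(l, c) \<in> E" "Dom C l = Dom C a" "y \<cdot> l = a"
      by (rule ses_pullback_ex[OF n, of e]) (use e' n' in \<open>auto simp: Hom_iff\<close>)
    note qD = is_pullbackD[OF pb] and lD = E_D[OF l(1)]
    define T where "T = Dom C c"
    have c: "c \<in> Hom C T S" and y: "y \<in> Hom C T P" and l': "l \<in> Hom C A T"
      using qD lD l(2) e' n' a by (simp_all add: T_def Hom_iff Dom_closed)
    obtain w b where b: "(w, b) \<in> E" "Cod C b = T" "Dom C b \<in> \<U>" "Dom C w \<in> \<V>"
      using uv.\<U>_cover[of T] c by (auto simp: Hom_iff)
    define V where "V = Dom C b"
    have b': "b \<in> Hom C V T" using E_D[OF b(1)] b(2) c by (simp add: V_def Hom_iff Dom_closed)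
    obtain z z' where pb2: "is_pullback C z z' l b"
      by (rule ses_pullback_ex[OF b(1), of l]) (use b' l' in \<open>auto simp: Hom_iff\<close>)
    note zD = is_pullbackD[OF pb2]
    have z'E: "(z', c \<cdot> b) \<in> E" by (rule ses_Cmp_deflation[OF b(1) l(1) pb2])
    define Y where "Y = Dom C z'"
    have z': "z' \<in> Hom C Y V" and z: "z \<in> Hom C Y A" using zD b' l' by (simp_all add: Y_def Hom_iff Dom_closed)
    have cb: "Cod C (c \<cdot> b) \<in> \<S>" "c \<cdot> b \<in> Hom C V S" using c b' S by (simp_all add: cat_simps)
    have Y: "Y \<in> \<H>" using \<H>I[OF z'E _ cb(1)] z' b(3) by (simp add: Y_def V_def Hom_iff)
    have "f \<cdot> z = \<pi> \<cdot> (a \<cdot> z)" by (rule Cmp_cong_right1[OF \<pi>a, symmetric]) (use bD a z in \<open>auto simp: Hom_iff\<close>)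
    also have "a \<cdot> z = y \<cdot> (l \<cdot> z)" by (rule Cmp_cong_right1[OF l(3), symmetric]) (use y l' z in \<open>auto simp: Hom_iff\<close>)
    also have "l \<cdot> z = b \<cdot> z'" by (rule zD)
    also have "\<pi> \<cdot> (y \<cdot> (b \<cdot> z')) = (\<pi> \<cdot> (y \<cdot> b)) \<cdot> z'" using bD(1-4) y b' z' by (simp add: cat_simps)
    also have "null \<dots>"
      by (rule core.ambient.nullI[OF z', of _ B]) (use bD(1-4) y b' b(3) in \<open>simp_all add: cat_simps V_def\<close>)
    finally have "null (f \<cdot> z)" .
    then have "null z" by (rule core.Q_monoD[OF m f z Y])
    then obtain t where t: "t \<in> Hom C V A" "t \<cdot> z' = z" by (rule core.null_extends[OF _ z z'E z' cb(1)])
    let ?b = "b \<boxplus> Neg C (l \<cdot> t)"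
    have bt: "?b \<in> Hom C V T" using b' l' t by (simp add: arith_simps)
    have "?b \<cdot> z' = (b \<cdot> z') \<boxplus> Neg C (l \<cdot> (t \<cdot> z'))" using b' l' t(1) z' by (simp add: cat_simps Neg_cat Cmp_Sum_L Cmp_Neg_L)
    also have "\<dots> = Zer C (Dom C z') (Cod C ?b)" unfolding t zD(9)[symmetric] using bt l' z z' by (simp add: arith_simps)
    finally have bz: "?b \<cdot> z' = Zer C (Dom C z') (Cod C ?b)" .
    obtain s where s: "s \<in> Arr C" "Dom C s = Cod C (c \<cdot> b)" "Cod C s = Cod C ?b" "s \<cdot> (c \<cdot> b) = ?b"
      by (rule cokernel_ex[OF E_cokernel[OF z'E] _ _ bz]) (use bt z' in \<open>simp_all add: Hom_iff\<close>)
    have s': "s \<in> Hom C S T" using s(1-3) cb bt by (simp add: Hom_iff)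
    have cl0: "c \<cdot> (l \<cdot> t) = Zer C V S" using Cmp_cong_right1[OF lD(4), of t] c l' t(1) by (simp add: arith_simps)
    have "(c \<cdot> s) \<cdot> (c \<cdot> b) = c \<cdot> ?b" using s c b' s' cb(2) by (simp add: assoc Hom_iff)
    also have "\<dots> = Ide C S \<cdot> (c \<cdot> b)" using c b' l' t(1) cl0 by (simp add: arith_simps)
    finally have cs: "c \<cdot> s = Ide C S"
      by - (rule epi_cancel[OF E_D(6)[OF z'E]], use c s' cb(2) in \<open>simp_all add: cat_simps\<close>)
    have ys: "y \<cdot> s \<in> Hom C S P" using y s' by (simp add: cat_simps)
    have "n \<cdot> (y \<cdot> s) = e \<cdot> (c \<cdot> s)" by (rule Cmp_cong_right[OF qD(9)[symmetric]]) (use y s' c e' n' in \<open>auto simp: Hom_iff\<close>)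
    then have ne: "n \<cdot> (y \<cdot> s) = e" unfolding cs using e' by (simp add: cat_simps)
    let ?d = "d \<boxplus> Neg C (\<gamma> \<cdot> ((y \<cdot> s) \<cdot> pZ))"
    have dd: "?d \<in> Hom C W D" using d(1) \<gamma> ys pZ by (simp add: arith_simps)
    have "m \<cdot> (\<gamma> \<cdot> ((y \<cdot> s) \<cdot> pZ)) = n \<cdot> ((y \<cdot> s) \<cdot> pZ)"
      by (rule Cmp_cong_right1[OF m'(3)]) (use mH \<gamma> ys pZ in \<open>auto simp: cat_simps\<close>)
    also have "\<dots> = e \<cdot> pZ" by (rule Cmp_cong_right1[OF ne]) (use n' ys pZ in \<open>auto simp: Hom_iff\<close>)
    finally have md0: "m \<cdot> ?d = Zer C (Dom C ?d) (Cod C m)"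
      unfolding e(4) using dd d(1) mH \<gamma> ys pZ e(4) by (simp add: cat_simps Neg_cat Cmp_Sum_R Cmp_Neg_R Neg_right)
    obtain t' where t': "t' \<in> Arr C" "Dom C t' = Dom C ?d" "Cod C t' = Dom C \<delta>" "\<delta> \<cdot> t' = ?d"
      by (rule kernel_ex[OF E_kernel[OF m'(1)] _ _ md0]) (use dd mH in \<open>simp_all add: Hom_iff\<close>)
    have t'H: "t' \<in> Hom C W B'" using t'(1-3) dd \<delta> by (simp add: Hom_iff)
    have pi0: "(y \<cdot> s) \<cdot> (pZ \<cdot> iZ) = Zer C Z P" unfolding E_D(4)[OF Z(1)] using ys Z(2) pZ by (simp add: arith_simps S_def)
    have "\<delta> \<cdot> (t' \<cdot> iZ) = ?d \<cdot> iZ" by (rule Cmp_cong_right1[OF t'(4)]) (use t'H \<delta> Z(2) in \<open>auto simp: Hom_iff\<close>)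
    also have "\<dots> = (d \<cdot> iZ) \<boxplus> Neg C (\<gamma> \<cdot> ((y \<cdot> s) \<cdot> (pZ \<cdot> iZ)))"
      using d(1) \<gamma> ys pZ Z(2) by (simp add: cat_simps Neg_cat Cmp_Sum_L Cmp_Neg_L)
    also have "\<dots> = \<delta> \<cdot> x" unfolding pi0 d using \<gamma> \<delta>x by (simp add: arith_simps)
    finally have "t' \<cdot> iZ = x"
      by - (rule mono_cancel[OF E_D(5)[OF m'(1)]], use t'H x(1) \<delta> Z(2) in \<open>simp_all add: cat_simps\<close>)
    then show "null x" using core.ambient.nullI[OF Z(2) t'H Z(3)] by simp
  qed
  then show ?thesis using pushout_comm_square[OF h(12)[rule_format, OF H]] by blast
qed

theorem integral_almost_abelian: "integral_category Q \<and> almost_abelian_category Q"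
proof -
  interpret Q: additive_category Q by (rule core.sub.additive_Q)
  show ?thesis
  proof (rule Q.integral_almost_abelianI)
    fix F assume F: "F \<in> Arr Q"
    obtain f A B where f: "f \<in> Hom C A B" "A \<in> \<H>" "B \<in> \<H>" "F = cl f" by (rule core.Arr_QE[OF F])
    obtain c q where c: "(c, q) \<in> E" "Cod C q \<in> \<S>" "Dom C c = B" "Cod C c \<in> \<H>" "is_cokernel_of Q (cl c) F"
      using cokernel_representative[OF f(1-3)] f(4) by metis
    have c': "c \<in> Hom C B (Cod C c)" using E_D[OF c(1)] c(3) by (simp add: Hom_def)
    have "\<exists>\<alpha> \<beta>. is_pullback Q \<alpha> \<beta> G (cl c) \<and> is_cokernel Q \<alpha>"
      if G: "G \<in> Arr Q" "Cod Q G = Cod Q (cl c)" for G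
    proof -
      obtain g Z where "g \<in> Hom C Z (Cod C c)" "Z \<in> \<H>" "G = cl g"
        using core.Arr_QE[OF G(1)] G(2) core.cl_Dom(3)[OF c' f(3) c(4)] by metis
      then show ?thesis using pullback_inflation[OF c(1,2) _ c(4)] c(3) f(3) by simp
    qed
    then show "\<exists>c. is_cokernel_of Q c F \<and> (\<forall>\<gamma> \<in> Arr Q. Cod Q \<gamma> = Cod Q c \<longrightarrow>
        (\<exists>\<alpha> \<beta>. is_pullback Q \<alpha> \<beta> \<gamma> c \<and> is_cokernel Q \<alpha>))" using c(5) by blast
    obtain k w where k: "(w, k) \<in> E" "Dom C w \<in> \<V>" "Cod C k = A" "Dom C k \<in> \<H>" "is_kernel_of Q (cl k) F"
      using kernel_representative[OF f(1-3)] f(4) by metis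
    have k': "k \<in> Hom C (Dom C k) A" using E_D[OF k(1)] k(3) by (simp add: Hom_def)
    have "\<exists>\<gamma> \<delta>. is_pushout Q (cl k) G \<gamma> \<delta> \<and> is_kernel Q \<delta>"
      if G: "G \<in> Arr Q" "Dom Q G = Dom Q (cl k)" for G
    proof -
      obtain g Z where "g \<in> Hom C (Dom C k) Z" "Z \<in> \<H>" "G = cl g"
        using core.Arr_QE[OF G(1)] G(2) core.cl_Dom(2)[OF k' k(4) f(2)] by metis
      then show ?thesis using pushout_deflation[OF k(1,2) _ k(4)] k(3) f(2) by simp
    qed
    then show "\<exists>k. is_kernel_of Q k F \<and> (\<forall>\<beta> \<in> Arr Q. Dom Q \<beta> = Dom Q k \<longrightarrow>
        (\<exists>\<gamma> \<delta>. is_pushout Q k \<beta> \<gamma> \<delta> \<and> is_kernel Q \<delta>))" using k(5) by blast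
  next
    fix \<alpha> \<beta> assume \<alpha>: "is_mono Q \<alpha>" and \<beta>: "\<beta> \<in> Arr Q" and dom: "Dom Q \<alpha> = Dom Q \<beta>"
    have "\<alpha> \<in> Arr Q" using \<alpha> by (simp add: is_mono_def)
    then obtain f A B where f: "f \<in> Hom C A B" "A \<in> \<H>" "B \<in> \<H>" "\<alpha> = cl f" "Dom Q \<alpha> = A" by (rule core.Arr_QE)
    obtain g B' where "g \<in> Hom C A B'" "B' \<in> \<H>" "\<beta> = cl g"
      using core.Arr_QE[OF \<beta>] dom f(5) by metis
    then show "\<exists>\<gamma> \<delta>. is_comm_square Q \<alpha> \<beta> \<gamma> \<delta> \<and> is_mono Q \<delta>"
      using pushout_mono[OF f(1-3)] \<alpha> f(4) by blast
  qed
qed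

end

lemma heart_op: "heart (op_cat C) (E\<inverse>) \<V> \<U> \<T> \<S> = op_cat (heart C E \<S> \<T> \<U> \<V>)"
  unfolding heart_def Let_def
  by (simp add: Int_commute full_subcat_op quot_cat_op)

theorem mainTheorem5:
  fixes C :: "('o, 'm) acat"
    and E :: "('m \<times> 'm) set"
    and \<S> \<T> \<U> \<V> :: "'o set"
  assumes "krull_schmidt_category C"
    and "exact_category C E"
    and "enough_projectives C E"
    and "enough_injectives C E"
    and "twin_cotorsion_pair C E \<S> \<T> \<U> \<V>"
    and "\<U> \<subseteq> \<T> \<or> \<T> \<subseteq> \<U>"
  shows "integral_category (heart C E \<S> \<T> \<U> \<V>) \<and>
         almost_abelian_category (heart C E \<S> \<T> \<U> \<V>)"
proof -
  interpret exact_category C E by fact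
  interpret st: split_cotorsion C E \<S> \<T>
    using assms(5) by (intro split_cotorsion) (simp add: twin_cotorsion_pair_def)
  interpret uv: split_cotorsion C E \<U> \<V>
    using assms(5) by (intro split_cotorsion) (simp add: twin_cotorsion_pair_def)
  have add: "is_additive_subcat C \<U>" "is_additive_subcat C \<T>" and SU: "\<S> \<subseteq> \<U>"
    using assms(5) by (simp_all add: twin_cotorsion_pair_def cotorsion_pair_def)
  show ?thesis
    using assms(6)
  proof
    assume UT: "\<U> \<subseteq> \<T>"
    interpret twin_cotorsion C E \<S> \<T> \<U> \<V>
    proof
      show "\<exists>Z \<in> \<U>. is_zero_obj C Z" using additive_subcat_zero[OF add(1)] by blast
    qed (use SU UT additive_subcat_sum[OF add(1)] in auto)
    have "heart C E \<S> \<T> \<U> \<V> = Q"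
    proof -
      have "\<T> \<inter> \<U> = \<U>" using UT by auto
      moreover have "Obj C \<inter> B_minus C E \<U> \<S> = B_minus C E \<U> \<S>" by (auto simp: B_minus_def)
      ultimately show ?thesis by (simp add: heart_def B_plus_all)
    qed
    then show ?thesis using integral_almost_abelian by simp
  next
    assume TU: "\<T> \<subseteq> \<U>"
    \<comment> \<open>In the opposite category \<open>\<V> \<subseteq> \<T>\<close> is the inclusion between the two cotorsion pairs.\<close>
    have VT: "\<V> \<subseteq> \<T>"
    proof
      fix X assume X: "X \<in> \<V>"
      show "X \<in> \<T>"
      proof (rule st.\<V>I)
        show "X \<in> Obj C" using X uv.\<V>_Obj by auto
        fix i p assume "(i, p) \<in> E" "Cod C p \<in> \<S>" "Dom C i = X"
        then show "\<exists>r \<in> Hom C (Cod C i) X. r \<cdot>\<^bsub>C\<^esub> i = Ide C X"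
          using uv.split[of i p] X SU unfolding is_biprod_def by blast
      qed
    qed
    interpret op_st: split_cotorsion "op_cat C" "E\<inverse>" \<T> \<S> by (rule st.split_cotorsion_op)
    interpret op_uv: split_cotorsion "op_cat C" "E\<inverse>" \<V> \<U> by (rule uv.split_cotorsion_op)
    interpret op: twin_cotorsion "op_cat C" "E\<inverse>" \<V> \<U> \<T> \<S>
    proof
      show "\<exists>Z \<in> \<T>. is_zero_obj (op_cat C) Z" using additive_subcat_zero[OF add(2)] by auto
    qed (use VT TU additive_subcat_sum[OF add(2)] in auto)
    have "heart (op_cat C) (E\<inverse>) \<V> \<U> \<T> \<S> = op.Q"
    proof -
      have "\<U> \<inter> \<T> = \<T>" using TU by auto
      moreover have "Obj C \<inter> B_plus C E \<T> \<V> = B_plus C E \<T> \<V>" by (auto simp: B_plus_def)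
      moreover have "B_minus C E \<T> \<S> = Obj C" using op.B_plus_all by simp
      ultimately show ?thesis by (simp add: heart_def)
    qed
    then have "integral_category (op_cat (heart C E \<S> \<T> \<U> \<V>))"
      "almost_abelian_category (op_cat (heart C E \<S> \<T> \<U> \<V>))"
      using op.integral_almost_abelian by (simp_all add: heart_op)
    then show ?thesis using integral_category_op almost_abelian_category_op by fastforce
  qed
qed

end
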